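(* Consider the Greedy-GQ iterates run for horizon $T$ with constant stepsizes $\alpha_t=T^{-a}$, $\beta_t=T^{-b}$ for $0\le t\le T$, and let $M$ be a random index, independent of the sample trajectory, with $\mathbb{P}(M=k)=\frac{\alpha_k}{\sum_{t=0}^T\alpha_t}$ for $k\in\{0,1,\dots,T\}$. Among all $(a,b)$ with $\frac12<a\le1$ and $0<b\le a$, the best rate of the bound $$\mathbb{E}\big[\|\nabla J(\theta_M)\|^2\big]=\mathcal{O}\left(\frac{1}{T^{1-a}}+\frac{\log T}{T^{\min\{b,a-b\}}}\right)$$ (that is, the largest value of the decay exponent $\min\{1-a,\,b,\,a-b\}$) is obtained at $a=\frac23$, $b=\frac13$, and with this choice $$\mathbb{E}\big[\|\nabla J(\theta_M)\|^2\big]=\mathcal{O}\left(\frac{\log T}{T^{1/3}}\right),$$ where the constants hidden in $\mathcal O(\cdot)$ do not depend on $T$ (and $T\ge2$).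
   Context: Setting. An MDP has state space $\mathcal S\subset\mathbb R^d$, finite action set $\mathcal A$, transition kernel $\mathsf P(\cdot|s,a)$, discount factor $\gamma\in(0,1)$, and reward $r:\mathcal S\times\mathcal A\times\mathcal S\to[0,r_{\max}]$. Features $\phi_{s,a}\in\mathbb R^N$ are given and $Q_\theta(s,a)=\phi_{s,a}^\top\theta$, $\theta\in\mathbb R^N$. A fixed behavior policy $\pi_b$ generates a single trajectory: $s_0$ is given, $a_t\sim\pi_b(\cdot|s_t)$, $s_{t+1}\sim\mathsf P(\cdot|s_t,a_t)$, $r_t=r(s_t,a_t,s_{t+1})$. The Markov chain $(s_t,a_t)$ is uniformly ergodic with invariant measure $\mu$ on $\mathcal S\times\mathcal A$. A parameterized target policy $\pi_\theta(\cdot|s)$, differentiable in $\theta$, is given. Notation. $\|\cdot\|$ is the Euclidean norm. $\bar V_{s'}(\theta)=\sum_{a'\in\mathcal A}\pi_\theta(a'|s')\theta^\top\phi_{s',a'}$; $\delta_{s,a,s'}(\theta)=r(s,a,s')+\gamma\bar V_{s'}(\theta)-\theta^\top\phi_{s,a}$; $\hat\phi_{s'}(\theta)=\nabla_\theta\bar V_{s'}(\theta)=\sum_{a'\in\mathcal A}\big(\theta^\top\phi_{s',a'}\nabla\pi_\theta(a'|s')+\pi_\theta(a'|s')\phi_{s',a'}\big)$; $C=\mathbb E_\mu[\phi_{S,A}\phi_{S,A}^\top]$. The objective (mean squared projected Bellman error) is $$J(\theta)=\mathbb E_\mu[\delta_{S,A,S'}(\theta)\phi_{S,A}]^\top C^{-1}\,\mathbb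 E_\mu[\delta_{S,A,S'}(\theta)\phi_{S,A}],$$ where $\mathbb E_\mu$ means $(S,A)\sim\mu$, $S'\sim\mathsf P(\cdot|S,A)$. Greedy-GQ algorithm. From given $\theta_0,\omega_0\in\mathbb R^N$, with $\phi_t=\phi_{s_t,a_t}$, $\delta_{t+1}(\theta)=\delta_{s_t,a_t,s_{t+1}}(\theta)$, $\hat\phi_{t+1}(\theta)=\hat\phi_{s_{t+1}}(\theta)$, $$\theta_{t+1}=\theta_t+\alpha_t\big(\delta_{t+1}(\theta_t)\phi_t-\gamma(\omega_t^\top\phi_t)\hat\phi_{t+1}(\theta_t)\big),\qquad \omega_{t+1}=\omega_t+\beta_t\big(\delta_{t+1}(\theta_t)-\phi_t^\top\omega_t\big)\phi_t.$$ Standing assumptions. (1) $C$ is non-singular. (2) $\|\phi_{s,a}\|\le1$ for all $(s,a)$. (3) There are $m>0$, $\rho\in(0,1)$ with $\sup_{s\in\mathcal S}d_{TV}(\mathbb P(s_t\in\cdot\,|s_0=s),\mu)\le m\rho^t$ for all $t>0$, where $d_{TV}$ is total variation distance and $\mu$ here denotes its marginal on $\mathcal S$. (4) For constants $k_1,k_2$ and all $(s,a)$: $\|\nabla\pi_\theta(a|s)\|\le k_1$ for all $\theta$, and $\|\nabla\pi_{\theta_1}(a|s)-\nabla\pi_{\theta_2}(a|s)\|\le k_2\|\theta_1-\theta_2\|$ for all $\theta_1,\theta_2$. (5) There is a constant $R$ (independent of $T$) such that $\|\theta_t\|\le R$ and $\|\omega_t\|\le R$ almost surely for all $t$. *)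

theory Defs
  imports "HOL-Probability.Probability"
begin

section \<open>Gradients, total variation, Markov kernels\<close>

definition gradient :: "('v::real_inner \<Rightarrow> real) \<Rightarrow> 'v \<Rightarrow> 'v" where
  "gradient f x = (THE D. GDERIV f x :> D)"

lemma gradient_eqI:
  assumes "GDERIV f x :> D"
  shows "gradient f x = D"
  unfolding gradient_def
proof (rule the_equality[where P = "\<lambda>D. GDERIV f x :> D", OF assms])
  fix D' assume "GDERIV f x :> D'"
  then have "(\<lambda>h. h \<bullet> D') = (\<lambda>h. h \<bullet> D)"
    using assms unfolding gderiv_def by (rule has_derivative_unique)
  then show "D' = D"
    by (metis inner_commute vector_eq_rdot)
qed

lemma GDERIV_gradient:
  fixes f :: "'v::euclidean_space \<Rightarrow> real"
  assumes "f differentiable (at x)"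
  shows "GDERIV f x :> gradient f x"
proof -
  from assms obtain L where L: "(f has_derivative L) (at x)"
    by (auto simp: differentiable_def)
  then interpret L: bounded_linear L by (rule has_derivative_bounded_linear)
  have "L h = h \<bullet> (\<Sum>i\<in>Basis. L i *\<^sub>R i)" for h
  proof -
    have "L h = L (\<Sum>i\<in>Basis. (h \<bullet> i) *\<^sub>R i)" by (simp add: euclidean_representation)
    then show ?thesis
      by (simp add: L.sum L.scaleR inner_sum_right mult.commute)
  qed
  then have "L = (\<lambda>h. h \<bullet> (\<Sum>i\<in>Basis. L i *\<^sub>R i))" by blast
  with L have "GDERIV f x :> (\<Sum>i\<in>Basis. L i *\<^sub>R i)"
    unfolding gderiv_def by simp
  then show ?thesis using gradient_eqI by metis
qed

definition tv_dist :: "'x measure \<Rightarrow> 'x measure \<Rightarrow> real" where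
  "tv_dist M N = (SUP A\<in>sets M. \<bar>measure M A - measure N A\<bar>)"

primrec kernel_pow :: "'x measure \<Rightarrow> ('x \<Rightarrow> 'x measure) \<Rightarrow> nat \<Rightarrow> 'x \<Rightarrow> 'x measure" where
  "kernel_pow N K 0 x = return N x"
| "kernel_pow N K (Suc n) x = kernel_pow N K n x \<bind> K"

definition invariant_measure :: "'x measure \<Rightarrow> ('x \<Rightarrow> 'x measure) \<Rightarrow> 'x measure \<Rightarrow> bool" where
  "invariant_measure N K \<mu> \<longleftrightarrow> \<mu> \<in> space (prob_algebra N) \<and> \<mu> \<bind> K = \<mu>"

definition uniformly_ergodic :: "'x measure \<Rightarrow> ('x \<Rightarrow> 'x measure) \<Rightarrow> 'x measure \<Rightarrow> bool" where
  "uniformly_ergodic N K \<mu> \<longleftrightarrow>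
     invariant_measure N K \<mu> \<and>
     (\<lambda>t. SUP x\<in>space N. tv_dist (kernel_pow N K t x) \<mu>) \<longlonglongrightarrow> 0"


section \<open>The Markov decision process and its trajectories\<close>

abbreviation state_space :: "(real^'d) set \<Rightarrow> (real^'d) measure" where
  "state_space S \<equiv> restrict_space borel S"

abbreviation sa_space :: "(real^'d) set \<Rightarrow> ((real^'d) \<times> 'a::finite) measure" where
  "sa_space S \<equiv> state_space S \<Otimes>\<^sub>M count_space UNIV"

definition state_kernel ::
  "((real^'d) \<times> 'a::finite \<Rightarrow> (real^'d) measure) \<Rightarrow> (real^'d \<Rightarrow> 'a pmf) \<Rightarrow>
   real^'d \<Rightarrow> (real^'d) measure" where
  "state_kernel P \<pi>b s = measure_pmf (\<pi>b s) \<bind> (\<lambda>a. P (s, a))"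

definition sa_kernel ::
  "(real^'d) set \<Rightarrow> ((real^'d) \<times> 'a::finite \<Rightarrow> (real^'d) measure) \<Rightarrow> (real^'d \<Rightarrow> 'a pmf) \<Rightarrow>
   (real^'d) \<times> 'a \<Rightarrow> ((real^'d) \<times> 'a) measure" where
  "sa_kernel S P \<pi>b x =
     P x \<bind> (\<lambda>s'. measure_pmf (\<pi>b s') \<bind> (\<lambda>a'. return (sa_space S) (s', a')))"

text \<open>The \<open>\<sigma>\<close>-algebra generated by the first \<open>n\<close> states and the first \<open>m\<close> actions.\<close>

definition history ::
  "'w measure \<Rightarrow> (real^'d) set \<Rightarrow> (nat \<Rightarrow> 'w \<Rightarrow> real^'d) \<Rightarrow> (nat \<Rightarrow> 'w \<Rightarrow> 'a::finite) \<Rightarrow>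
   nat \<Rightarrow> nat \<Rightarrow> 'w measure" where
  "history M S st act n m = sigma (space M)
     ({st i -` B \<inter> space M | i B. i < n \<and> B \<in> sets (state_space S)} \<union>
      {act j -` B \<inter> space M | j B. j < m})"

text \<open>
  The trajectory generated by the behaviour policy \<open>\<pi>b\<close>: the conditional law of
  \<open>a\<^sub>t\<close> given \<open>s\<^sub>0, a\<^sub>0, \<dots>, s\<^sub>t\<close> is \<open>\<pi>b(\<cdot>|s\<^sub>t)\<close>, and the conditional law of \<open>s\<^bsub>t+1\<^esub>\<close>
  given \<open>s\<^sub>0, a\<^sub>0, \<dots>, s\<^sub>t, a\<^sub>t\<close> is \<open>P(\<cdot>|s\<^sub>t, a\<^sub>t)\<close>.
\<close>

definition trajectory ::
  "'w measure \<Rightarrow> (real^'d) set \<Rightarrow> ((real^'d) \<times> 'a::finite \<Rightarrow> (real^'d) measure) \<Rightarrow>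
   (real^'d \<Rightarrow> 'a pmf) \<Rightarrow> real^'d \<Rightarrow> (nat \<Rightarrow> 'w \<Rightarrow> real^'d) \<Rightarrow> (nat \<Rightarrow> 'w \<Rightarrow> 'a) \<Rightarrow> bool" where
  "trajectory M S P \<pi>b s0 st act \<longleftrightarrow>
     (\<forall>t. st t \<in> M \<rightarrow>\<^sub>M state_space S) \<and>
     (\<forall>t. act t \<in> M \<rightarrow>\<^sub>M count_space UNIV) \<and>
     (AE w in M. st 0 w = s0) \<and>
     (\<forall>t B. AE w in M.
        real_cond_exp M (history M S st act (Suc t) t) (\<lambda>w. indicator B (act t w)) w
          = measure (measure_pmf (\<pi>b (st t w))) B) \<and>
     (\<forall>t. \<forall>B\<in>sets (state_space S). AE w in M.
        real_cond_exp M (history M S st act (Suc t) (Suc t)) (\<lambda>w. indicator B (st (Suc t) w)) w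
          = measure (P (st t w, act t w)) B)"


section \<open>The objective\<close>

definition Vbar ::
  "(real^'d \<Rightarrow> 'a::finite \<Rightarrow> real^'n) \<Rightarrow> (real^'n \<Rightarrow> real^'d \<Rightarrow> 'a pmf) \<Rightarrow> real^'d \<Rightarrow> real^'n \<Rightarrow> real"
  where "Vbar \<phi> \<pi> s' \<theta> = (\<Sum>a'\<in>UNIV. pmf (\<pi> \<theta> s') a' * (\<theta> \<bullet> \<phi> s' a'))"

definition td_error ::
  "real \<Rightarrow> (real^'d \<Rightarrow> 'a \<Rightarrow> real^'d \<Rightarrow> real) \<Rightarrow> (real^'d \<Rightarrow> 'a::finite \<Rightarrow> real^'n) \<Rightarrow>
   (real^'n \<Rightarrow> real^'d \<Rightarrow> 'a pmf) \<Rightarrow> real^'d \<Rightarrow> 'a \<Rightarrow> real^'d \<Rightarrow> real^'n \<Rightarrow> real"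
  where "td_error \<gamma> r \<phi> \<pi> s a s' \<theta> = r s a s' + \<gamma> * Vbar \<phi> \<pi> s' \<theta> - \<theta> \<bullet> \<phi> s a"

definition phi_hat ::
  "(real^'d \<Rightarrow> 'a::finite \<Rightarrow> real^'n) \<Rightarrow> (real^'n \<Rightarrow> real^'d \<Rightarrow> 'a pmf) \<Rightarrow> real^'d \<Rightarrow> real^'n \<Rightarrow> real^'n"
  where "phi_hat \<phi> \<pi> s' \<theta> =
    (\<Sum>a'\<in>UNIV. (\<theta> \<bullet> \<phi> s' a') *\<^sub>R gradient (\<lambda>\<theta>'. pmf (\<pi> \<theta>' s') a') \<theta>
                + pmf (\<pi> \<theta> s') a' *\<^sub>R \<phi> s' a')"

lemma gradient_Vbar:
  assumes "\<And>a'. (\<lambda>\<theta>'. pmf (\<pi> \<theta>' s') a') differentiable (at \<theta>)"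
  shows "gradient (Vbar \<phi> \<pi> s') \<theta> = phi_hat \<phi> \<pi> s' \<theta>"
proof (rule gradient_eqI)
  have "GDERIV (\<lambda>\<theta>'. pmf (\<pi> \<theta>' s') a' * (\<theta>' \<bullet> \<phi> s' a')) \<theta> :>
      (\<theta> \<bullet> \<phi> s' a') *\<^sub>R gradient (\<lambda>\<theta>'. pmf (\<pi> \<theta>' s') a') \<theta> + pmf (\<pi> \<theta> s') a' *\<^sub>R \<phi> s' a'" for a'
  proof -
    have "GDERIV (\<lambda>\<theta>'. \<theta>' \<bullet> \<phi> s' a') \<theta> :> \<phi> s' a'"
      unfolding gderiv_def by (intro derivative_intros)
    from GDERIV_mult[OF GDERIV_gradient[OF assms[of a']] this] show ?thesis
      by (simp add: add.commute)
  qed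
  then show "GDERIV (Vbar \<phi> \<pi> s') \<theta> :> phi_hat \<phi> \<pi> s' \<theta>"
    unfolding gderiv_def Vbar_def phi_hat_def inner_sum_right
    by (intro has_derivative_sum) auto
qed

definition feature_cov ::
  "((real^'d) \<times> 'a) measure \<Rightarrow> (real^'d \<Rightarrow> 'a \<Rightarrow> real^'n) \<Rightarrow> real^'n^'n"
  where "feature_cov \<mu> \<phi> = (LINT (s, a)|\<mu>. (\<chi> i j. \<phi> s a $ i * \<phi> s a $ j))"

definition mean_td ::
  "((real^'d) \<times> 'a::finite) measure \<Rightarrow> ((real^'d) \<times> 'a \<Rightarrow> (real^'d) measure) \<Rightarrow> real \<Rightarrow>
   (real^'d \<Rightarrow> 'a \<Rightarrow> real^'d \<Rightarrow> real) \<Rightarrow> (real^'d \<Rightarrow> 'a \<Rightarrow> real^'n) \<Rightarrow>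
   (real^'n \<Rightarrow> real^'d \<Rightarrow> 'a pmf) \<Rightarrow> real^'n \<Rightarrow> real^'n"
  where "mean_td \<mu> P \<gamma> r \<phi> \<pi> \<theta> =
    (LINT (s, a)|\<mu>. LINT s'|P (s, a). td_error \<gamma> r \<phi> \<pi> s a s' \<theta> *\<^sub>R \<phi> s a)"

definition mspbe ::
  "((real^'d) \<times> 'a::finite) measure \<Rightarrow> ((real^'d) \<times> 'a \<Rightarrow> (real^'d) measure) \<Rightarrow> real \<Rightarrow>
   (real^'d \<Rightarrow> 'a \<Rightarrow> real^'d \<Rightarrow> real) \<Rightarrow> (real^'d \<Rightarrow> 'a \<Rightarrow> real^'n) \<Rightarrow>
   (real^'n \<Rightarrow> real^'d \<Rightarrow> 'a pmf) \<Rightarrow> real^'n \<Rightarrow> real"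
  where "mspbe \<mu> P \<gamma> r \<phi> \<pi> \<theta> =
    mean_td \<mu> P \<gamma> r \<phi> \<pi> \<theta> \<bullet> (matrix_inv (feature_cov \<mu> \<phi>) *v mean_td \<mu> P \<gamma> r \<phi> \<pi> \<theta>)"


section \<open>Greedy-GQ\<close>

text \<open>The pair \<open>(\<theta>\<^sub>t, \<omega>\<^sub>t)\<close> along a fixed sample path \<open>s\<close>, \<open>a\<close>.\<close>

primrec greedy_gq ::
  "real \<Rightarrow> (real^'d \<Rightarrow> 'a::finite \<Rightarrow> real^'d \<Rightarrow> real) \<Rightarrow> (real^'d \<Rightarrow> 'a \<Rightarrow> real^'n) \<Rightarrow>
   (real^'n \<Rightarrow> real^'d \<Rightarrow> 'a pmf) \<Rightarrow> (nat \<Rightarrow> real) \<Rightarrow> (nat \<Rightarrow> real) \<Rightarrow> real^'n \<Rightarrow> real^'n \<Rightarrow>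
   (nat \<Rightarrow> real^'d) \<Rightarrow> (nat \<Rightarrow> 'a) \<Rightarrow> nat \<Rightarrow> (real^'n) \<times> (real^'n)" where
  "greedy_gq \<gamma> r \<phi> \<pi> \<alpha> \<beta> \<theta>0 \<omega>0 s a 0 = (\<theta>0, \<omega>0)"
| "greedy_gq \<gamma> r \<phi> \<pi> \<alpha> \<beta> \<theta>0 \<omega>0 s a (Suc t) =
    (let (\<theta>, \<omega>) = greedy_gq \<gamma> r \<phi> \<pi> \<alpha> \<beta> \<theta>0 \<omega>0 s a t;
         f = \<phi> (s t) (a t);
         \<delta> = td_error \<gamma> r \<phi> \<pi> (s t) (a t) (s (Suc t)) \<theta>
     in (\<theta> + \<alpha> t *\<^sub>R (\<delta> *\<^sub>R f - (\<gamma> * (\<omega> \<bullet> f)) *\<^sub>R phi_hat \<phi> \<pi> (s (Suc t)) \<theta>),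
         \<omega> + \<beta> t *\<^sub>R ((\<delta> - f \<bullet> \<omega>) *\<^sub>R f)))"

definition const_step :: "real \<Rightarrow> nat \<Rightarrow> nat \<Rightarrow> real" where
  "const_step c T t = real T powr (- c)"

text \<open>
  The random iterates for horizon \<open>T\<close> with stepsizes \<open>\<alpha>\<^sub>t = T\<^bsup>-a\<^esup>\<close>, \<open>\<beta>\<^sub>t = T\<^bsup>-b\<^esup>\<close>,
  as functions of the sample point \<open>w\<close>.
\<close>

definition gq_run ::
  "real \<Rightarrow> (real^'d \<Rightarrow> 'a::finite \<Rightarrow> real^'d \<Rightarrow> real) \<Rightarrow> (real^'d \<Rightarrow> 'a \<Rightarrow> real^'n) \<Rightarrow>
   (real^'n \<Rightarrow> real^'d \<Rightarrow> 'a pmf) \<Rightarrow> real^'n \<Rightarrow> real^'n \<Rightarrow>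
   (nat \<Rightarrow> 'w \<Rightarrow> real^'d) \<Rightarrow> (nat \<Rightarrow> 'w \<Rightarrow> 'a) \<Rightarrow> real \<Rightarrow> real \<Rightarrow> nat \<Rightarrow>
   nat \<Rightarrow> 'w \<Rightarrow> (real^'n) \<times> (real^'n)" where
  "gq_run \<gamma> r \<phi> \<pi> \<theta>0 \<omega>0 st act a b T t w =
     greedy_gq \<gamma> r \<phi> \<pi> (const_step a T) (const_step b T) \<theta>0 \<omega>0 (\<lambda>i. st i w) (\<lambda>i. act i w) t"

text \<open>The almost sure bound on the iterates of a run, with one constant for all horizons.\<close>

definition gq_bounded ::
  "'w measure \<Rightarrow> real \<Rightarrow> (real^'d \<Rightarrow> 'a::finite \<Rightarrow> real^'d \<Rightarrow> real) \<Rightarrow>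
   (real^'d \<Rightarrow> 'a \<Rightarrow> real^'n) \<Rightarrow> (real^'n \<Rightarrow> real^'d \<Rightarrow> 'a pmf) \<Rightarrow> real^'n \<Rightarrow> real^'n \<Rightarrow>
   (nat \<Rightarrow> 'w \<Rightarrow> real^'d) \<Rightarrow> (nat \<Rightarrow> 'w \<Rightarrow> 'a) \<Rightarrow> real \<Rightarrow> real \<Rightarrow> bool" where
  "gq_bounded M \<gamma> r \<phi> \<pi> \<theta>0 \<omega>0 st act a b \<longleftrightarrow>
     (\<exists>R. \<forall>T\<ge>2. \<forall>t\<le>T. AE w in M.
        norm (fst (gq_run \<gamma> r \<phi> \<pi> \<theta>0 \<omega>0 st act a b T t w)) \<le> R \<and>
        norm (snd (gq_run \<gamma> r \<phi> \<pi> \<theta>0 \<omega>0 st act a b T t w)) \<le> R)"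

definition output_index ::
  "'w measure \<Rightarrow> (real^'d) set \<Rightarrow> (nat \<Rightarrow> 'w \<Rightarrow> real^'d) \<Rightarrow> (nat \<Rightarrow> 'w \<Rightarrow> 'a::finite) \<Rightarrow>
   (nat \<Rightarrow> real) \<Rightarrow> nat \<Rightarrow> ('w \<Rightarrow> nat) \<Rightarrow> bool" where
  "output_index M S st act \<alpha> T idx \<longleftrightarrow>
     prob_space.indep_set M
       (sets (vimage_algebra (space M) idx (count_space UNIV)))
       (sets (vimage_algebra (space M) (\<lambda>w t. (st t w, act t w)) (Pi\<^sub>M UNIV (\<lambda>_. sa_space S)))) \<and>
     (\<forall>k\<le>T. measure M {w \<in> space M. idx w = k} = \<alpha> k / (\<Sum>t=0..T. \<alpha> t))"

definition sq_grad_at_output ::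
  "((real^'d) \<times> 'a::finite) measure \<Rightarrow> ((real^'d) \<times> 'a \<Rightarrow> (real^'d) measure) \<Rightarrow> real \<Rightarrow>
   (real^'d \<Rightarrow> 'a \<Rightarrow> real^'d \<Rightarrow> real) \<Rightarrow> (real^'d \<Rightarrow> 'a \<Rightarrow> real^'n) \<Rightarrow>
   (real^'n \<Rightarrow> real^'d \<Rightarrow> 'a pmf) \<Rightarrow> real^'n \<Rightarrow> real^'n \<Rightarrow>
   (nat \<Rightarrow> 'w \<Rightarrow> real^'d) \<Rightarrow> (nat \<Rightarrow> 'w \<Rightarrow> 'a) \<Rightarrow> real \<Rightarrow> real \<Rightarrow> nat \<Rightarrow>
   ('w \<Rightarrow> nat) \<Rightarrow> 'w \<Rightarrow> real" where
  "sq_grad_at_output \<mu> P \<gamma> r \<phi> \<pi> \<theta>0 \<omega>0 st act a b T idx w =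
     (norm (gradient (mspbe \<mu> P \<gamma> r \<phi> \<pi>)
        (fst (gq_run \<gamma> r \<phi> \<pi> \<theta>0 \<omega>0 st act a b T (idx w) w))))\<^sup>2"

end

(*
  Write x = (\<theta>, \<omega>) for an iterate, \<omega>*(\<theta>) = C^-1 E[\<delta> \<phi>] for the ideal second iterate and
  z = \<omega> - \<omega>*(\<theta>) for the tracking error.  Since \<nabla>J(\<theta>) = -2 E[G(\<theta>, \<omega>*(\<theta>))] for the update
  direction G of \<theta>, the smoothness of J and the positive definiteness of C give, with
  W = J/\<alpha> + \<kappa> |z|^2 / (2 \<beta>), the drift inequality
    |\<nabla>J(\<theta>_t)|^2 / 4 <= W_t - W_{t+1} + N(x_t, O_t) + O(\<beta> + \<alpha>/\<beta>),
  where the noise N(x, .) is centred under the stationary law of an observation O = ((s, a), s'),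
  bounded, and Lipschitz in x.  Replacing x_t by x_{t-\<tau>} with \<tau> ~ ln T / ln (1/\<rho>) costs O(\<tau> \<beta>), and
  conditionally on the history up to time t - \<tau> the mean of N(x_{t-\<tau>}, O_t) is O(\<rho>^\<tau>) by mixing.
  Summing over t < T and dividing by T gives the rate.
*)
theory Submission
  imports Defs
begin

section \<open>Kernels, conditional expectations and total variation\<close>

text \<open>Everything is read off one trajectory, so an iterate is correlated with the observation
  that drives it, while the mixing hypothesis speaks of the state marginal only. Two facts bridge
  this gap. Given the past just before the action at time t, the mean of a function of the
  observation depends on the past only through the current state and the past datum carried along
  (\<open>cond_step\<close>). And invariance of \<mu> forces its actions to follow the behaviour
  policy, so averaging \<open>cond_step\<close> over the state marginal of \<mu> gives the
  stationary mean. The tracking error biases the gradient step by at most a constant times |z|,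
  which Young's inequality turns into a multiple of |z|^2. The weight \<kappa> is the one for which
  the contraction of |z|^2, due to positive definiteness of C, absorbs exactly this multiple. The
  target \<open>omega_star\<close> itself moves by O(\<alpha>) per step; measured against the
  contraction rate \<beta>, this is the \<alpha>/\<beta> term. The iterates are bounded only almost
  surely, so all estimates are made for iterates clipped to a ball.\<close>

lemma integral_bind_prob_algebra:
  fixes f :: "'y \<Rightarrow> real"
  assumes M: "M \<in> space (prob_algebra A)" and N: "N \<in> A \<rightarrow>\<^sub>M prob_algebra K"
    and f: "f \<in> borel_measurable K" and bd: "\<And>x. x \<in> space K \<Longrightarrow> \<bar>f x\<bar> \<le> B"
  shows "(\<integral>x. f x \<partial>(M \<bind> N)) = (\<integral>x. (\<integral>y. f y \<partial>N x) \<partial>M)"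
proof (rule integral_bind[where K=K and B=B and B'=1])
  have sM: "sets M = sets A" and pM: "prob_space M"
    using M by (auto simp: space_prob_algebra)
  show "N \<in> M \<rightarrow>\<^sub>M subprob_algebra K"
    using measurable_prob_algebraD[OF N] by (simp add: measurable_cong_sets[OF sM refl])
  show "finite_measure M" using pM by (rule prob_space.finite_measure)
  show "AE x in M. emeasure (N x) (space (N x)) \<le> ennreal 1"
  proof (rule AE_I2)
    fix x assume "x \<in> space M"
    then have "x \<in> space A" using sets_eq_imp_space_eq[OF sM] by simp
    then have "prob_space (N x)" using measurable_space[OF N] by (auto simp: space_prob_algebra)
    then show "emeasure (N x) (space (N x)) \<le> ennreal 1" by (simp add: prob_space.emeasure_space_1)
  qed
qed (use f bd in auto)

lemma integrable_bounded_prob: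
  fixes f :: "'y \<Rightarrow> 'b::{banach, second_countable_topology}"
  assumes "prob_space M" "f \<in> borel_measurable M" "\<And>x. x \<in> space M \<Longrightarrow> norm (f x) \<le> B"
  shows "integrable M f"
proof -
  interpret prob_space M by fact
  show ?thesis by (rule integrable_const_bound[of f B]) (use assms in auto)
qed

lemma norm_integral_le_prob:
  fixes f :: "'y \<Rightarrow> 'b::{banach, second_countable_topology}"
  assumes "prob_space M" "f \<in> borel_measurable M" "\<And>x. x \<in> space M \<Longrightarrow> norm (f x) \<le> B"
  shows "norm (\<integral>x. f x \<partial>M) \<le> B"
proof -
  interpret prob_space M by fact
  have i: "integrable M f" by (rule integrable_bounded_prob) (use assms in auto)
  have "norm (\<integral>x. f x \<partial>M) \<le> (\<integral>x. norm (f x) \<partial>M)" by simp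
  also have "\<dots> \<le> (\<integral>x. B \<partial>M)"
    by (rule integral_mono) (use assms i in auto)
  finally show ?thesis by (simp add: prob_space)
qed

section \<open>Total variation as a bound on differences of integrals\<close>

lemma abs_measure_diff_le_tv_dist:
  assumes "prob_space M" "prob_space N" "A \<in> sets M"
  shows "\<bar>measure M A - measure N A\<bar> \<le> tv_dist M N"
  unfolding tv_dist_def
proof (rule cSUP_upper[OF assms(3)], rule bdd_aboveI2)
  fix A
  show "\<bar>measure M A - measure N A\<bar> \<le> 1"
    using prob_space.prob_le_1[OF assms(1), of A] prob_space.prob_le_1[OF assms(2), of A]
      measure_nonneg[of M A] measure_nonneg[of N A] by linarith
qed

text \<open>The level sets \<open>{g \<ge> k/n}\<close> approximate \<open>g\<close> uniformly up to \<open>1/n\<close>.\<close>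

lemma integral_diff_le_tv_dist_unit:
  fixes g :: "'y \<Rightarrow> real"
  assumes M: "prob_space M" and N: "prob_space N" and s: "sets N = sets M"
    and g: "g \<in> borel_measurable M" and b: "\<And>x. x \<in> space M \<Longrightarrow> 0 \<le> g x \<and> g x \<le> 1"
  shows "\<bar>(\<integral>x. g x \<partial>M) - (\<integral>x. g x \<partial>N)\<bar> \<le> tv_dist M N"
proof -
  interpret M: prob_space M by fact
  interpret N: prob_space N by fact
  have sp: "space N = space M" using s by (rule sets_eq_imp_space_eq)
  have gN: "g \<in> borel_measurable N" using g by (simp add: measurable_cong_sets[OF s refl])
  have approx: "\<bar>(\<integral>x. g x \<partial>M) - (\<integral>x. g x \<partial>N)\<bar> \<le> tv_dist M N + 2 * inverse (real (Suc m))" for m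
  proof -
    define n where "n = Suc m"
    define L where "L k = {x \<in> space M. real k \<le> real n * g x}" for k
    define u where "u x = (\<Sum>k\<in>{1..n}. indicator (L k) x) / real n" for x
    have L: "L k \<in> sets M" for k unfolding L_def using g by measurable
    have LN: "L k \<in> sets N" for k using L s by simp
    have ux: "\<bar>g x - u x\<bar> \<le> 1 / real n" if x: "x \<in> space M" for x
    proof -
      \<comment> \<open>The levels in 1..n whose set contains x are exactly 1..j, so
        \<open>u x\<close> is \<open>n * g x\<close> rounded down and divided by n.\<close>
      define j where "j = nat \<lfloor>real n * g x\<rfloor>"
      have ng: "0 \<le> real n * g x" "real n * g x \<le> real n"
        using b[OF x] by (auto simp: mult_left_le)
      have "(\<Sum>k\<in>{1..n}. indicator (L k) x) = (\<Sum>k\<in>{1..n}. if k \<in> {1..j} then 1 else (0::real))"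
      proof (rule sum.cong[OF refl])
        fix k assume "k \<in> {1..n}"
        moreover have "k \<le> j \<longleftrightarrow> real k \<le> real n * g x" unfolding j_def using ng by linarith
        ultimately show "indicator (L k) x = (if k \<in> {1..j} then 1 else (0::real))"
          using x by (auto simp: L_def indicator_def)
      qed
      also have "\<dots> = real (card ({1..n} \<inter> {1..j}))"
        by (simp only: sum.inter_restrict[symmetric] finite_atLeastAtMost) simp
      also have "{1..n} \<inter> {1..j} = {1..j}"
      proof -
        have "j \<le> n" unfolding j_def using ng by linarith
        then show ?thesis by auto
      qed
      finally have "u x = real j / real n" unfolding u_def by simp
      moreover have "real j \<le> real n * g x" "real n * g x \<le> real j + 1" unfolding j_def using ng by linarith+
      moreover have "g x = real n * g x / real n" unfolding n_def by simp
      ultimately have "\<bar>g x - u x\<bar> = \<bar>real n * g x - real j\<bar> / real n"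
        by (metis abs_divide abs_of_nat diff_divide_distrib)
      also have "\<dots> \<le> 1 / real n"
        using \<open>real j \<le> real n * g x\<close> \<open>real n * g x \<le> real j + 1\<close> by (intro divide_right_mono) auto
      finally show ?thesis .
    qed
    have iu: "(\<integral>x. u x \<partial>Q) = (\<Sum>k\<in>{1..n}. measure Q (L k)) / real n" "integrable Q u"
      if "prob_space Q" "\<And>k. L k \<in> sets Q" for Q
    proof -
      interpret prob_space Q by fact
      have i: "integrable Q (indicator (L k) :: _ \<Rightarrow> real)" for k
        using that(2)[of k] by (auto simp: integrable_indicator_iff emeasure_eq_measure)
      show "(\<integral>x. u x \<partial>Q) = (\<Sum>k\<in>{1..n}. measure Q (L k)) / real n"
        unfolding u_def using i that(2) sets.sets_into_space[OF that(2)]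
        by (simp add: Bochner_Integration.integral_sum Int_absorb2)
      show "integrable Q u" unfolding u_def using i by auto
    qed
    have gi: "integrable M g" "integrable N g"
      by (rule integrable_bounded_prob[where B=1]; use M N g gN b sp in force)+
    have "\<bar>(\<integral>x. g x \<partial>M) - (\<integral>x. u x \<partial>M)\<bar> \<le> 1 / real n"
      using norm_integral_le_prob[OF M, of "\<lambda>x. g x - u x" "1 / real n"] gi iu[OF M L] ux by simp
    moreover have "\<bar>(\<integral>x. g x \<partial>N) - (\<integral>x. u x \<partial>N)\<bar> \<le> 1 / real n"
      using norm_integral_le_prob[OF N, of "\<lambda>x. g x - u x" "1 / real n"] gi iu[OF N LN] ux sp by simp
    moreover have "\<bar>(\<integral>x. u x \<partial>M) - (\<integral>x. u x \<partial>N)\<bar> \<le> tv_dist M N"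
    proof -
      have "(\<integral>x. u x \<partial>M) - (\<integral>x. u x \<partial>N) = (\<Sum>k\<in>{1..n}. measure M (L k) - measure N (L k)) / real n"
        using iu(1)[OF M L] iu(1)[OF N LN] by (simp add: sum_subtractf diff_divide_distrib)
      also have "\<bar>\<dots>\<bar> \<le> (\<Sum>k\<in>{1..n}. tv_dist M N) / real n"
        unfolding abs_divide abs_of_nat using L
        by (intro divide_right_mono order_trans[OF sum_abs] sum_mono abs_measure_diff_le_tv_dist[OF M N]) auto
      finally show ?thesis unfolding n_def by simp
    qed
    moreover have "1 / real n = inverse (real (Suc m))" unfolding n_def by (simp add: divide_inverse)
    ultimately show ?thesis by linarith
  qed
  have "(\<lambda>m. tv_dist M N + 2 * inverse (real (Suc m))) \<longlonglongrightarrow> tv_dist M N + 2 * 0"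
    by (intro tendsto_intros LIMSEQ_inverse_real_of_nat)
  then show ?thesis using approx by (intro LIMSEQ_le_const) auto
qed

text \<open>The affine map to (f + B) / (2 * B) brings f into the unit interval; undoing it produces
  the factor 2 * B.\<close>

lemma integral_diff_le_tv_dist:
  fixes f :: "'y \<Rightarrow> real"
  assumes M: "prob_space M" and N: "prob_space N" and s: "sets N = sets M"
    and f: "f \<in> borel_measurable M" and b: "\<And>x. x \<in> space M \<Longrightarrow> \<bar>f x\<bar> \<le> B"
  shows "\<bar>(\<integral>x. f x \<partial>M) - (\<integral>x. f x \<partial>N)\<bar> \<le> 2 * B * tv_dist M N"
proof -
  interpret M: prob_space M by fact
  interpret N: prob_space N by fact
  have sp: "space N = space M" using s by (rule sets_eq_imp_space_eq)
  have fN: "f \<in> borel_measurable N" using f by (simp add: measurable_cong_sets[OF s refl])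
  have fi: "integrable M f" "integrable N f"
    by (rule integrable_bounded_prob[where B=B]; use M N f fN b sp in force)+
  obtain x0 where "x0 \<in> space M" using M.not_empty by blast
  then have B0: "0 \<le> B" using b[of x0] by linarith
  show ?thesis
  proof (cases "B = 0")
    case True
    \<comment> \<open>The rescaling divides by 2 * B, so the degenerate bound 0 is treated
      apart.\<close>
    then have z: "f x = 0" if "x \<in> space M" for x using b[OF that] by simp
    have "(\<integral>x. f x \<partial>M) = (\<integral>x. 0 \<partial>M)"
      by (rule Bochner_Integration.integral_cong) (simp_all add: z)
    moreover have "(\<integral>x. f x \<partial>N) = (\<integral>x. 0 \<partial>N)"
      by (rule Bochner_Integration.integral_cong) (simp_all add: z sp)
    ultimately show ?thesis using True by simp
  next
    case False
    then have Bp: "0 < B" using B0 by simp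
    define g where "g x = (f x + B) / (2 * B)" for x
    have fg: "(\<integral>x. g x \<partial>Q) = ((\<integral>x. f x \<partial>Q) + B) / (2 * B)" if "prob_space Q" "integrable Q f" for Q
    proof -
      interpret prob_space Q by fact
      show ?thesis unfolding g_def using that(2) by (simp add: prob_space)
    qed
    have "\<bar>(\<integral>x. g x \<partial>M) - (\<integral>x. g x \<partial>N)\<bar> \<le> tv_dist M N"
    proof (rule integral_diff_le_tv_dist_unit[OF M N s])
      show "g \<in> borel_measurable M" unfolding g_def using f by measurable
      show "0 \<le> g x \<and> g x \<le> 1" if "x \<in> space M" for x
        using b[OF that] Bp unfolding g_def by (auto simp: field_simps abs_le_iff)
    qed
    also have "(\<integral>x. g x \<partial>M) - (\<integral>x. g x \<partial>N) = ((\<integral>x. f x \<partial>M) - (\<integral>x. f x \<partial>N)) / (2 * B)"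
      unfolding fg[OF M fi(1)] fg[OF N fi(2)] by (simp add: diff_divide_distrib[symmetric])
    finally show ?thesis using Bp by (simp add: abs_mult field_simps)
  qed
qed

text \<open>The conditional law of Z is known only set by set, with an exceptional null set for each
  set. The proof therefore compares two measures on the product space, the joint law of (Y, Z) and
  the mixture of the kernels: they agree on rectangles, which form a generator closed under
  intersection, hence they are equal and integrate h alike.\<close>

lemma (in prob_space) expectation_cond_kernel:
  fixes h :: "'y \<times> 'z \<Rightarrow> real"
  assumes F: "subalgebra M F" and K: "K \<in> F \<rightarrow>\<^sub>M prob_algebra N'"
    and Z: "Z \<in> M \<rightarrow>\<^sub>M N'" and Y: "Y \<in> F \<rightarrow>\<^sub>M N"
    and ce: "\<And>B. B \<in> sets N' \<Longrightarrow>
      AE w in M. real_cond_exp M F (\<lambda>w. indicator B (Z w)) w = measure (K w) B"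
    and h: "h \<in> borel_measurable (N \<Otimes>\<^sub>M N')"
    and bd: "\<And>x. x \<in> space (N \<Otimes>\<^sub>M N') \<Longrightarrow> \<bar>h x\<bar> \<le> C"
  shows "expectation (\<lambda>w. h (Y w, Z w)) = expectation (\<lambda>w. \<integral>z. h (Y w, z) \<partial>K w)"
proof -
  have [measurable]: "K \<in> M \<rightarrow>\<^sub>M prob_algebra N'" "Y \<in> M \<rightarrow>\<^sub>M N"
    using measurable_from_subalg[OF F] K Y by auto
  note Z[measurable]
  interpret fs: finite_measure_subalgebra M F by unfold_locales (rule F)
  \<comment> \<open>The point mass at \<open>Y w\<close> times \<open>K w\<close>: the candidate for
    the conditional law of the pair.\<close>
  define \<kappa> where "\<kappa> w = distr (K w) (N \<Otimes>\<^sub>M N') (\<lambda>z. (Y w, z))" for w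
  have \<kappa>: "\<kappa> \<in> M \<rightarrow>\<^sub>M prob_algebra (N \<Otimes>\<^sub>M N')" unfolding \<kappa>_def by measurable
  have Mp: "M \<in> space (prob_algebra M)" by (simp add: space_prob_algebra prob_space_axioms)
  have Kw: "prob_space (K w)" "sets (K w) = sets N'" "space (K w) = space N'" if "w \<in> space M" for w
  proof -
    show *: "prob_space (K w)" "sets (K w) = sets N'"
      using measurable_space[OF \<open>K \<in> M \<rightarrow>\<^sub>M prob_algebra N'\<close> that] by (auto simp: space_prob_algebra)
    show "space (K w) = space N'" by (rule sets_eq_imp_space_eq[OF *(2)])
  qed
  have eq: "distr M (N \<Otimes>\<^sub>M N') (\<lambda>w. (Y w, Z w)) = M \<bind> \<kappa>"
  proof (rule measure_eqI_generator_eq[OF Int_stable_pair_measure_generator[of N N'],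
        where \<Omega>="space N \<times> space N'" and A="\<lambda>_. space N \<times> space N'"])
    show "{a \<times> b |a b. a \<in> sets N \<and> b \<in> sets N'} \<subseteq> Pow (space N \<times> space N')"
      using sets.sets_into_space[of _ N] sets.sets_into_space[of _ N'] by auto
    show "sets (distr M (N \<Otimes>\<^sub>M N') (\<lambda>w. (Y w, Z w))) = sigma_sets (space N \<times> space N') {a \<times> b |a b. a \<in> sets N \<and> b \<in> sets N'}"
      by (simp add: sets_pair_measure)
    show "sets (M \<bind> \<kappa>) = sigma_sets (space N \<times> space N') {a \<times> b |a b. a \<in> sets N \<and> b \<in> sets N'}"
      unfolding sets_bind'[OF Mp \<kappa>] by (simp add: sets_pair_measure)
    show "range (\<lambda>_::nat. space N \<times> space N') \<subseteq> {a \<times> b |a b. a \<in> sets N \<and> b \<in> sets N'}" by auto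
    show "emeasure (distr M (N \<Otimes>\<^sub>M N') (\<lambda>w. (Y w, Z w))) (space N \<times> space N') \<noteq> \<infinity>" for i :: nat
      by (simp add: emeasure_distr emeasure_eq_measure)
    fix X assume "X \<in> {a \<times> b |a b. a \<in> sets N \<and> b \<in> sets N'}"
    then obtain A B where X: "X = A \<times> B" and A[measurable]: "A \<in> sets N" and B[measurable]: "B \<in> sets N'" by auto
    have XM[measurable]: "X \<in> sets (N \<Otimes>\<^sub>M N')" unfolding X by simp
    have mX: "measure (\<kappa> w) X = indicator A (Y w) * measure (K w) B" if w: "w \<in> space M" for w
    proof -
      have Yw: "Y w \<in> space N" using measurable_space[OF \<open>Y \<in> M \<rightarrow>\<^sub>M N\<close> w] .
      have "(\<lambda>z. (Y w, z)) \<in> K w \<rightarrow>\<^sub>M N \<Otimes>\<^sub>M N'"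
        using measurable_Pair1'[OF Yw] by (simp add: measurable_cong_sets[OF Kw(2)[OF w] refl])
      then have "measure (\<kappa> w) X = measure (K w) ((\<lambda>z. (Y w, z)) -` X \<inter> space (K w))"
        unfolding \<kappa>_def by (simp add: measure_distr)
      also have "(\<lambda>z. (Y w, z)) -` X \<inter> space (K w) = (if Y w \<in> A then B else {})"
        using sets.sets_into_space[OF B] Kw(3)[OF w] unfolding X by auto
      finally show ?thesis by auto
    qed
    have [simp]: "space (M \<bind> \<kappa>) = space (N \<Otimes>\<^sub>M N')"
      using sets_eq_imp_space_eq[OF sets_bind'[OF Mp \<kappa>]] .
    have "measure (M \<bind> \<kappa>) X = (\<integral>w. measure (\<kappa> w) X \<partial>M)"
      by (rule measure_bind[OF measurable_prob_algebraD[OF \<kappa>] XM])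
    also have "\<dots> = (\<integral>w. indicator A (Y w) * measure (K w) B \<partial>M)"
      by (rule Bochner_Integration.integral_cong) (auto simp: mX)
    also have "\<dots> = (\<integral>w. indicator A (Y w) * real_cond_exp M F (\<lambda>w. indicator B (Z w)) w \<partial>M)"
    proof (rule integral_cong_AE)
      show "AE w in M. indicator A (Y w) * measure (K w) B = indicator A (Y w) * real_cond_exp M F (\<lambda>w. indicator B (Z w)) w"
        using ce[OF B] by eventually_elim simp
    qed measurable
    \<comment> \<open>The defining property of conditional expectation, applicable because the
      factor that depends on Y is F-measurable.\<close>
    also have "\<dots> = (\<integral>w. indicator A (Y w) * indicator B (Z w) \<partial>M)"
    proof (rule fs.real_cond_exp_intg(2))
      show "(\<lambda>w. indicator A (Y w)) \<in> borel_measurable F" using Y by measurable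
      show "integrable M (\<lambda>w. indicator A (Y w) * indicator B (Z w) :: real)"
        by (rule integrable_bounded_prob[OF prob_space_axioms, where B=1]) (auto simp: indicator_def)
    qed measurable
    also have "\<dots> = (\<integral>w. indicator ((\<lambda>w. (Y w, Z w)) -` X \<inter> space M) w \<partial>M)"
      by (rule Bochner_Integration.integral_cong) (auto simp: X indicator_def)
    also have "\<dots> = measure (distr M (N \<Otimes>\<^sub>M N') (\<lambda>w. (Y w, Z w))) X"
      by (simp add: measure_distr)
    finally have "measure (distr M (N \<Otimes>\<^sub>M N') (\<lambda>w. (Y w, Z w))) X = measure (M \<bind> \<kappa>) X" ..
    moreover have "prob_space (M \<bind> \<kappa>)" by (rule prob_space_bind'[OF Mp \<kappa>])
    moreover have "prob_space (distr M (N \<Otimes>\<^sub>M N') (\<lambda>w. (Y w, Z w)))" by (rule prob_space_distr) measurable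
    ultimately show "emeasure (distr M (N \<Otimes>\<^sub>M N') (\<lambda>w. (Y w, Z w))) X = emeasure (M \<bind> \<kappa>) X"
      by (simp add: finite_measure.emeasure_eq_measure prob_space.finite_measure)
  qed auto
  have "expectation (\<lambda>w. h (Y w, Z w)) = (\<integral>x. h x \<partial>distr M (N \<Otimes>\<^sub>M N') (\<lambda>w. (Y w, Z w)))"
    by (rule integral_distr[symmetric]) (use h in measurable)
  also have "\<dots> = (\<integral>w. (\<integral>x. h x \<partial>\<kappa> w) \<partial>M)"
    unfolding eq by (rule integral_bind_prob_algebra[OF Mp \<kappa> h bd])
  also have "\<dots> = (\<integral>w. (\<integral>z. h (Y w, z) \<partial>K w) \<partial>M)"
  proof (rule Bochner_Integration.integral_cong[OF refl])
    fix w assume w: "w \<in> space M"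
    have "(\<lambda>z. (Y w, z)) \<in> K w \<rightarrow>\<^sub>M N \<Otimes>\<^sub>M N'"
      using measurable_Pair1'[OF measurable_space[OF \<open>Y \<in> M \<rightarrow>\<^sub>M N\<close> w]]
      by (simp add: measurable_cong_sets[OF Kw(2)[OF w] refl])
    then show "(\<integral>x. h x \<partial>\<kappa> w) = (\<integral>z. h (Y w, z) \<partial>K w)"
      unfolding \<kappa>_def using h by (subst integral_distr) auto
  qed
  finally show ?thesis .
qed

section \<open>The chain under the behaviour policy\<close>

text \<open>Both the integrand and the measure vary with x. Pushing \<open>L x\<close> forward to
  the law of (x, y) moves all dependence into the kernel, and the integral of one fixed function
  against a measurable kernel is measurable.\<close>

lemma integral_measurable_prob_kernel:
  fixes f :: "'x \<Rightarrow> 'y \<Rightarrow> 'b::{banach, second_countable_topology}"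
  assumes f: "(\<lambda>(x, y). f x y) \<in> borel_measurable (M \<Otimes>\<^sub>M N)" and L: "L \<in> M \<rightarrow>\<^sub>M prob_algebra N"
  shows "(\<lambda>x. \<integral>y. f x y \<partial>L x) \<in> borel_measurable M"
proof -
  have k: "(\<lambda>x. distr (L x) (M \<Otimes>\<^sub>M N) (Pair x)) \<in> M \<rightarrow>\<^sub>M subprob_algebra (M \<Otimes>\<^sub>M N)"
    by (rule measurable_prob_algebraD, rule measurable_distr_prob_space2[OF L]) measurable
  have "(\<integral>z. (case z of (x, y) \<Rightarrow> f x y) \<partial>distr (L x) (M \<Otimes>\<^sub>M N) (Pair x)) = (\<integral>y. f x y \<partial>L x)"
    if x: "x \<in> space M" for x
  proof -
    have "sets (L x) = sets N" using measurable_space[OF L x] by (auto simp: space_prob_algebra)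
    then have "Pair x \<in> L x \<rightarrow>\<^sub>M M \<Otimes>\<^sub>M N"
      using measurable_Pair1'[OF x] by (simp cong: measurable_cong_sets)
    from integral_distr[OF this f] show ?thesis by simp
  qed
  with measurable_compose[OF k integral_measurable_subprob_algebra[OF f]] show ?thesis
    by (simp cong: measurable_cong)
qed

locale behaviour_chain =
  fixes S :: "(real^'d) set"
    and P :: "(real^'d) \<times> 'a::finite \<Rightarrow> (real^'d) measure"
    and \<pi>b :: "real^'d \<Rightarrow> 'a pmf"
  assumes P_kernel: "P \<in> sa_space S \<rightarrow>\<^sub>M prob_algebra (state_space S)"
    and behaviour_meas: "\<And>a. (\<lambda>s. pmf (\<pi>b s) a) \<in> borel_measurable (state_space S)"
begin

abbreviation "SS \<equiv> state_space S"
abbreviation "SA \<equiv> sa_space S :: ((real^'d) \<times> 'a) measure"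
abbreviation "Obs \<equiv> SA \<Otimes>\<^sub>M SS"

text \<open>Conditional mean of h when only the past datum and the current state are known: the
  action and the next state are integrated out. The datum is carried as a parameter because it will
  be a lagged iterate.\<close>

definition cond_step :: "('x \<times> (((real^'d) \<times> 'a) \<times> (real^'d)) \<Rightarrow> real) \<Rightarrow> 'x \<times> (real^'d) \<Rightarrow> real" where
  "cond_step h y = (\<Sum>a\<in>UNIV. pmf (\<pi>b (snd y)) a * (\<integral>s'. h (fst y, ((snd y, a), s')) \<partial>P (snd y, a)))"

lemma space_SS [simp]: "space SS = S"
  by (simp add: space_restrict_space)

lemma space_SA [simp]: "space SA = S \<times> UNIV"
  by (simp add: space_pair_measure)

lemma P_prob: "s \<in> S \<Longrightarrow> prob_space (P (s, a))"
  and sets_P: "s \<in> S \<Longrightarrow> sets (P (s, a)) = sets SS"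
  using measurable_space[OF P_kernel, of "(s, a)"] by (auto simp: space_prob_algebra)

lemma space_P: "s \<in> S \<Longrightarrow> space (P (s, a)) = S"
  using sets_eq_imp_space_eq[OF sets_P] by simp

text \<open>With finitely many actions, the mass of any action set is a finite sum of the measurable
  point masses.\<close>

lemma behaviour_kernel: "(\<lambda>s. measure_pmf (\<pi>b s)) \<in> SS \<rightarrow>\<^sub>M prob_algebra (count_space UNIV)"
proof (rule measurable_prob_algebra_generated[where \<Omega>=UNIV and G="Pow UNIV"])
  show "sets (count_space UNIV) = sigma_sets UNIV (Pow UNIV :: 'a set set)"
    by (metis sets_count_space sets.sigma_sets_eq space_count_space)
  show "(\<lambda>s. emeasure (measure_pmf (\<pi>b s)) A) \<in> borel_measurable SS" for A
    using behaviour_meas by (simp add: emeasure_measure_pmf_finite)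
qed (auto simp: Int_stable_def prob_space_measure_pmf)

lemma state_kernel_measurable: "state_kernel P \<pi>b \<in> SS \<rightarrow>\<^sub>M prob_algebra SS"
  unfolding state_kernel_def
  by (rule measurable_bind_prob_space2[OF behaviour_kernel]) (simp add: P_kernel)

lemma sa_kernel_measurable: "sa_kernel S P \<pi>b \<in> SA \<rightarrow>\<^sub>M prob_algebra SA"
  unfolding sa_kernel_def
proof (rule measurable_bind_prob_space2[OF P_kernel])
  have "(\<lambda>s'. measure_pmf (\<pi>b s') \<bind> (\<lambda>a'. return SA (s', a'))) \<in> SS \<rightarrow>\<^sub>M prob_algebra SA"
    by (rule measurable_bind_prob_space2[OF behaviour_kernel])
      (auto simp: case_prod_unfold intro!: measurable_return_prob_space)
  then show "(\<lambda>(x, s'). measure_pmf (\<pi>b s') \<bind> (\<lambda>a'. return SA (s', a'))) \<in> SA \<Otimes>\<^sub>M SS \<rightarrow>\<^sub>M prob_algebra SA"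
    by (simp add: case_prod_unfold)
qed

lemma kernel_pow_measurable: "kernel_pow SS (state_kernel P \<pi>b) k \<in> SS \<rightarrow>\<^sub>M prob_algebra SS"
proof (induction k)
  case 0
  then show ?case using measurable_return_prob_space[of SS] by (simp cong: measurable_cong)
next
  case (Suc k)
  show ?case using measurable_bind_prob_space[OF Suc state_kernel_measurable] by (simp cong: measurable_cong)
qed

lemma integral_pmf_bind:
  fixes f :: "'y \<Rightarrow> real"
  assumes N: "N \<in> count_space UNIV \<rightarrow>\<^sub>M prob_algebra K"
    and f: "f \<in> borel_measurable K" "\<And>x. x \<in> space K \<Longrightarrow> \<bar>f x\<bar> \<le> B"
  shows "(\<integral>x. f x \<partial>(measure_pmf (p :: 'a pmf) \<bind> N)) = (\<Sum>a\<in>UNIV. pmf p a * (\<integral>x. f x \<partial>N a))"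
proof -
  have "measure_pmf p \<in> space (prob_algebra (count_space UNIV))"
    by (simp add: space_prob_algebra prob_space_measure_pmf)
  from integral_bind_prob_algebra[OF this N f] show ?thesis
    by (simp add: integral_measure_pmf_real[of UNIV] mult.commute)
qed

lemma P_section: "s \<in> S \<Longrightarrow> (\<lambda>a. P (s, a)) \<in> count_space UNIV \<rightarrow>\<^sub>M prob_algebra SS"
  using measurable_space[OF P_kernel] by simp

lemma integral_state_kernel:
  fixes g :: "real^'d \<Rightarrow> real"
  assumes "s \<in> S" "g \<in> borel_measurable SS" "\<And>s. s \<in> S \<Longrightarrow> \<bar>g s\<bar> \<le> B"
  shows "(\<integral>s'. g s' \<partial>state_kernel P \<pi>b s) = (\<Sum>a\<in>UNIV. pmf (\<pi>b s) a * (\<integral>s'. g s' \<partial>P (s, a)))"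
  unfolding state_kernel_def
  by (rule integral_pmf_bind[OF P_section]) (use assms in auto)

lemma pmf_average_le:
  fixes f :: "'a \<Rightarrow> real"
  assumes "\<And>a. \<bar>f a\<bar> \<le> B"
  shows "\<bar>\<Sum>a\<in>UNIV. pmf p a * f a\<bar> \<le> B"
proof -
  have "\<bar>\<Sum>a\<in>UNIV. pmf p a * f a\<bar> \<le> (\<Sum>a\<in>UNIV. pmf p a * B)"
    by (rule order_trans[OF sum_abs]) (auto intro!: sum_mono mult_left_mono assms simp: abs_mult)
  also have "\<dots> = B" by (simp add: sum_distrib_right[symmetric] sum_pmf_eq_1)
  finally show ?thesis .
qed

lemma cond_step_measurable:
  assumes h: "h \<in> borel_measurable (N \<Otimes>\<^sub>M Obs)"
  shows "cond_step h \<in> borel_measurable (N \<Otimes>\<^sub>M SS)"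
  unfolding cond_step_def
proof (intro borel_measurable_sum borel_measurable_times)
  fix a
  show "(\<lambda>y. pmf (\<pi>b (snd y)) a) \<in> borel_measurable (N \<Otimes>\<^sub>M SS)"
    by (rule measurable_compose[OF measurable_snd behaviour_meas])
  have K: "(\<lambda>y. P (snd y, a)) \<in> N \<Otimes>\<^sub>M SS \<rightarrow>\<^sub>M prob_algebra SS"
    by (rule measurable_compose[OF _ P_kernel]) measurable
  show "(\<lambda>y. \<integral>s'. h (fst y, ((snd y, a), s')) \<partial>P (snd y, a)) \<in> borel_measurable (N \<Otimes>\<^sub>M SS)"
  proof (rule integral_measurable_prob_kernel[OF _ K])
    have "(\<lambda>z. (fst (fst z), ((snd (fst z), a), snd z))) \<in> (N \<Otimes>\<^sub>M SS) \<Otimes>\<^sub>M SS \<rightarrow>\<^sub>M N \<Otimes>\<^sub>M Obs"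
      by measurable
    from measurable_compose[OF this h]
    show "(\<lambda>(y, s'). h (fst y, ((snd y, a), s'))) \<in> borel_measurable ((N \<Otimes>\<^sub>M SS) \<Otimes>\<^sub>M SS)"
      by (simp add: case_prod_unfold)
  qed
qed

lemma cond_step_bound:
  assumes h: "h \<in> borel_measurable (N \<Otimes>\<^sub>M Obs)" and y: "y \<in> space (N \<Otimes>\<^sub>M SS)"
    and b: "\<And>z. z \<in> space (N \<Otimes>\<^sub>M Obs) \<Longrightarrow> \<bar>h z\<bar> \<le> B"
  shows "\<bar>cond_step h y\<bar> \<le> B"
  unfolding cond_step_def
proof (rule pmf_average_le)
  fix a
  have s: "snd y \<in> S" and x: "fst y \<in> space N" using y by (auto simp: space_pair_measure)
  have "(\<lambda>s'. (fst y, ((snd y, a), s'))) \<in> P (snd y, a) \<rightarrow>\<^sub>M N \<Otimes>\<^sub>M Obs"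
    unfolding measurable_cong_sets[OF sets_P[OF s] refl]
    using s x by (intro measurable_Pair) auto
  from measurable_compose[OF this h] show "\<bar>\<integral>s'. h (fst y, ((snd y, a), s')) \<partial>P (snd y, a)\<bar> \<le> B"
    unfolding real_norm_def[symmetric]
    using b s x by (intro norm_integral_le_prob[OF P_prob[OF s]]) (auto simp: space_pair_measure space_P)
qed

subsection \<open>Stationary observations\<close>

text \<open>The single law behind the expectation in the objective: a pair (s, a) from \<mu>
  followed by a transition. It replaces the iterated integrals by one integral.\<close>

definition stationary_obs :: "((real^'d) \<times> 'a) measure \<Rightarrow> (((real^'d) \<times> 'a) \<times> (real^'d)) measure" where
  "stationary_obs \<mu> = \<mu> \<bind> (\<lambda>x. distr (P x) Obs (Pair x))"

lemma obs_kernel: "(\<lambda>x. distr (P x) Obs (Pair x)) \<in> SA \<rightarrow>\<^sub>M prob_algebra Obs"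
  by (rule measurable_distr_prob_space2[OF P_kernel]) measurable

context
  fixes \<mu> assumes inv: "invariant_measure SA (sa_kernel S P \<pi>b) \<mu>"
begin

lemma mu_space: "\<mu> \<in> space (prob_algebra SA)"
  using inv by (simp add: invariant_measure_def)

lemma mu_prob: "prob_space \<mu>" and sets_mu: "sets \<mu> = sets SA"
  using mu_space by (auto simp: space_prob_algebra)

lemma space_mu: "space \<mu> = S \<times> UNIV"
  using sets_eq_imp_space_eq[OF sets_mu] by simp

lemma stationary_obs_prob: "prob_space (stationary_obs \<mu>)"
  unfolding stationary_obs_def by (rule prob_space_bind'[OF mu_space obs_kernel])

lemma sets_stationary_obs: "sets (stationary_obs \<mu>) = sets Obs"
  unfolding stationary_obs_def by (rule sets_bind'[OF mu_space obs_kernel])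

lemma space_stationary_obs: "space (stationary_obs \<mu>) = (S \<times> UNIV) \<times> S"
  using sets_eq_imp_space_eq[OF sets_stationary_obs] by (simp add: space_pair_measure)

lemma integral_stationary_obs:
  fixes f :: "_ \<Rightarrow> real"
  assumes f: "f \<in> borel_measurable Obs" and b: "\<And>x. x \<in> space Obs \<Longrightarrow> \<bar>f x\<bar> \<le> B"
  shows "(\<integral>z. f z \<partial>stationary_obs \<mu>) = (\<integral>x. (\<integral>s'. f (x, s') \<partial>P x) \<partial>\<mu>)"
  unfolding stationary_obs_def
proof (subst integral_bind_prob_algebra[OF mu_space obs_kernel f b], assumption,
    rule Bochner_Integration.integral_cong[OF refl])
  fix x assume "x \<in> space \<mu>"
  then obtain s a where x: "x = (s, a)" "s \<in> S" by (auto simp: space_mu)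
  have "Pair x \<in> P x \<rightarrow>\<^sub>M Obs"
    unfolding x(1) measurable_cong_sets[OF sets_P[OF x(2)] refl] using x(2) by (intro measurable_Pair) auto
  then show "(\<integral>z. f z \<partial>distr (P x) Obs (Pair x)) = (\<integral>s'. f (x, s') \<partial>P x)"
    using f by (rule integral_distr)
qed

lemma integral_sa_kernel:
  fixes f :: "_ \<Rightarrow> real"
  assumes f: "f \<in> borel_measurable SA" and b: "\<And>x. x \<in> space SA \<Longrightarrow> \<bar>f x\<bar> \<le> B" and x: "x \<in> space SA"
  shows "(\<integral>y. f y \<partial>sa_kernel S P \<pi>b x) = (\<integral>s'. (\<Sum>a\<in>UNIV. pmf (\<pi>b s') a * f (s', a)) \<partial>P x)"
proof -
  have K: "(\<lambda>s'. measure_pmf (\<pi>b s') \<bind> (\<lambda>a'. return SA (s', a'))) \<in> SS \<rightarrow>\<^sub>M prob_algebra SA"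
    by (rule measurable_bind_prob_space2[OF behaviour_kernel])
      (auto simp: case_prod_unfold intro!: measurable_return_prob_space)
  have "(\<integral>y. f y \<partial>sa_kernel S P \<pi>b x)
      = (\<integral>s'. (\<integral>y. f y \<partial>(measure_pmf (\<pi>b s') \<bind> (\<lambda>a'. return SA (s', a')))) \<partial>P x)"
    unfolding sa_kernel_def
    using integral_bind_prob_algebra[OF measurable_space[OF P_kernel x] K f b] .
  also have "\<dots> = (\<integral>s'. (\<Sum>a\<in>UNIV. pmf (\<pi>b s') a * f (s', a)) \<partial>P x)"
  proof (rule Bochner_Integration.integral_cong[OF refl])
    fix s' assume "s' \<in> space (P x)"
    then have s': "s' \<in> S" using x space_P by (cases x) auto
    have "(\<integral>y. f y \<partial>(measure_pmf (\<pi>b s') \<bind> (\<lambda>a'. return SA (s', a'))))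
      = (\<Sum>a\<in>UNIV. pmf (\<pi>b s') a * (\<integral>y. f y \<partial>return SA (s', a)))"
      by (rule integral_pmf_bind[OF _ f b])
        (use s' measurable_space[OF measurable_return_prob_space[of SA]] in simp)
    also have "\<dots> = (\<Sum>a\<in>UNIV. pmf (\<pi>b s') a * f (s', a))"
      using s' f by (simp add: integral_return)
    finally show "(\<integral>y. f y \<partial>(measure_pmf (\<pi>b s') \<bind> (\<lambda>a'. return SA (s', a'))))
      = (\<Sum>a\<in>UNIV. pmf (\<pi>b s') a * f (s', a))" .
  qed
  finally show ?thesis .
qed

text \<open>Invariance forces the conditional law of the action given the state under \<open>\<mu>\<close> to be \<open>\<pi>b\<close>.\<close>

lemma integral_mu_disintegrate:
  fixes f :: "_ \<Rightarrow> real"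
  assumes f: "f \<in> borel_measurable SA" and b: "\<And>x. x \<in> space SA \<Longrightarrow> \<bar>f x\<bar> \<le> B"
  shows "(\<integral>x. f x \<partial>\<mu>) = (\<integral>s. (\<Sum>a\<in>UNIV. pmf (\<pi>b s) a * f (s, a)) \<partial>distr \<mu> SS fst)"
proof -
  define g where "g s = (\<Sum>a\<in>UNIV. pmf (\<pi>b s) a * f (s, a))" for s
  have fa: "(\<lambda>s. f (s, a)) \<in> borel_measurable SS" for a
    by (rule measurable_compose[OF _ f]) measurable
  have g: "g \<in> borel_measurable SS" unfolding g_def using fa behaviour_meas by measurable
  have gb: "\<bar>g s\<bar> \<le> B" if "s \<in> S" for s
    unfolding g_def using that b by (intro pmf_average_le) auto
  have gf: "(\<lambda>x. g (fst x)) \<in> borel_measurable SA" by (rule measurable_compose[OF measurable_fst g])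
  have eq: "\<mu> \<bind> sa_kernel S P \<pi>b = \<mu>" using inv by (simp add: invariant_measure_def)
  have "(\<integral>x. f x \<partial>\<mu>) = (\<integral>x. f x \<partial>(\<mu> \<bind> sa_kernel S P \<pi>b))" by (simp only: eq)
  also have "\<dots> = (\<integral>x. (\<integral>y. f y \<partial>sa_kernel S P \<pi>b x) \<partial>\<mu>)"
    by (rule integral_bind_prob_algebra[OF mu_space sa_kernel_measurable f b])
  \<comment> \<open>One step of the chain draws the new action from \<open>\<pi>b\<close>, so it
    cannot distinguish f from its action average g. Invariance, used before and after this line,
    transfers the equality to \<mu>.\<close>
  also have "\<dots> = (\<integral>x. (\<integral>y. g (fst y) \<partial>sa_kernel S P \<pi>b x) \<partial>\<mu>)"
  proof (rule Bochner_Integration.integral_cong[OF refl])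
    fix x assume "x \<in> space \<mu>"
    then have x: "x \<in> space SA" by (simp add: space_mu)
    have "(\<integral>y. f y \<partial>sa_kernel S P \<pi>b x) = (\<integral>s. g s \<partial>P x)"
      unfolding g_def by (rule integral_sa_kernel[OF f b x])
    moreover have "(\<integral>y. g (fst y) \<partial>sa_kernel S P \<pi>b x) = (\<integral>s. g s \<partial>P x)"
      by (subst integral_sa_kernel[OF gf _ x, where B=B])
        (auto simp: gb sum_distrib_right[symmetric] sum_pmf_eq_1)
    ultimately show "(\<integral>y. f y \<partial>sa_kernel S P \<pi>b x) = (\<integral>y. g (fst y) \<partial>sa_kernel S P \<pi>b x)" by simp
  qed
  also have "\<dots> = (\<integral>x. g (fst x) \<partial>(\<mu> \<bind> sa_kernel S P \<pi>b))"
    by (rule integral_bind_prob_algebra[OF mu_space sa_kernel_measurable gf, where B=B, symmetric])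
      (auto simp: gb)
  also have "\<dots> = (\<integral>x. g (fst x) \<partial>\<mu>)" by (simp only: eq)
  also have "\<dots> = (\<integral>s. g s \<partial>distr \<mu> SS fst)"
    by (rule integral_distr[symmetric, OF _ g]) (simp add: measurable_cong_sets[OF sets_mu refl])
  finally show ?thesis unfolding g_def .
qed

text \<open>The link between mixing of states and centredness of observations:
  \<open>cond_step\<close> draws the action from \<open>\<pi>b\<close>, and by
  \<open>integral_mu_disintegrate\<close> this is also how \<mu> draws it.\<close>

lemma integral_cond_step_stationary:
  assumes h: "h \<in> borel_measurable (N \<Otimes>\<^sub>M Obs)" and x: "x \<in> space N"
    and b: "\<And>z. z \<in> space (N \<Otimes>\<^sub>M Obs) \<Longrightarrow> \<bar>h z\<bar> \<le> B"
  shows "(\<integral>s. cond_step h (x, s) \<partial>distr \<mu> SS fst) = (\<integral>z. h (x, z) \<partial>stationary_obs \<mu>)"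
proof -
  have hx: "(\<lambda>z. h (x, z)) \<in> borel_measurable Obs"
    by (rule measurable_compose[OF measurable_Pair1'[OF x] h])
  have inner: "(\<lambda>y. \<integral>s'. h (x, (y, s')) \<partial>P y) \<in> borel_measurable SA"
    using hx by (intro integral_measurable_prob_kernel[OF _ P_kernel])
      (simp add: case_prod_unfold)
  have ib: "\<bar>\<integral>s'. h (x, (y, s')) \<partial>P y\<bar> \<le> B" if ySA: "y \<in> space SA" for y
  proof -
    obtain s a where y: "y = (s, a)" "s \<in> S" using ySA by (cases y) auto
    have "Pair y \<in> P y \<rightarrow>\<^sub>M Obs"
      unfolding y(1) measurable_cong_sets[OF sets_P[OF y(2)] refl] using y(2) by (intro measurable_Pair) auto
    then have "(\<lambda>s'. h (x, (y, s'))) \<in> borel_measurable (P y)" by (rule measurable_compose[OF _ hx])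
    then show ?thesis
      unfolding real_norm_def[symmetric] using b y x P_prob[OF y(2), of a]
      by (intro norm_integral_le_prob) (auto simp: space_pair_measure space_P)
  qed
  have "(\<integral>z. h (x, z) \<partial>stationary_obs \<mu>) = (\<integral>y. (\<integral>s'. h (x, (y, s')) \<partial>P y) \<partial>\<mu>)"
    by (rule integral_stationary_obs[OF hx, where B=B]) (use b x in \<open>auto simp: space_pair_measure\<close>)
  also have "\<dots> = (\<integral>s. (\<Sum>a\<in>UNIV. pmf (\<pi>b s) a * (\<integral>s'. h (x, ((s, a), s')) \<partial>P (s, a))) \<partial>distr \<mu> SS fst)"
    by (rule integral_mu_disintegrate[OF inner ib])
  finally show ?thesis unfolding cond_step_def by simp
qed

end

end

section \<open>Expectations along the single trajectory\<close>

locale mdp_trajectory = behaviour_chain S P \<pi>b + prob_space M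
  for S :: "(real^'d) set"
    and P :: "(real^'d) \<times> 'a::finite \<Rightarrow> (real^'d) measure"
    and \<pi>b :: "real^'d \<Rightarrow> 'a pmf"
    and M :: "'w measure" +
  fixes s0 :: "real^'d" and st :: "nat \<Rightarrow> 'w \<Rightarrow> real^'d" and act :: "nat \<Rightarrow> 'w \<Rightarrow> 'a"
  assumes traj: "trajectory M S P \<pi>b s0 st act"
begin

text \<open>Both arguments are counts. \<open>Hist (Suc t) t\<close> is the moment just before the
  action at time t is drawn, \<open>Hist (Suc t) (Suc t)\<close> the moment just after.\<close>

abbreviation "Hist n k \<equiv> history M S st act n k"

definition obs :: "nat \<Rightarrow> 'w \<Rightarrow> ((real^'d) \<times> 'a) \<times> (real^'d)" where
  "obs t w = ((st t w, act t w), st (Suc t) w)"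

lemma st_measurable: "st t \<in> M \<rightarrow>\<^sub>M SS"
  and act_measurable: "act t \<in> M \<rightarrow>\<^sub>M count_space UNIV"
  using traj by (auto simp: trajectory_def)

lemma st_in: "w \<in> space M \<Longrightarrow> st t w \<in> S"
  using measurable_space[OF st_measurable] by simp

lemma obs_measurable: "obs t \<in> M \<rightarrow>\<^sub>M Obs"
  unfolding obs_def using st_measurable act_measurable by measurable

lemma obs_in: "w \<in> space M \<Longrightarrow> obs t w \<in> (S \<times> UNIV) \<times> S"
  by (simp add: obs_def st_in)

lemma
  shows space_Hist: "space (Hist n k) = space M"
    and sets_Hist: "sets (Hist n k) = sigma_sets (space M)
      ({st i -` B \<inter> space M | i B. i < n \<and> B \<in> sets SS} \<union> {act j -` B \<inter> space M | j B. j < k})"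
  unfolding history_def by (auto intro!: space_measure_of sets_measure_of)

lemma subalgebra_Hist: "subalgebra M (Hist n k)"
  unfolding subalgebra_def space_Hist sets_Hist
  by (auto intro!: sets.sigma_sets_subset measurable_sets[OF st_measurable] measurable_sets[OF act_measurable])

lemma st_Hist: "i < n \<Longrightarrow> st i \<in> Hist n k \<rightarrow>\<^sub>M SS"
  by (rule measurableI) (auto simp: space_Hist sets_Hist st_in intro!: sigma_sets.Basic)

lemma act_Hist: "j < k \<Longrightarrow> act j \<in> Hist n k \<rightarrow>\<^sub>M count_space UNIV"
  by (rule measurableI, simp, unfold space_Hist sets_Hist) blast

lemma measurable_Hist_mono:
  assumes "n \<le> n'" "k \<le> k'" "X \<in> Hist n k \<rightarrow>\<^sub>M N"
  shows "X \<in> Hist n' k' \<rightarrow>\<^sub>M N"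
proof -
  have "subalgebra (Hist n' k') (Hist n k)"
    unfolding subalgebra_def space_Hist sets_Hist
    using assms(1,2) by (intro conjI refl sigma_sets_mono' Un_mono) (blast intro: order_less_le_trans)+
  from measurable_from_subalg[OF this assms(3)] show ?thesis .
qed

text \<open>The two conditional laws of \<open>trajectory\<close> are used in reverse order of time:
  the next state is integrated out given the action, then the action given the state.\<close>

lemma expectation_obs:
  fixes h :: "'x \<times> (((real^'d) \<times> 'a) \<times> (real^'d)) \<Rightarrow> real"
  assumes X: "X \<in> Hist (Suc t) t \<rightarrow>\<^sub>M N" and h: "h \<in> borel_measurable (N \<Otimes>\<^sub>M Obs)"
    and b: "\<And>z. z \<in> space (N \<Otimes>\<^sub>M Obs) \<Longrightarrow> \<bar>h z\<bar> \<le> B"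
  shows "expectation (\<lambda>w. h (X w, obs t w)) = expectation (\<lambda>w. cond_step h (X w, st t w))"
proof -
  define h1 where "h1 y = h (fst (fst y), ((snd (fst y)), snd y))" for y :: "('x \<times> ((real^'d) \<times> 'a)) \<times> (real^'d)"
  have h1: "h1 \<in> borel_measurable ((N \<Otimes>\<^sub>M SA) \<Otimes>\<^sub>M SS)"
    unfolding h1_def by (rule measurable_compose[OF _ h]) measurable
  have h1b: "\<bar>h1 y\<bar> \<le> B" if "y \<in> space ((N \<Otimes>\<^sub>M SA) \<Otimes>\<^sub>M SS)" for y
    unfolding h1_def by (rule b) (use that in \<open>auto simp: space_pair_measure\<close>)
  have X': "X \<in> Hist (Suc t) (Suc t) \<rightarrow>\<^sub>M N" by (rule measurable_Hist_mono[OF _ _ X]) auto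
  have sa: "(\<lambda>w. (st t w, act t w)) \<in> Hist (Suc t) (Suc t) \<rightarrow>\<^sub>M SA"
    by (intro measurable_Pair st_Hist act_Hist) auto
  have "expectation (\<lambda>w. h (X w, obs t w)) = expectation (\<lambda>w. h1 ((X w, (st t w, act t w)), st (Suc t) w))"
    by (simp add: h1_def obs_def)
  also have "\<dots> = expectation (\<lambda>w. \<integral>s'. h1 ((X w, (st t w, act t w)), s') \<partial>P (st t w, act t w))"
  proof (rule expectation_cond_kernel[OF subalgebra_Hist _ st_measurable _ _ h1 h1b])
    show "(\<lambda>w. P (st t w, act t w)) \<in> Hist (Suc t) (Suc t) \<rightarrow>\<^sub>M prob_algebra SS"
      by (rule measurable_compose[OF sa P_kernel])
    show "(\<lambda>w. (X w, (st t w, act t w))) \<in> Hist (Suc t) (Suc t) \<rightarrow>\<^sub>M N \<Otimes>\<^sub>M SA"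
      by (intro measurable_Pair X' sa)
    show "AE w in M. real_cond_exp M (Hist (Suc t) (Suc t)) (\<lambda>w. indicator C (st (Suc t) w)) w
        = measure (P (st t w, act t w)) C" if "C \<in> sets SS" for C
      using traj that by (auto simp: trajectory_def)
  qed
  also have "\<dots> = expectation (\<lambda>w. (\<lambda>((x, s), a). \<integral>s'. h1 ((x, (s, a)), s') \<partial>P (s, a)) ((X w, st t w), act t w))"
    by simp
  also have "\<dots> = expectation (\<lambda>w. \<integral>a. (\<lambda>((x, s), a). \<integral>s'. h1 ((x, (s, a)), s') \<partial>P (s, a)) ((X w, st t w), a) \<partial>measure_pmf (\<pi>b (st t w)))"
  proof (rule expectation_cond_kernel[OF subalgebra_Hist[of "Suc t" t] _ act_measurable, where N="N \<Otimes>\<^sub>M SS" and C=B])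
    show "(\<lambda>w. measure_pmf (\<pi>b (st t w))) \<in> Hist (Suc t) t \<rightarrow>\<^sub>M prob_algebra (count_space UNIV)"
      by (rule measurable_compose[OF st_Hist behaviour_kernel]) simp
    show "(\<lambda>w. (X w, st t w)) \<in> Hist (Suc t) t \<rightarrow>\<^sub>M N \<Otimes>\<^sub>M SS"
      by (intro measurable_Pair X st_Hist) auto
    show "AE w in M. real_cond_exp M (Hist (Suc t) t) (\<lambda>w. indicator C (act t w)) w
        = measure (measure_pmf (\<pi>b (st t w))) C" for C
      using traj by (auto simp: trajectory_def)
    have "(\<lambda>y. \<integral>s'. h1 ((fst (fst y), (snd (fst y), snd y)), s') \<partial>P (snd (fst y), snd y))
        \<in> borel_measurable ((N \<Otimes>\<^sub>M SS) \<Otimes>\<^sub>M count_space UNIV)"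
    proof (rule integral_measurable_prob_kernel)
      show "(\<lambda>y. P (snd (fst y), snd y)) \<in> (N \<Otimes>\<^sub>M SS) \<Otimes>\<^sub>M count_space UNIV \<rightarrow>\<^sub>M prob_algebra SS"
        by (rule measurable_compose[OF _ P_kernel]) measurable
      have "(\<lambda>z. ((fst (fst (fst z)), (snd (fst (fst z)), snd (fst z))), snd z))
          \<in> ((N \<Otimes>\<^sub>M SS) \<Otimes>\<^sub>M count_space UNIV) \<Otimes>\<^sub>M SS \<rightarrow>\<^sub>M (N \<Otimes>\<^sub>M SA) \<Otimes>\<^sub>M SS"
        by measurable
      from measurable_compose[OF this h1]
      show "(\<lambda>(y, s'). h1 ((fst (fst y), (snd (fst y), snd y)), s'))
          \<in> borel_measurable (((N \<Otimes>\<^sub>M SS) \<Otimes>\<^sub>M count_space UNIV) \<Otimes>\<^sub>M SS)"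
        by (simp add: case_prod_unfold)
    qed
    then show "(\<lambda>((x, s), a). \<integral>s'. h1 ((x, (s, a)), s') \<partial>P (s, a)) \<in> borel_measurable ((N \<Otimes>\<^sub>M SS) \<Otimes>\<^sub>M count_space UNIV)"
      by (simp add: case_prod_unfold)
    fix y assume "y \<in> space ((N \<Otimes>\<^sub>M SS) \<Otimes>\<^sub>M count_space (UNIV :: 'a set))"
    then obtain x s a where y: "y = ((x, s), a)" "x \<in> space N" "s \<in> S"
      by (cases y) (auto simp: space_pair_measure)
    have "(\<lambda>s'. ((x, (s, a)), s')) \<in> P (s, a) \<rightarrow>\<^sub>M (N \<Otimes>\<^sub>M SA) \<Otimes>\<^sub>M SS"
      unfolding measurable_cong_sets[OF sets_P[OF y(3)] refl] using y by (intro measurable_Pair) auto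
    from measurable_compose[OF this h1] have "\<bar>\<integral>s'. h1 ((x, (s, a)), s') \<partial>P (s, a)\<bar> \<le> B"
      unfolding real_norm_def[symmetric]
      by (rule norm_integral_le_prob[OF P_prob[OF y(3)]]) (use h1b y space_P in \<open>auto simp: space_pair_measure\<close>)
    then show "\<bar>(\<lambda>((x, s), a). \<integral>s'. h1 ((x, (s, a)), s') \<partial>P (s, a)) y\<bar> \<le> B" using y by simp
  qed
  also have "\<dots> = expectation (\<lambda>w. cond_step h (X w, st t w))"
    by (simp add: integral_measure_pmf_real[of UNIV] cond_step_def h1_def mult.commute)
  finally show ?thesis .
qed

text \<open>Markov property over k steps, with X frozen at time u. The induction removes the last
  transition, replacing g by its one-step average (hence g is arbitrary in the induction); this
  matches \<open>kernel_pow\<close>, which composes the new kernel after the old power.\<close>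

lemma expectation_lagged_state:
  fixes g :: "'x \<times> (real^'d) \<Rightarrow> real"
  assumes X: "X \<in> Hist (Suc u) u \<rightarrow>\<^sub>M N"
  shows "g \<in> borel_measurable (N \<Otimes>\<^sub>M SS) \<Longrightarrow> (\<And>z. z \<in> space (N \<Otimes>\<^sub>M SS) \<Longrightarrow> \<bar>g z\<bar> \<le> B) \<Longrightarrow>
    expectation (\<lambda>w. g (X w, st (u + k) w))
      = expectation (\<lambda>w. \<integral>s'. g (X w, s') \<partial>kernel_pow SS (state_kernel P \<pi>b) k (st u w))"
proof (induction k arbitrary: g)
  case (0 g)
  have XM: "X \<in> M \<rightarrow>\<^sub>M N" by (rule measurable_from_subalg[OF subalgebra_Hist X])
  show ?case
  proof (simp, rule Bochner_Integration.integral_cong[OF refl])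
    fix w assume w: "w \<in> space M"
    have "(\<lambda>s'. g (X w, s')) \<in> borel_measurable SS"
      by (rule measurable_compose[OF measurable_Pair1'[OF measurable_space[OF XM w]] 0(1)])
    then show "g (X w, st u w) = (\<integral>s'. g (X w, s') \<partial>return SS (st u w))"
      using st_in[OF w] by (simp add: integral_return)
  qed
next
  case (Suc k g)
  let ?K = "state_kernel P \<pi>b"
  have XM: "X \<in> M \<rightarrow>\<^sub>M N" by (rule measurable_from_subalg[OF subalgebra_Hist X])
  define h where "h y = g (fst y, snd (snd y))" for y :: "'x \<times> (((real^'d) \<times> 'a) \<times> (real^'d))"
  define g' where "g' = cond_step h"
  have h: "h \<in> borel_measurable (N \<Otimes>\<^sub>M Obs)"
    unfolding h_def by (rule measurable_compose[OF _ Suc.prems(1)]) measurable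
  have hb: "\<bar>h z\<bar> \<le> B" if "z \<in> space (N \<Otimes>\<^sub>M Obs)" for z
    unfolding h_def by (rule Suc.prems(2)) (use that in \<open>auto simp: space_pair_measure\<close>)
  have gx: "(\<lambda>s'. g (x, s')) \<in> borel_measurable SS" if "x \<in> space N" for x
    by (rule measurable_compose[OF measurable_Pair1'[OF that] Suc.prems(1)])
  have g': "g' \<in> borel_measurable (N \<Otimes>\<^sub>M SS)" unfolding g'_def by (rule cond_step_measurable[OF h])
  have g'b: "\<bar>g' z\<bar> \<le> B" if "z \<in> space (N \<Otimes>\<^sub>M SS)" for z
    unfolding g'_def by (rule cond_step_bound[OF h that hb])
  have g'_eq: "g' (x, s) = (\<integral>s'. g (x, s') \<partial>?K s)" if "x \<in> space N" "s \<in> S" for x s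
    unfolding g'_def cond_step_def h_def
    by (subst integral_state_kernel[OF that(2) gx[OF that(1)], where B=B])
      (use that Suc.prems(2) in \<open>auto simp: space_pair_measure\<close>)
  have "X \<in> Hist (Suc (u + k)) (u + k) \<rightarrow>\<^sub>M N" by (rule measurable_Hist_mono[OF _ _ X]) auto
  note expectation_obs[OF this h hb]
  moreover have "g (X w, st (u + Suc k) w) = h (X w, obs (u + k) w)" for w
    by (simp add: h_def obs_def)
  ultimately have "expectation (\<lambda>w. g (X w, st (u + Suc k) w)) = expectation (\<lambda>w. g' (X w, st (u + k) w))"
    unfolding g'_def by (simp only:)
  also have "\<dots> = expectation (\<lambda>w. \<integral>s'. g' (X w, s') \<partial>kernel_pow SS ?K k (st u w))"
    by (rule Suc.IH[OF g' g'b])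
  also have "\<dots> = expectation (\<lambda>w. \<integral>s'. g (X w, s') \<partial>kernel_pow SS ?K (Suc k) (st u w))"
  proof (rule Bochner_Integration.integral_cong[OF refl])
    fix w assume w: "w \<in> space M"
    have Xw: "X w \<in> space N" using measurable_space[OF XM w] .
    have kp: "kernel_pow SS ?K k (st u w) \<in> space (prob_algebra SS)"
      using measurable_space[OF kernel_pow_measurable, of "st u w" k] st_in[OF w] by simp
    then have "sets (kernel_pow SS ?K k (st u w)) = sets SS" by (simp add: space_prob_algebra)
    then have sp: "space (kernel_pow SS ?K k (st u w)) = S"
      by (metis sets_eq_imp_space_eq space_SS)
    have "(\<integral>s'. g' (X w, s') \<partial>kernel_pow SS ?K k (st u w))
        = (\<integral>s. (\<integral>s'. g (X w, s') \<partial>?K s) \<partial>kernel_pow SS ?K k (st u w))"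
      by (rule Bochner_Integration.integral_cong[OF refl]) (simp add: sp g'_eq Xw)
    also have "\<dots> = (\<integral>s'. g (X w, s') \<partial>(kernel_pow SS ?K k (st u w) \<bind> ?K))"
      by (rule integral_bind_prob_algebra[OF kp state_kernel_measurable gx[OF Xw], symmetric, where B=B])
        (use Xw Suc.prems(2) in \<open>auto simp: space_pair_measure\<close>)
    finally show "(\<integral>s'. g' (X w, s') \<partial>kernel_pow SS ?K k (st u w))
        = (\<integral>s'. g (X w, s') \<partial>kernel_pow SS ?K (Suc k) (st u w))" by simp
  qed
  finally show ?case .
qed

text \<open>Given the past at time u, the state k steps later has a law within \<epsilon> of the
  marginal of \<mu>. Under that marginal the averaged h has mean zero, so only the total variation
  error of a function bounded by B remains.\<close>

lemma expectation_lagged_obs_le: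
  fixes h :: "'x \<times> (((real^'d) \<times> 'a) \<times> (real^'d)) \<Rightarrow> real"
  assumes inv: "invariant_measure SA (sa_kernel S P \<pi>b) \<mu>"
    and mix: "\<And>s. s \<in> S \<Longrightarrow>
      tv_dist (kernel_pow SS (state_kernel P \<pi>b) k s) (distr \<mu> SS fst) \<le> \<epsilon>"
    and X: "X \<in> Hist (Suc u) u \<rightarrow>\<^sub>M N" and h: "h \<in> borel_measurable (N \<Otimes>\<^sub>M Obs)"
    and b: "\<And>z. z \<in> space (N \<Otimes>\<^sub>M Obs) \<Longrightarrow> \<bar>h z\<bar> \<le> B"
    and centred: "\<And>x. x \<in> space N \<Longrightarrow> (\<integral>z. h (x, z) \<partial>stationary_obs \<mu>) = 0"
  shows "\<bar>expectation (\<lambda>w. h (X w, obs (u + k) w))\<bar> \<le> 2 * B * \<epsilon>"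
proof -
  let ?K = "state_kernel P \<pi>b"
  have XM: "X \<in> M \<rightarrow>\<^sub>M N" by (rule measurable_from_subalg[OF subalgebra_Hist X])
  have g: "cond_step h \<in> borel_measurable (N \<Otimes>\<^sub>M SS)" by (rule cond_step_measurable[OF h])
  have gb: "\<bar>cond_step h z\<bar> \<le> B" if "z \<in> space (N \<Otimes>\<^sub>M SS)" for z by (rule cond_step_bound[OF h that b])
  have "X \<in> Hist (Suc (u + k)) (u + k) \<rightarrow>\<^sub>M N" by (rule measurable_Hist_mono[OF _ _ X]) auto
  from expectation_obs[OF this h b]
  have "expectation (\<lambda>w. h (X w, obs (u + k) w))
      = expectation (\<lambda>w. \<integral>s'. cond_step h (X w, s') \<partial>kernel_pow SS ?K k (st u w))"
    using expectation_lagged_state[OF X g gb] by simp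
  also have "norm \<dots> \<le> 2 * B * \<epsilon>"
  proof (rule norm_integral_le_prob[OF prob_space_axioms])
    have kpm: "(\<lambda>w. kernel_pow SS ?K k (st u w)) \<in> M \<rightarrow>\<^sub>M prob_algebra SS"
      by (rule measurable_compose[OF st_measurable kernel_pow_measurable])
    show "(\<lambda>w. \<integral>s'. cond_step h (X w, s') \<partial>kernel_pow SS ?K k (st u w)) \<in> borel_measurable M"
    proof (rule integral_measurable_prob_kernel[OF _ kpm])
      have "(\<lambda>z. (X (fst z), snd z)) \<in> M \<Otimes>\<^sub>M SS \<rightarrow>\<^sub>M N \<Otimes>\<^sub>M SS" using XM by measurable
      from measurable_compose[OF this g]
      show "(\<lambda>(w, s'). cond_step h (X w, s')) \<in> borel_measurable (M \<Otimes>\<^sub>M SS)" by (simp add: case_prod_unfold)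
    qed
    fix w assume w: "w \<in> space M"
    have Xw: "X w \<in> space N" using measurable_space[OF XM w] .
    have kp: "kernel_pow SS ?K k (st u w) \<in> space (prob_algebra SS)"
      by (rule measurable_space[OF kpm w])
    then have sp: "sets (kernel_pow SS ?K k (st u w)) = sets SS" "prob_space (kernel_pow SS ?K k (st u w))"
      by (auto simp: space_prob_algebra)
    have spc: "space (kernel_pow SS ?K k (st u w)) = S" using sets_eq_imp_space_eq[OF sp(1)] by simp
    have fm: "fst \<in> \<mu> \<rightarrow>\<^sub>M SS" by (simp add: measurable_cong_sets[OF sets_mu[OF inv] refl])
    have B0: "0 \<le> B"
    proof -
      have "(X w, st u w) \<in> space (N \<Otimes>\<^sub>M SS)" using Xw st_in[OF w] by (simp add: space_pair_measure)
      from gb[OF this] show ?thesis by linarith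
    qed
    have "\<bar>(\<integral>s'. cond_step h (X w, s') \<partial>kernel_pow SS ?K k (st u w)) - (\<integral>s'. cond_step h (X w, s') \<partial>distr \<mu> SS fst)\<bar>
      \<le> 2 * B * tv_dist (kernel_pow SS ?K k (st u w)) (distr \<mu> SS fst)"
    proof (rule integral_diff_le_tv_dist[OF sp(2)])
      show "prob_space (distr \<mu> SS fst)" by (rule prob_space.prob_space_distr[OF mu_prob[OF inv] fm])
      show "(\<lambda>s'. cond_step h (X w, s')) \<in> borel_measurable (kernel_pow SS ?K k (st u w))"
        unfolding measurable_cong_sets[OF sp(1) refl]
        by (rule measurable_compose[OF measurable_Pair1'[OF Xw] g])
    qed (use sp spc Xw gb in \<open>auto simp: space_pair_measure\<close>)
    also have "(\<integral>s'. cond_step h (X w, s') \<partial>distr \<mu> SS fst) = 0"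
      using integral_cond_step_stationary[OF inv h Xw b] centred[OF Xw] by simp
    also have "2 * B * tv_dist (kernel_pow SS ?K k (st u w)) (distr \<mu> SS fst) \<le> 2 * B * \<epsilon>"
      using B0 mix[OF st_in[OF w]] by (intro mult_left_mono) auto
    finally show "norm (\<integral>s'. cond_step h (X w, s') \<partial>kernel_pow SS ?K k (st u w)) \<le> 2 * B * \<epsilon>" by simp
  qed
  finally show ?thesis by simp
qed

end

section \<open>Regular families\<close>

text \<open>Approximating x by simple functions leaves finitely many sections of f at each stage,
  each measurable; continuity in x lets the stages converge to f.\<close>

lemma caratheodory_measurable:
  fixes f :: "'x::{metric_space, second_countable_topology} \<Rightarrow> 's \<Rightarrow> 'b::{metric_space, second_countable_topology}"
  assumes m: "\<And>x. f x \<in> borel_measurable N"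
    and c: "\<And>s. s \<in> space N \<Longrightarrow> continuous_on UNIV (\<lambda>x. f x s)"
  shows "(\<lambda>y. f (fst y) (snd y)) \<in> borel_measurable (borel \<Otimes>\<^sub>M N)"
proof -
  obtain F :: "nat \<Rightarrow> 'x \<Rightarrow> 'x" where F: "\<And>i. simple_function borel (F i)" "\<And>x. (\<lambda>i. F i x) \<longlonglongrightarrow> x"
    using borel_measurable_implies_sequence_metric[of "\<lambda>x::'x. x" borel undefined] by auto
  have "(\<lambda>y. f (F i (fst y)) (snd y)) \<in> borel_measurable (borel \<Otimes>\<^sub>M N)" for i
  proof (rule measurable_compose_countable'[where f="\<lambda>q y. f q (snd y)" and I="range (F i)"])
    show "(\<lambda>y. f q (snd y)) \<in> borel_measurable (borel \<Otimes>\<^sub>M N)" for q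
      by (rule measurable_compose[OF measurable_snd m])
    have fin: "finite (range (F i))" using F(1)[of i] by (simp add: simple_function_def)
    then show "countable (range (F i))" by (rule countable_finite)
    have "F i \<in> borel \<rightarrow>\<^sub>M count_space (range (F i))"
      using F(1)[of i] by (intro measurable_count_space_eq2[THEN iffD2])
        (auto simp: simple_function_def fin)
    then show "(\<lambda>y. F i (fst y)) \<in> borel \<Otimes>\<^sub>M N \<rightarrow>\<^sub>M count_space (range (F i))"
      by (rule measurable_compose[OF measurable_fst])
  qed
  then show ?thesis
  proof (rule borel_measurable_LIMSEQ_metric)
    fix y assume "y \<in> space (borel \<Otimes>\<^sub>M N :: ('x \<times> 's) measure)"
    then have "snd y \<in> space N" by (auto simp: space_pair_measure)
    then show "(\<lambda>i. f (F i (fst y)) (snd y)) \<longlonglongrightarrow> f (fst y) (snd y)"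
      using continuous_on_tendsto_compose[OF c[of "snd y"] F(2)[of "fst y"]] by simp
  qed
qed

text \<open>Only the probabilities themselves are assumed measurable in the state. Each component of
  the gradient is a pointwise limit of difference quotients with increment 1 / (n + 1), which are
  jointly measurable.\<close>

lemma gradient_measurable:
  fixes f :: "'x::euclidean_space \<Rightarrow> 's \<Rightarrow> real"
  assumes m: "\<And>x. f x \<in> borel_measurable N"
    and d: "\<And>s x. s \<in> space N \<Longrightarrow> (\<lambda>x. f x s) differentiable (at x)"
  shows "(\<lambda>y. gradient (\<lambda>x. f x (snd y)) (fst y)) \<in> borel_measurable (borel \<Otimes>\<^sub>M N)"
proof (rule borel_measurable_euclidean_space[THEN iffD2], rule ballI)
  fix e :: 'x
  have c: "continuous_on UNIV (\<lambda>x. f x s)" if "s \<in> space N" for s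
    using d[OF that] by (auto intro!: continuous_at_imp_continuous_on differentiable_imp_continuous_within)
  have fm: "(\<lambda>y. f (fst y) (snd y)) \<in> borel_measurable (borel \<Otimes>\<^sub>M N)"
    by (rule caratheodory_measurable[OF m c])
  define q where "q n y = real (Suc n) * (f (fst y + inverse (real (Suc n)) *\<^sub>R e) (snd y) - f (fst y) (snd y))"
    for n :: nat and y
  show "(\<lambda>y. gradient (\<lambda>x. f x (snd y)) (fst y) \<bullet> e) \<in> borel_measurable (borel \<Otimes>\<^sub>M N)"
  proof (rule borel_measurable_LIMSEQ_metric)
    fix n
    have "(\<lambda>y. (fst y + inverse (real (Suc n)) *\<^sub>R e, snd y)) \<in> borel \<Otimes>\<^sub>M N \<rightarrow>\<^sub>M borel \<Otimes>\<^sub>M N" by measurable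
    from measurable_compose[OF this fm] fm
    show "q n \<in> borel_measurable (borel \<Otimes>\<^sub>M N)" unfolding q_def by simp
  next
    fix y assume "y \<in> space (borel \<Otimes>\<^sub>M N :: ('x \<times> 's) measure)"
    then have s: "snd y \<in> space N" by (auto simp: space_pair_measure)
    define g where "g = gradient (\<lambda>x. f x (snd y)) (fst y)"
    have "((\<lambda>x. f x (snd y)) has_derivative (\<lambda>h. h \<bullet> g)) (at (fst y + 0 *\<^sub>R e))"
      using GDERIV_gradient[OF d[OF s, of "fst y"]] by (simp add: gderiv_def g_def)
    moreover have "((\<lambda>t::real. fst y + t *\<^sub>R e) has_derivative (\<lambda>t. t *\<^sub>R e)) (at 0)"
      by (auto intro!: derivative_eq_intros)
    ultimately have "((\<lambda>t. f (fst y + t *\<^sub>R e) (snd y)) has_derivative (\<lambda>t. (t *\<^sub>R e) \<bullet> g)) (at 0)"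
      using has_derivative_compose by blast
    then have "((\<lambda>t. f (fst y + t *\<^sub>R e) (snd y)) has_real_derivative (g \<bullet> e)) (at 0)"
      by (rule has_derivative_imp_has_field_derivative) (simp add: inner_commute)
    then have "((\<lambda>h. (f (fst y + h *\<^sub>R e) (snd y) - f (fst y) (snd y)) / h) \<longlongrightarrow> g \<bullet> e) (at 0)"
      by (simp add: DERIV_def)
    moreover have "filterlim (\<lambda>n. inverse (real (Suc n))) (at 0) sequentially"
      using LIMSEQ_inverse_real_of_nat by (auto simp: filterlim_at)
    ultimately have "(\<lambda>n. (f (fst y + inverse (real (Suc n)) *\<^sub>R e) (snd y) - f (fst y) (snd y)) / inverse (real (Suc n)))
        \<longlonglongrightarrow> g \<bullet> e" by (rule filterlim_compose)
    then show "(\<lambda>n. q n y) \<longlonglongrightarrow> gradient (\<lambda>x. f x (snd y)) (fst y) \<bullet> e"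
      unfolding q_def g_def[symmetric] by (simp add: divide_inverse mult.commute)
  qed
qed

section \<open>Mean value and Taylor estimates\<close>

lemma lipschitz_of_gradient_bound:
  fixes f :: "'v::euclidean_space \<Rightarrow> real"
  assumes "\<And>x. GDERIV f x :> g x" "\<And>x. norm (g x) \<le> L"
  shows "\<bar>f x - f y\<bar> \<le> L * norm (x - y)"
proof -
  have "norm (f x - f y) \<le> L * norm (x - y)"
  proof (rule differentiable_bound[where S=UNIV])
    show "(f has_derivative (\<lambda>h. h \<bullet> g u)) (at u within UNIV)" for u
      using assms(1)[of u] by (simp add: gderiv_def)
    show "onorm (\<lambda>h. h \<bullet> g u) \<le> L" for u
    proof (rule onorm_le)
      fix h :: 'v
      have "norm (h \<bullet> g u) \<le> norm h * norm (g u)" by (simp add: Cauchy_Schwarz_ineq2)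
      also have "\<dots> \<le> norm h * L" using assms(2) by (intro mult_left_mono) auto
      finally show "norm (h \<bullet> g u) \<le> L * norm h" by (simp add: mult.commute)
    qed
  qed auto
  then show ?thesis by simp
qed

text \<open>The mean value inequality is applied to f minus its linear part at x, whose gradient on
  the segment is at most L |y - x|. This gives the constant L rather than L / 2, which is enough for
  rates.\<close>

lemma taylor_lipschitz_gradient:
  fixes f :: "'v::euclidean_space \<Rightarrow> real"
  assumes K: "convex K" "x \<in> K" "y \<in> K"
    and d: "\<And>u. u \<in> K \<Longrightarrow> GDERIV f u :> g u"
    and L: "0 \<le> L" "\<And>u v. u \<in> K \<Longrightarrow> v \<in> K \<Longrightarrow> norm (g u - g v) \<le> L * norm (u - v)"
  shows "\<bar>f y - f x - g x \<bullet> (y - x)\<bar> \<le> L * (norm (y - x))\<^sup>2"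
proof -
  define F where "F u = f u - u \<bullet> g x" for u
  have sub: "closed_segment x y \<subseteq> K" using K by (simp add: closed_segment_subset)
  have "norm (F y - F x) \<le> (L * norm (y - x)) * norm (y - x)"
  proof (rule differentiable_bound[where S="closed_segment x y"])
    fix u assume u: "u \<in> closed_segment x y"
    then have uK: "u \<in> K" using sub by auto
    have "(f has_derivative (\<lambda>h. h \<bullet> g u)) (at u)" using d[OF uK] by (simp add: gderiv_def)
    then have "(F has_derivative (\<lambda>h. h \<bullet> g u - h \<bullet> g x)) (at u)"
      unfolding F_def by (auto intro!: derivative_eq_intros)
    then show "(F has_derivative (\<lambda>h. h \<bullet> (g u - g x))) (at u within closed_segment x y)"
      by (simp add: inner_diff_right has_derivative_at_withinI)
    show "onorm (\<lambda>h. h \<bullet> (g u - g x)) \<le> L * norm (y - x)"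
    proof (rule onorm_le)
      fix h :: 'v
      have "norm (g u - g x) \<le> L * norm (u - x)" using L(2)[OF uK K(2)] .
      also have "\<dots> \<le> L * norm (y - x)"
        using segment_bound(1)[OF u] L(1) by (intro mult_left_mono) (auto simp: norm_minus_commute)
      finally have "norm h * norm (g u - g x) \<le> norm h * (L * norm (y - x))" by (intro mult_left_mono) auto
      then show "norm (h \<bullet> (g u - g x)) \<le> L * norm (y - x) * norm h"
        using Cauchy_Schwarz_ineq2[of h "g u - g x"] by (simp add: mult.commute)
    qed
  qed auto
  also have "F y - F x = f y - f x - g x \<bullet> (y - x)"
    unfolding F_def by (simp add: inner_diff_right inner_commute)
  finally show ?thesis by (simp add: power2_eq_square mult.assoc)
qed

text \<open>Every quantity of the analysis is such a family; the closure properties below replace the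
  bookkeeping of explicit Lipschitz constants.\<close>

definition reg_family ::
  "'o measure \<Rightarrow> 'x::{real_normed_vector, second_countable_topology} set \<Rightarrow>
   ('x \<Rightarrow> 'o \<Rightarrow> 'v::{real_normed_vector, second_countable_topology}) \<Rightarrow> bool" where
  "reg_family N K f \<longleftrightarrow> (\<lambda>y. f (fst y) (snd y)) \<in> borel_measurable (borel \<Otimes>\<^sub>M N) \<and>
     (\<exists>B\<ge>0. \<forall>z\<in>space N. \<forall>x\<in>K. norm (f x z) \<le> B \<and> (\<forall>y\<in>K. norm (f x z - f y z) \<le> B * norm (x - y)))"

text \<open>The definition uses one nonnegative number both as bound and as Lipschitz constant; the
  sum of the absolute values dominates B and L whatever their signs.\<close>

lemma reg_familyI:
  assumes "(\<lambda>y. f (fst y) (snd y)) \<in> borel_measurable (borel \<Otimes>\<^sub>M N)"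
    and "\<And>x z. x \<in> K \<Longrightarrow> z \<in> space N \<Longrightarrow> norm (f x z) \<le> B"
    and "\<And>x y z. x \<in> K \<Longrightarrow> y \<in> K \<Longrightarrow> z \<in> space N \<Longrightarrow> norm (f x z - f y z) \<le> L * norm (x - y)"
  shows "reg_family N K f"
  unfolding reg_family_def
proof (intro conjI assms(1) exI[of _ "\<bar>B\<bar> + \<bar>L\<bar>"] ballI)
  fix z x y assume "z \<in> space N" "x \<in> K" "y \<in> K"
  have "L * norm (x - y) \<le> (\<bar>B\<bar> + \<bar>L\<bar>) * norm (x - y)" by (intro mult_right_mono) auto
  with assms(3)[OF \<open>x \<in> K\<close> \<open>y \<in> K\<close> \<open>z \<in> space N\<close>]
  show "norm (f x z - f y z) \<le> (\<bar>B\<bar> + \<bar>L\<bar>) * norm (x - y)" by linarith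
next
  fix z x assume "z \<in> space N" "x \<in> K"
  with assms(2)[of x z] show "norm (f x z) \<le> \<bar>B\<bar> + \<bar>L\<bar>" by simp
qed auto

lemma reg_familyE:
  assumes "reg_family N K f"
  obtains B where "0 \<le> B" "\<And>x z. x \<in> K \<Longrightarrow> z \<in> space N \<Longrightarrow> norm (f x z) \<le> B"
    "\<And>x y z. x \<in> K \<Longrightarrow> y \<in> K \<Longrightarrow> z \<in> space N \<Longrightarrow> norm (f x z - f y z) \<le> B * norm (x - y)"
  using assms unfolding reg_family_def by blast

lemma reg_family_measurable:
  "reg_family N K f \<Longrightarrow> (\<lambda>y. f (fst y) (snd y)) \<in> borel_measurable (borel \<Otimes>\<^sub>M N)"
  by (simp add: reg_family_def)

lemma reg_family_section: "reg_family N K f \<Longrightarrow> f x \<in> borel_measurable N"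
  using measurable_compose[OF measurable_Pair1'[of x borel N] reg_family_measurable] by auto

lemma reg_family_const:
  assumes "g \<in> borel_measurable N" "\<And>z. z \<in> space N \<Longrightarrow> norm (g z) \<le> B"
  shows "reg_family N K (\<lambda>x. g)"
  by (rule reg_familyI[where B=B and L=0]) (use assms in auto)

lemma reg_family_linear:
  assumes A: "bounded_linear A" and f: "reg_family N K f"
  shows "reg_family N K (\<lambda>x z. A (f x z))"
proof -
  interpret A: bounded_linear A by fact
  obtain b where b: "0 < b" "\<And>v. norm (A v) \<le> norm v * b" using A.pos_bounded by blast
  obtain B where B: "0 \<le> B" "\<And>x z. x \<in> K \<Longrightarrow> z \<in> space N \<Longrightarrow> norm (f x z) \<le> B"
    "\<And>x y z. x \<in> K \<Longrightarrow> y \<in> K \<Longrightarrow> z \<in> space N \<Longrightarrow> norm (f x z - f y z) \<le> B * norm (x - y)"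
    using reg_familyE[OF f] by metis
  show ?thesis
  proof (rule reg_familyI[where B="B * b" and L="B * b"])
    have "A \<in> borel_measurable borel"
      by (intro borel_measurable_continuous_onI A.continuous_on continuous_on_id)
    with reg_family_measurable[OF f]
    show "(\<lambda>y. A (f (fst y) (snd y))) \<in> borel_measurable (borel \<Otimes>\<^sub>M N)" by (rule measurable_compose)
    show "norm (A (f x z)) \<le> B * b" if "x \<in> K" "z \<in> space N" for x z
      using order_trans[OF b(2) mult_right_mono[OF B(2)[OF that]]] b(1) by simp
    show "norm (A (f x z) - A (f y z)) \<le> B * b * norm (x - y)" if "x \<in> K" "y \<in> K" "z \<in> space N" for x y z
      using order_trans[OF b(2) mult_right_mono[OF B(3)[OF that]]] b(1)
      by (simp add: A.diff[symmetric] mult_ac)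
  qed
qed

lemma reg_family_add:
  assumes f: "reg_family N K f" and g: "reg_family N K g"
  shows "reg_family N K (\<lambda>x z. f x z + g x z)"
proof -
  obtain A where A: "0 \<le> A" "\<And>x z. x \<in> K \<Longrightarrow> z \<in> space N \<Longrightarrow> norm (f x z) \<le> A"
    "\<And>x y z. x \<in> K \<Longrightarrow> y \<in> K \<Longrightarrow> z \<in> space N \<Longrightarrow> norm (f x z - f y z) \<le> A * norm (x - y)"
    using reg_familyE[OF f] by metis
  obtain B where B: "0 \<le> B" "\<And>x z. x \<in> K \<Longrightarrow> z \<in> space N \<Longrightarrow> norm (g x z) \<le> B"
    "\<And>x y z. x \<in> K \<Longrightarrow> y \<in> K \<Longrightarrow> z \<in> space N \<Longrightarrow> norm (g x z - g y z) \<le> B * norm (x - y)"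
    using reg_familyE[OF g] by metis
  show ?thesis
  proof (rule reg_familyI[where B="A + B" and L="A + B"])
    show "(\<lambda>y. f (fst y) (snd y) + g (fst y) (snd y)) \<in> borel_measurable (borel \<Otimes>\<^sub>M N)"
      using reg_family_measurable[OF f] reg_family_measurable[OF g] by simp
    show "norm (f x z + g x z) \<le> A + B" if "x \<in> K" "z \<in> space N" for x z
      by (rule norm_triangle_le[OF add_mono[OF A(2) B(2)]]) (use that in auto)
    fix x y z assume *: "x \<in> K" "y \<in> K" "z \<in> space N"
    have eq: "f x z + g x z - (f y z + g y z) = (f x z - f y z) + (g x z - g y z)" by simp
    show "norm (f x z + g x z - (f y z + g y z)) \<le> (A + B) * norm (x - y)"
      unfolding eq distrib_right by (rule norm_triangle_le[OF add_mono[OF A(3)[OF *] B(3)[OF *]]])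
  qed
qed

lemma reg_family_bilinear:
  assumes P: "bounded_bilinear pr" and f: "reg_family N K f" and g: "reg_family N K g"
  shows "reg_family N K (\<lambda>x z. pr (f x z) (g x z))"
proof -
  interpret P: bounded_bilinear pr by fact
  obtain p where p: "0 \<le> p" "\<And>a b. norm (pr a b) \<le> norm a * norm b * p" using P.nonneg_bounded by blast
  obtain A where A: "0 \<le> A" "\<And>x z. x \<in> K \<Longrightarrow> z \<in> space N \<Longrightarrow> norm (f x z) \<le> A"
    "\<And>x y z. x \<in> K \<Longrightarrow> y \<in> K \<Longrightarrow> z \<in> space N \<Longrightarrow> norm (f x z - f y z) \<le> A * norm (x - y)"
    using reg_familyE[OF f] by metis
  obtain B where B: "0 \<le> B" "\<And>x z. x \<in> K \<Longrightarrow> z \<in> space N \<Longrightarrow> norm (g x z) \<le> B"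
    "\<And>x y z. x \<in> K \<Longrightarrow> y \<in> K \<Longrightarrow> z \<in> space N \<Longrightarrow> norm (g x z - g y z) \<le> B * norm (x - y)"
    using reg_familyE[OF g] by metis
  have pb: "norm (pr a b) \<le> s * t * p" if "norm a \<le> s" "norm b \<le> t" for a b s t
    using p(2)[of a b] that p(1) by (meson mult_mono mult_right_mono norm_ge_zero order_trans)
  show ?thesis
  proof (rule reg_familyI[where B="A * B * p" and L="2 * A * B * p"])
    have c: "continuous_on UNIV (\<lambda>y. pr (fst y) (snd y))"
      by (intro P.continuous_on continuous_intros)
    show "(\<lambda>y. pr (f (fst y) (snd y)) (g (fst y) (snd y))) \<in> borel_measurable (borel \<Otimes>\<^sub>M N)"
      by (rule borel_measurable_continuous_Pair[OF reg_family_measurable[OF f] reg_family_measurable[OF g] c])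
    show "norm (pr (f x z) (g x z)) \<le> A * B * p" if "x \<in> K" "z \<in> space N" for x z
      using A B that by (intro pb) auto
    fix x y z assume *: "x \<in> K" "y \<in> K" "z \<in> space N"
    have "pr (f x z) (g x z) - pr (f y z) (g y z) = pr (f x z - f y z) (g x z) + pr (f y z) (g x z - g y z)"
      by (simp add: P.diff_left P.diff_right)
    also have "norm \<dots> \<le> (A * norm (x - y)) * B * p + A * (B * norm (x - y)) * p"
      using A B * by (intro norm_triangle_le add_mono pb) auto
    finally show "norm (pr (f x z) (g x z) - pr (f y z) (g y z)) \<le> 2 * A * B * p * norm (x - y)"
      by (simp add: algebra_simps)
  qed
qed

lemmas reg_family_scaleR = reg_family_bilinear[OF bounded_bilinear_scaleR]
lemmas reg_family_mult = reg_family_bilinear[OF bounded_bilinear_mult]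
lemmas reg_family_inner = reg_family_bilinear[OF bounded_bilinear_inner]

lemma reg_family_cmult: "reg_family N K f \<Longrightarrow> reg_family N K (\<lambda>x z. c *\<^sub>R f x z)"
  by (rule reg_family_linear[OF bounded_linear_scaleR_right])

lemma reg_family_diff:
  assumes f: "reg_family N K f" and g: "reg_family N K g"
  shows "reg_family N K (\<lambda>x z. f x z - g x z)"
  using reg_family_add[OF f reg_family_cmult[OF g, of "-1"]] by simp

lemma reg_family_sum:
  assumes "\<And>i. i \<in> I \<Longrightarrow> reg_family N K (f i)"
  shows "reg_family N K (\<lambda>x z. \<Sum>i\<in>I. f i x z)"
  using assms
proof (induction I rule: infinite_finite_induct)
  case (insert i I)
  then show ?case using reg_family_add[of N K "f i" "\<lambda>x z. \<Sum>i\<in>I. f i x z"] by simp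
qed (auto intro: reg_family_const[where B=0])

text \<open>A mean over a fixed law does not depend on z; it is kept as a family so that it can be
  combined with genuine families by the same closure rules.\<close>

lemma reg_family_integral:
  fixes f :: "'x::{real_normed_vector, second_countable_topology} \<Rightarrow> 'o \<Rightarrow> 'v::{banach, second_countable_topology}"
  assumes nu: "prob_space \<nu>" and s: "sets \<nu> = sets N" and f: "reg_family N K f"
  shows "reg_family N K (\<lambda>x z. \<integral>u. f x u \<partial>\<nu>)"
proof -
  interpret prob_space \<nu> by fact
  have sp: "space \<nu> = space N" using s by (rule sets_eq_imp_space_eq)
  obtain B where B: "0 \<le> B" "\<And>x z. x \<in> K \<Longrightarrow> z \<in> space N \<Longrightarrow> norm (f x z) \<le> B"
    "\<And>x y z. x \<in> K \<Longrightarrow> y \<in> K \<Longrightarrow> z \<in> space N \<Longrightarrow> norm (f x z - f y z) \<le> B * norm (x - y)"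
    using reg_familyE[OF f] by metis
  have fm: "f x \<in> borel_measurable \<nu>" for x
    using reg_family_section[OF f] by (simp add: measurable_cong_sets[OF s refl])
  have fi: "integrable \<nu> (f x)" if "x \<in> K" for x
    by (rule integrable_bounded_prob[OF nu fm]) (use B(2) that sp in auto)
  show ?thesis
  proof (rule reg_familyI[where B=B and L=B])
    have "(\<lambda>y. f (fst y) (snd y)) \<in> borel_measurable (borel \<Otimes>\<^sub>M \<nu>)"
      using reg_family_measurable[OF f] by (simp add: measurable_cong_sets[OF sets_pair_measure_cong[OF refl s] refl])
    then have "(\<lambda>x. \<integral>u. f x u \<partial>\<nu>) \<in> borel_measurable borel"
      by (intro borel_measurable_lebesgue_integral) (simp add: case_prod_unfold)
    then show "(\<lambda>y. \<integral>u. f (fst y) u \<partial>\<nu>) \<in> borel_measurable (borel \<Otimes>\<^sub>M N)"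
      by (rule measurable_compose[OF measurable_fst])
    show "norm (\<integral>u. f x u \<partial>\<nu>) \<le> B" if "x \<in> K" for x
      by (rule norm_integral_le_prob[OF nu fm]) (use B(2) that sp in auto)
    fix x y assume *: "x \<in> K" "y \<in> K"
    have "norm (\<integral>u. f x u - f y u \<partial>\<nu>) \<le> B * norm (x - y)"
      by (rule norm_integral_le_prob[OF nu borel_measurable_diff[OF fm fm]]) (use B(3) * sp in auto)
    then show "norm ((\<integral>u. f x u \<partial>\<nu>) - (\<integral>u. f y u \<partial>\<nu>)) \<le> B * norm (x - y)"
      using fi[OF *(1)] fi[OF *(2)] by simp
  qed
qed

section \<open>The Greedy-GQ model\<close>

locale greedy_gq_model = behaviour_chain S P \<pi>b
  for S :: "(real^'d) set"
    and P :: "(real^'d) \<times> 'a::finite \<Rightarrow> (real^'d) measure"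
    and \<pi>b :: "real^'d \<Rightarrow> 'a pmf" +
  fixes \<gamma> r_max k1 k2 :: real
    and r :: "real^'d \<Rightarrow> 'a \<Rightarrow> real^'d \<Rightarrow> real"
    and \<phi> :: "real^'d \<Rightarrow> 'a \<Rightarrow> real^'n"
    and \<pi> :: "real^'n \<Rightarrow> real^'d \<Rightarrow> 'a pmf"
    and \<mu> :: "((real^'d) \<times> 'a) measure"
  assumes inv: "invariant_measure (sa_space S) (sa_kernel S P \<pi>b) \<mu>"
    and discount: "0 < \<gamma>" "\<gamma> < 1"
    and r_meas: "(\<lambda>((s, a), s'). r s a s') \<in> borel_measurable (sa_space S \<Otimes>\<^sub>M state_space S)"
    and r_bound: "\<And>s a s'. s \<in> S \<Longrightarrow> s' \<in> S \<Longrightarrow> 0 \<le> r s a s' \<and> r s a s' \<le> r_max"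
    and phi_meas: "\<And>a. (\<lambda>s. \<phi> s a) \<in> borel_measurable (state_space S)"
    and target_meas: "\<And>\<theta> a. (\<lambda>s. pmf (\<pi> \<theta> s) a) \<in> borel_measurable (state_space S)"
    and target_diff: "\<And>\<theta> s a. s \<in> S \<Longrightarrow> (\<lambda>\<theta>'. pmf (\<pi> \<theta>' s) a) differentiable (at \<theta>)"
    and C_nonsingular: "invertible (feature_cov \<mu> \<phi>)"
    and phi_bound: "\<And>s a. s \<in> S \<Longrightarrow> norm (\<phi> s a) \<le> 1"
    and target_grad_bound: "\<And>\<theta> s a. s \<in> S \<Longrightarrow>
      norm (gradient (\<lambda>\<theta>'. pmf (\<pi> \<theta>' s) a) \<theta>) \<le> k1"
    and target_grad_lipschitz: "\<And>\<theta>1 \<theta>2 s a. s \<in> S \<Longrightarrow>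
      norm (gradient (\<lambda>\<theta>'. pmf (\<pi> \<theta>' s) a) \<theta>1 - gradient (\<lambda>\<theta>'. pmf (\<pi> \<theta>' s) a) \<theta>2)
        \<le> k2 * norm (\<theta>1 - \<theta>2)"
begin

abbreviation "\<nu> \<equiv> stationary_obs \<mu>"
abbreviation "C \<equiv> feature_cov \<mu> \<phi>"
abbreviation "C_inv \<equiv> matrix_inv (feature_cov \<mu> \<phi>)"
abbreviation "J \<equiv> mspbe \<mu> P \<gamma> r \<phi> \<pi>"

text \<open>An iterate is \<open>x = (\<theta>, \<omega>)\<close>, an observation is \<open>z = ((s, a), s')\<close>.\<close>

definition iter_ball :: "real \<Rightarrow> ((real^'n) \<times> (real^'n)) set" where
  "iter_ball R = cball 0 R \<times> cball 0 R"

definition feat :: "((real^'d) \<times> 'a) \<times> (real^'d) \<Rightarrow> real^'n" where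
  "feat z = \<phi> (fst (fst z)) (snd (fst z))"

definition td :: "(real^'n) \<times> (real^'n) \<Rightarrow> ((real^'d) \<times> 'a) \<times> (real^'d) \<Rightarrow> real" where
  "td x z = td_error \<gamma> r \<phi> \<pi> (fst (fst z)) (snd (fst z)) (snd z) (fst x)"

definition next_feat :: "(real^'n) \<times> (real^'n) \<Rightarrow> ((real^'d) \<times> 'a) \<times> (real^'d) \<Rightarrow> real^'n" where
  "next_feat x z = phi_hat \<phi> \<pi> (snd z) (fst x)"

text \<open>A function of \<theta> only, as are \<open>omega_star\<close> and \<open>grad_J\<close>.
  All take the full iterate as argument so that they fit the calculus of regular families; the
  \<open>_cong\<close> lemmas below recover the independence of \<omega>.\<close>

definition gbar :: "(real^'n) \<times> (real^'n) \<Rightarrow> real^'n" where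
  "gbar x = (\<integral>z. td x z *\<^sub>R feat z \<partial>\<nu>)"

definition omega_star :: "(real^'n) \<times> (real^'n) \<Rightarrow> real^'n" where
  "omega_star x = C_inv *v gbar x"

definition theta_dir where
  "theta_dir x z = td x z *\<^sub>R feat z - (\<gamma> * (snd x \<bullet> feat z)) *\<^sub>R next_feat x z"

definition omega_dir where
  "omega_dir x z = (td x z - feat z \<bullet> snd x) *\<^sub>R feat z"

definition ideal_dir where
  "ideal_dir x z = td x z *\<^sub>R feat z - (\<gamma> * (omega_star x \<bullet> feat z)) *\<^sub>R next_feat x z"

definition next_iter where
  "next_iter \<alpha> \<beta> x z = (fst x + \<alpha> *\<^sub>R theta_dir x z, snd x + \<beta> *\<^sub>R omega_dir x z)"

text \<open>Introduced by its formula, from which regularity is immediate; \<open>gradient_J\<close>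
  identifies it with the true gradient of the objective.\<close>

definition grad_J :: "(real^'n) \<times> (real^'n) \<Rightarrow> real^'n" where
  "grad_J x = (-2) *\<^sub>R (\<integral>z. ideal_dir x z \<partial>\<nu>)"

definition track_err :: "(real^'n) \<times> (real^'n) \<Rightarrow> real^'n" where
  "track_err x = snd x - omega_star x"

text \<open>The means of \<open>ideal_dir x\<close> and \<open>omega_dir x\<close> under the
  stationary law are minus half of \<open>grad_J x\<close> and minus
  \<open>C *v track_err x\<close>, so both brackets are centred. The weight \<kappa> is that of the
  tracking error in the drift inequality.\<close>

definition noise :: "real \<Rightarrow> (real^'n) \<times> (real^'n) \<Rightarrow> ((real^'d) \<times> 'a) \<times> (real^'d) \<Rightarrow> real" where
  "noise \<kappa> x z = grad_J x \<bullet> (ideal_dir x z + (1/2) *\<^sub>R grad_J x)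
     + \<kappa> * (track_err x \<bullet> (omega_dir x z + C *v track_err x))"

lemma nu_prob: "prob_space \<nu>" and sets_nu: "sets \<nu> = sets Obs" and space_nu: "space \<nu> = (S \<times> UNIV) \<times> S"
  using stationary_obs_prob[OF inv] sets_stationary_obs[OF inv] space_stationary_obs[OF inv] by auto

lemma space_Obs: "space Obs = (S \<times> UNIV) \<times> S"
  by (simp add: space_pair_measure)

lemma in_iter_ball: "x \<in> iter_ball R \<longleftrightarrow> norm (fst x) \<le> R \<and> norm (snd x) \<le> R"
  by (cases x) (auto simp: iter_ball_def)

subsection \<open>Regularity of the update directions\<close>

lemma GDERIV_target: "s \<in> S \<Longrightarrow> GDERIV (\<lambda>\<theta>'. pmf (\<pi> \<theta>' s) a) \<theta> :> gradient (\<lambda>\<theta>'. pmf (\<pi> \<theta>' s) a) \<theta>"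
  by (rule GDERIV_gradient[OF target_diff])

lemma feat_measurable: "feat \<in> borel_measurable Obs"
  unfolding feat_def
proof (rule measurable_compose_countable'[where f="\<lambda>a z. \<phi> (fst (fst z)) a" and I=UNIV])
  show "(\<lambda>z. \<phi> (fst (fst z)) a) \<in> borel_measurable Obs" for a
    by (rule measurable_compose[OF _ phi_meas]) measurable
qed (auto intro: countable_finite)

lemma feat_bound: "z \<in> space Obs \<Longrightarrow> norm (feat z) \<le> 1"
  unfolding space_Obs feat_def by (auto intro: phi_bound)

lemma reg_feat: "reg_family Obs K (\<lambda>x. feat)"
  by (rule reg_family_const[OF feat_measurable feat_bound])

lemma reg_fst: "reg_family Obs (iter_ball R) (\<lambda>x z. fst x)"
proof (rule reg_familyI[where L=1])
  show "(\<lambda>y. fst (fst y)) \<in> borel_measurable ((borel :: ((real^'n) \<times> (real^'n)) measure) \<Otimes>\<^sub>M Obs)"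
    by (rule measurable_compose[OF measurable_fst], rule borel_measurable_continuous_onI) (intro continuous_intros)
  show "norm (fst x) \<le> R" if "x \<in> iter_ball R" for x using that by (simp add: in_iter_ball)
  show "norm (fst x - fst y) \<le> 1 * norm (x - y)" for x y :: "(real^'n) \<times> (real^'n)"
    using norm_fst_le[of "fst x - fst y" "snd x - snd y"] by (simp add: minus_prod_def)
qed

lemma reg_snd: "reg_family Obs (iter_ball R) (\<lambda>x z. snd x)"
proof (rule reg_familyI[where L=1])
  show "(\<lambda>y. snd (fst y)) \<in> borel_measurable ((borel :: ((real^'n) \<times> (real^'n)) measure) \<Otimes>\<^sub>M Obs)"
    by (rule measurable_compose[OF measurable_fst], rule borel_measurable_continuous_onI) (intro continuous_intros)
  show "norm (snd x) \<le> R" if "x \<in> iter_ball R" for x using that by (simp add: in_iter_ball)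
  show "norm (snd x - snd y) \<le> 1 * norm (x - y)" for x y :: "(real^'n) \<times> (real^'n)"
    using norm_snd_le[of "snd x - snd y" "fst x - fst y"] by (simp add: minus_prod_def)
qed

lemma reg_next_phi: "reg_family Obs K (\<lambda>x z. \<phi> (snd z) a)"
  by (rule reg_family_const[OF measurable_compose[OF measurable_snd phi_meas]])
    (auto simp: space_Obs intro: phi_bound)

lemma theta_next_measurable:
  assumes "(\<lambda>y. f (fst y) (snd y)) \<in> borel_measurable (borel \<Otimes>\<^sub>M SS)"
  shows "(\<lambda>y. f (fst (fst y)) (snd (snd y)))
    \<in> borel_measurable ((borel :: ((real^'n) \<times> (real^'n)) measure) \<Otimes>\<^sub>M Obs)"
proof -
  have "(fst :: (real^'n) \<times> (real^'n) \<Rightarrow> _) \<in> borel \<rightarrow>\<^sub>M borel"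
    by (rule borel_measurable_continuous_onI) (intro continuous_intros)
  then have "(\<lambda>y. (fst (fst y), snd (snd y))) \<in> (borel :: ((real^'n) \<times> (real^'n)) measure) \<Otimes>\<^sub>M Obs \<rightarrow>\<^sub>M borel \<Otimes>\<^sub>M SS"
    by (intro measurable_Pair measurable_compose[OF measurable_fst] measurable_compose[OF measurable_snd]) simp_all
  from measurable_compose[OF this assms] show ?thesis by simp
qed

lemma norm_fst_diff_le: "0 \<le> L \<Longrightarrow> L * norm (fst x - fst y) \<le> L * norm (x - y)"
  for x y :: "(real^'n) \<times> (real^'n)"
  using norm_fst_le[of "fst x - fst y" "snd x - snd y"]
  by (intro mult_left_mono) (simp_all add: minus_prod_def)

text \<open>The gradient bound gives the Lipschitz estimate by the mean value inequality;
  differentiability gives the continuity that joint measurability rests on.\<close>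

lemma reg_target: "reg_family Obs K (\<lambda>x z. pmf (\<pi> (fst x) (snd z)) a)"
  for K :: "((real^'n) \<times> (real^'n)) set"
proof (rule reg_familyI[where B=1 and L="\<bar>k1\<bar>"])
  have c: "continuous_on UNIV (\<lambda>\<theta>. pmf (\<pi> \<theta> s) a)" if "s \<in> space SS" for s
    using target_diff that by (auto intro!: continuous_at_imp_continuous_on differentiable_imp_continuous_within)
  show "(\<lambda>y. pmf (\<pi> (fst (fst y)) (snd (snd y))) a)
      \<in> borel_measurable ((borel :: ((real^'n) \<times> (real^'n)) measure) \<Otimes>\<^sub>M Obs)"
    by (rule theta_next_measurable[OF caratheodory_measurable[OF target_meas c]])
  show "norm (pmf (\<pi> (fst x) (snd z)) a) \<le> 1" for x :: "(real^'n) \<times> (real^'n)" and z :: "((real^'d) \<times> 'a) \<times> (real^'d)"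
    by (simp add: pmf_le_1)
  fix x y :: "(real^'n) \<times> (real^'n)" and z :: "((real^'d) \<times> 'a) \<times> (real^'d)"
  assume "z \<in> space Obs"
  then have s: "snd z \<in> S" by (auto simp: space_Obs)
  have "norm (pmf (\<pi> (fst x) (snd z)) a - pmf (\<pi> (fst y) (snd z)) a) \<le> \<bar>k1\<bar> * norm (fst x - fst y)"
    using lipschitz_of_gradient_bound[OF GDERIV_target[OF s], where L="\<bar>k1\<bar>"] target_grad_bound[OF s, of a]
    by (simp add: order_trans[OF _ abs_ge_self])
  also have "\<dots> \<le> \<bar>k1\<bar> * norm (x - y)" by (rule norm_fst_diff_le) simp
  finally show "norm (pmf (\<pi> (fst x) (snd z)) a - pmf (\<pi> (fst y) (snd z)) a) \<le> \<bar>k1\<bar> * norm (x - y)" .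
qed

lemma reg_target_gradient: "reg_family Obs K (\<lambda>x z. gradient (\<lambda>\<theta>'. pmf (\<pi> \<theta>' (snd z)) a) (fst x))"
  for K :: "((real^'n) \<times> (real^'n)) set"
proof (rule reg_familyI[where B=k1 and L="\<bar>k2\<bar>"])
  show "(\<lambda>y. gradient (\<lambda>\<theta>'. pmf (\<pi> \<theta>' (snd (snd y))) a) (fst (fst y)))
      \<in> borel_measurable ((borel :: ((real^'n) \<times> (real^'n)) measure) \<Otimes>\<^sub>M Obs)"
    by (rule theta_next_measurable[where f="\<lambda>\<theta> s. gradient (\<lambda>\<theta>'. pmf (\<pi> \<theta>' s) a) \<theta>"], rule gradient_measurable)
      (auto intro: target_meas target_diff)
  fix x y :: "(real^'n) \<times> (real^'n)" and z :: "((real^'d) \<times> 'a) \<times> (real^'d)"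
  assume "z \<in> space Obs"
  then have s: "snd z \<in> S" by (auto simp: space_Obs)
  show "norm (gradient (\<lambda>\<theta>'. pmf (\<pi> \<theta>' (snd z)) a) (fst x)) \<le> k1" by (rule target_grad_bound[OF s])
  have "norm (gradient (\<lambda>\<theta>'. pmf (\<pi> \<theta>' (snd z)) a) (fst x) - gradient (\<lambda>\<theta>'. pmf (\<pi> \<theta>' (snd z)) a) (fst y))
      \<le> k2 * norm (fst x - fst y)" by (rule target_grad_lipschitz[OF s])
  also have "\<dots> \<le> \<bar>k2\<bar> * norm (fst x - fst y)" by (intro mult_right_mono) auto
  also have "\<dots> \<le> \<bar>k2\<bar> * norm (x - y)" by (rule norm_fst_diff_le) simp
  finally show "norm (gradient (\<lambda>\<theta>'. pmf (\<pi> \<theta>' (snd z)) a) (fst x) - gradient (\<lambda>\<theta>'. pmf (\<pi> \<theta>' (snd z)) a) (fst y))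
      \<le> \<bar>k2\<bar> * norm (x - y)" .
qed

lemma reg_reward: "reg_family Obs K (\<lambda>x z. r (fst (fst z)) (snd (fst z)) (snd z))"
proof (rule reg_family_const[where B=r_max])
  show "(\<lambda>z. r (fst (fst z)) (snd (fst z)) (snd z)) \<in> borel_measurable Obs"
    using r_meas by (simp add: case_prod_unfold)
  show "norm (r (fst (fst z)) (snd (fst z)) (snd z)) \<le> r_max" if "z \<in> space Obs" for z
    using that r_bound[of "fst (fst z)" "snd z" "snd (fst z)"] by (auto simp: space_Obs)
qed

lemma reg_td: "reg_family Obs (iter_ball R) td"
proof -
  \<comment> \<open>The discount is written as a scalar multiplication so that
    \<open>reg_family_cmult\<close> matches; simplification turns it back into a product of
    reals.\<close>
  have "reg_family Obs (iter_ball R) (\<lambda>x z. r (fst (fst z)) (snd (fst z)) (snd z)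
      + \<gamma> *\<^sub>R (\<Sum>a\<in>UNIV. pmf (\<pi> (fst x) (snd z)) a * (fst x \<bullet> \<phi> (snd z) a)) - fst x \<bullet> feat z)"
    by (intro reg_family_add reg_family_diff reg_family_cmult reg_family_sum reg_family_mult reg_family_inner
        reg_reward reg_target reg_fst reg_next_phi reg_feat)
  then show ?thesis by (simp add: td_def[abs_def] td_error_def Vbar_def feat_def)
qed

lemma reg_next_feat: "reg_family Obs (iter_ball R) next_feat"
  unfolding next_feat_def phi_hat_def
  by (intro reg_family_add reg_family_sum reg_family_scaleR reg_family_inner
      reg_target reg_target_gradient reg_fst reg_next_phi)

lemma reg_gbar: "reg_family Obs (iter_ball R) (\<lambda>x z. gbar x)"
  unfolding gbar_def
  by (intro reg_family_integral[OF nu_prob sets_nu] reg_family_scaleR reg_td reg_feat)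

lemma reg_omega_star: "reg_family Obs (iter_ball R) (\<lambda>x z. omega_star x)"
  unfolding omega_star_def by (intro reg_family_linear[OF matrix_vector_mul_bounded_linear] reg_gbar)

lemma reg_theta_dir: "reg_family Obs (iter_ball R) theta_dir"
proof -
  have "reg_family Obs (iter_ball R) (\<lambda>x z. td x z *\<^sub>R feat z - (\<gamma> *\<^sub>R (snd x \<bullet> feat z)) *\<^sub>R next_feat x z)"
    by (intro reg_family_diff reg_family_scaleR reg_family_cmult reg_family_inner reg_td reg_feat reg_snd reg_next_feat)
  then show ?thesis by (simp add: theta_dir_def[abs_def])
qed

lemma reg_omega_dir: "reg_family Obs (iter_ball R) omega_dir"
  unfolding omega_dir_def
  by (intro reg_family_diff reg_family_scaleR reg_family_inner reg_td reg_feat reg_snd)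

lemma reg_ideal_dir: "reg_family Obs (iter_ball R) ideal_dir"
proof -
  have "reg_family Obs (iter_ball R) (\<lambda>x z. td x z *\<^sub>R feat z - (\<gamma> *\<^sub>R (omega_star x \<bullet> feat z)) *\<^sub>R next_feat x z)"
    by (intro reg_family_diff reg_family_scaleR reg_family_cmult reg_family_inner reg_td reg_feat reg_omega_star reg_next_feat)
  then show ?thesis by (simp add: ideal_dir_def[abs_def])
qed

lemma reg_grad_J: "reg_family Obs (iter_ball R) (\<lambda>x z. grad_J x)"
  unfolding grad_J_def
  by (intro reg_family_cmult reg_family_integral[OF nu_prob sets_nu] reg_ideal_dir)

lemma reg_track_err: "reg_family Obs (iter_ball R) (\<lambda>x z. track_err x)"
  unfolding track_err_def by (intro reg_family_diff reg_snd reg_omega_star)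

lemma reg_noise: "reg_family Obs (iter_ball R) (noise \<kappa>)"
proof -
  have "reg_family Obs (iter_ball R) (\<lambda>x z. grad_J x \<bullet> (ideal_dir x z + (1/2) *\<^sub>R grad_J x)
     + \<kappa> *\<^sub>R (track_err x \<bullet> (omega_dir x z + C *v track_err x)))"
    by (intro reg_family_add reg_family_cmult reg_family_inner reg_grad_J reg_ideal_dir reg_track_err reg_omega_dir
        reg_family_linear[OF matrix_vector_mul_bounded_linear])
  then show ?thesis by (simp add: noise_def[abs_def])
qed

subsection \<open>The feature covariance\<close>

lemma reg_integrable:
  fixes f :: "_ \<Rightarrow> _ \<Rightarrow> 'v::{banach, second_countable_topology}"
  assumes f: "reg_family Obs K f" and x: "x \<in> K"
  shows "integrable \<nu> (f x)"
proof -
  obtain B where B: "\<And>x z. x \<in> K \<Longrightarrow> z \<in> space Obs \<Longrightarrow> norm (f x z) \<le> B"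
    using reg_familyE[OF f] by metis
  show ?thesis
    by (rule integrable_bounded_prob[OF nu_prob, where B=B])
      (use reg_family_section[OF f] B x in \<open>auto simp: measurable_cong_sets[OF sets_nu refl] space_nu space_Obs\<close>)
qed

lemma integral_nu_fst:
  fixes f :: "_ \<Rightarrow> real"
  assumes f: "f \<in> borel_measurable SA" and b: "\<And>y. y \<in> space SA \<Longrightarrow> \<bar>f y\<bar> \<le> B"
  shows "(\<integral>z. f (fst z) \<partial>\<nu>) = (\<integral>y. f y \<partial>\<mu>)"
proof -
  have "(\<integral>z. f (fst z) \<partial>\<nu>) = (\<integral>y. (\<integral>s'. f (fst (y, s')) \<partial>P y) \<partial>\<mu>)"
    by (rule integral_stationary_obs[OF inv measurable_compose[OF measurable_fst f], where B=B])
      (use b in \<open>auto simp: space_pair_measure\<close>)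
  also have "\<dots> = (\<integral>y. f y \<partial>\<mu>)"
  proof (rule Bochner_Integration.integral_cong[OF refl])
    fix y assume "y \<in> space \<mu>"
    then have "prob_space (P y)" using P_prob[of "fst y" "snd y"] by (auto simp: space_mu[OF inv])
    then show "(\<integral>s'. f (fst (y, s')) \<partial>P y) = f y" by (simp add: prob_space.prob_space)
  qed
  finally show ?thesis .
qed

text \<open>The covariance is a matrix-valued Bochner integral, and A \<mapsto> (A v) \<bullet> u is
  a bounded linear functional that passes under it. The result is stated over the law of
  observations, where all other means live.\<close>

lemma cov_inner: "(C *v v) \<bullet> u = (\<integral>z. (feat z \<bullet> v) * (feat z \<bullet> u) \<partial>\<nu>)"
proof -
  define M :: "real^'n \<Rightarrow> real^'n^'n" where "M q = (\<chi> i j. q $ i * q $ j)" for q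
  define T :: "real^'n^'n \<Rightarrow> real" where "T A = (A *v v) \<bullet> u" for A
  have cM: "continuous_on UNIV M" unfolding M_def by (intro continuous_intros)
  \<comment> \<open>Features lie in the unit ball, so compactness bounds the outer products q q^T
    and makes them integrable, without computing a matrix norm.\<close>
  have "compact (M ` cball 0 1)"
    by (rule compact_continuous_image[OF continuous_on_subset[OF cM] compact_cball]) simp
  then obtain b where b: "\<And>q. norm q \<le> 1 \<Longrightarrow> norm (M q) \<le> b"
    using compact_imp_bounded bounded_iff by (metis dist_0_norm imageI mem_cball)
  have pm: "(\<lambda>y. \<phi> (fst y) (snd y)) \<in> borel_measurable SA"
    by (rule measurable_compose_countable'[where f="\<lambda>a y. \<phi> (fst y) a" and I=UNIV])
      (auto intro: countable_finite measurable_compose[OF measurable_fst phi_meas])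
  have Mm: "(\<lambda>y. M (\<phi> (fst y) (snd y))) \<in> borel_measurable SA"
    by (rule measurable_compose[OF pm borel_measurable_continuous_onI[OF cM]])
  have Mi: "integrable \<mu> (\<lambda>y. M (\<phi> (fst y) (snd y)))"
    by (rule integrable_bounded_prob[OF mu_prob[OF inv], where B=b])
      (use Mm in \<open>auto simp: measurable_cong_sets[OF sets_mu[OF inv] refl] space_mu[OF inv] intro!: b phi_bound\<close>)
  have "linear T"
    unfolding T_def by (rule linearI) (simp_all add: matrix_vector_mult_add_rdistrib inner_add_left scaleR_matrix_vector_assoc[symmetric])
  then have bT: "bounded_linear T" by (simp add: linear_conv_bounded_linear)
  have TM: "T (M q) = (q \<bullet> v) * (q \<bullet> u)" for q
  proof -
    have "T (M q) = (\<Sum>i\<in>UNIV. \<Sum>j\<in>UNIV. (q $ i * u $ i) * (q $ j * v $ j))"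
      unfolding T_def M_def matrix_vector_mult_def inner_vec_def by (simp add: sum_distrib_left sum_distrib_right mult_ac)
    also have "\<dots> = (q \<bullet> u) * (q \<bullet> v)" unfolding inner_vec_def by (simp add: sum_product)
    finally show ?thesis by (simp add: mult.commute)
  qed
  have "(C *v v) \<bullet> u = T (\<integral>y. M (\<phi> (fst y) (snd y)) \<partial>\<mu>)"
    unfolding T_def feature_cov_def M_def by (simp add: case_prod_unfold)
  also have "\<dots> = (\<integral>y. T (M (\<phi> (fst y) (snd y))) \<partial>\<mu>)"
    by (rule integral_bounded_linear[OF bT Mi, symmetric])
  also have "\<dots> = (\<integral>y. (\<phi> (fst y) (snd y) \<bullet> v) * (\<phi> (fst y) (snd y) \<bullet> u) \<partial>\<mu>)" by (simp add: TM)
  also have "\<dots> = (\<integral>z. (\<phi> (fst (fst z)) (snd (fst z)) \<bullet> v) * (\<phi> (fst (fst z)) (snd (fst z)) \<bullet> u) \<partial>\<nu>)"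
  proof (rule integral_nu_fst[symmetric, where B="norm v * norm u"])
    show "(\<lambda>y. (\<phi> (fst y) (snd y) \<bullet> v) * (\<phi> (fst y) (snd y) \<bullet> u)) \<in> borel_measurable SA"
      using pm by simp
    fix y assume "y \<in> space SA"
    then have "norm (\<phi> (fst y) (snd y)) \<le> 1" by (auto intro: phi_bound)
    then have "\<bar>\<phi> (fst y) (snd y) \<bullet> w\<bar> \<le> norm w" for w
      using Cauchy_Schwarz_ineq2[of "\<phi> (fst y) (snd y)" w] mult_right_mono[of "norm (\<phi> (fst y) (snd y))" 1 "norm w"] by simp
    then show "\<bar>(\<phi> (fst y) (snd y) \<bullet> v) * (\<phi> (fst y) (snd y) \<bullet> u)\<bar> \<le> norm v * norm u"
      unfolding abs_mult by (intro mult_mono) auto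
  qed
  finally show ?thesis by (simp add: feat_def)
qed

lemma cov_symmetric: "(C *v v) \<bullet> u = v \<bullet> (C *v u)"
  by (simp add: cov_inner inner_commute[of v] mult.commute)

lemma C_inv_right: "C *v (C_inv *v v) = v"
  and C_inv_left: "C_inv *v (C *v v) = v"
proof -
  have "C ** C_inv = mat 1 \<and> C_inv ** C = mat 1"
    using C_nonsingular unfolding invertible_def matrix_inv_def by (rule someI_ex)
  then show "C *v (C_inv *v v) = v" "C_inv *v (C *v v) = v"
    by (simp_all add: matrix_vector_mul_assoc)
qed

lemma C_inv_symmetric: "(C_inv *v v) \<bullet> u = v \<bullet> (C_inv *v u)"
  using cov_symmetric[of "C_inv *v v" "C_inv *v u"] by (simp add: C_inv_right)

text \<open>The quadratic form is the mean of (feat \<bullet> v)^2, hence nonnegative; invertibility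
  excludes zeros away from the origin. The constant is its minimum on the compact unit sphere, and
  scaling extends the bound to all v.\<close>

lemma cov_positive_definite:
  obtains l where "0 < l" "\<And>v. l * (norm v)\<^sup>2 \<le> v \<bullet> (C *v v)"
proof -
  have fi: "integrable \<nu> (\<lambda>z. (feat z \<bullet> v) * (feat z \<bullet> u))" for v u
  proof -
    have "reg_family Obs (UNIV :: real set) (\<lambda>x z. (feat z \<bullet> v) * (feat z \<bullet> u))"
      by (intro reg_family_mult reg_family_linear[OF bounded_linear_inner_left] reg_feat)
    then show ?thesis by (rule reg_integrable) simp
  qed
  have q: "v \<bullet> (C *v v) = (\<integral>z. (feat z \<bullet> v)\<^sup>2 \<partial>\<nu>)" for v
    using cov_inner[of v v] by (simp add: inner_commute power2_eq_square)
  have pos: "0 < v \<bullet> (C *v v)" if "v \<noteq> 0" for v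
  proof (rule ccontr)
    assume "\<not> 0 < v \<bullet> (C *v v)"
    moreover have "0 \<le> v \<bullet> (C *v v)" unfolding q by simp
    ultimately have "(\<integral>z. (feat z \<bullet> v)\<^sup>2 \<partial>\<nu>) = 0" using q[of v] by linarith
    then have "AE z in \<nu>. (feat z \<bullet> v)\<^sup>2 = 0"
      using fi[of v v] by (subst (asm) integral_nonneg_eq_0_iff_AE) (auto simp: power2_eq_square)
    \<comment> \<open>Testing \<open>cov_inner\<close> with u = C v gives |C v|^2 = 0, so v = 0 by
      invertibility.\<close>
    then have "AE z in \<nu>. (feat z \<bullet> v) * (feat z \<bullet> (C *v v)) = 0" by eventually_elim simp
    then have "(C *v v) \<bullet> (C *v v) = 0"
      unfolding cov_inner by (rule integral_eq_zero_AE)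
    then have "C_inv *v (C *v v) = 0" by simp
    with that show False by (simp add: C_inv_left)
  qed
  have c: "continuous_on (sphere 0 1) (\<lambda>v. v \<bullet> (C *v v))"
    by (intro continuous_intros linear_continuous_on matrix_vector_mul_bounded_linear)
  have "(axis undefined 1 :: real^'n) \<in> sphere 0 1" by (simp add: norm_axis_1)
  then have "sphere 0 1 \<noteq> ({} :: (real^'n) set)" by blast
  from continuous_attains_inf[OF compact_sphere this c]
  obtain v0 where v0: "v0 \<in> sphere 0 1" "\<And>v. v \<in> sphere 0 1 \<Longrightarrow> v0 \<bullet> (C *v v0) \<le> v \<bullet> (C *v v)" by blast
  show ?thesis
  proof
    show "0 < v0 \<bullet> (C *v v0)" using v0(1) by (intro pos) auto
    fix v :: "real^'n"
    show "v0 \<bullet> (C *v v0) * (norm v)\<^sup>2 \<le> v \<bullet> (C *v v)"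
    proof (cases "v = 0")
      case False
      have "v0 \<bullet> (C *v v0) \<le> (inverse (norm v) *\<^sub>R v) \<bullet> (C *v (inverse (norm v) *\<^sub>R v))"
        by (rule v0(2)) (use False in simp)
      also have "\<dots> = (v \<bullet> (C *v v)) / (norm v)\<^sup>2"
        by (simp add: matrix_vector_mult_scaleR power2_eq_square divide_inverse)
      finally show ?thesis using False by (simp add: field_simps)
    qed simp
  qed
qed

subsection \<open>The objective and its gradient\<close>

lemma zero_in_iter_ball: "norm \<theta> \<le> R \<Longrightarrow> (\<theta>, 0) \<in> iter_ball R"
  using norm_ge_zero[of \<theta>] by (simp add: in_iter_ball order_trans[OF norm_ge_zero])

lemma td_cong: "fst x = fst y \<Longrightarrow> td x = td y"
  and next_feat_cong: "fst x = fst y \<Longrightarrow> next_feat x = next_feat y"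
  by (auto simp: td_def next_feat_def)

lemma gbar_cong: "fst x = fst y \<Longrightarrow> gbar x = gbar y"
  unfolding gbar_def by (simp add: td_cong[of x y])

lemma omega_star_cong: "fst x = fst y \<Longrightarrow> omega_star x = omega_star y"
  unfolding omega_star_def by (simp add: gbar_cong[of x y])

lemma grad_J_cong: "fst x = fst y \<Longrightarrow> grad_J x = grad_J y"
  unfolding grad_J_def ideal_dir_def
  by (simp add: td_cong[of x y] next_feat_cong[of x y] omega_star_cong[of x y])

lemma C_omega_star: "C *v omega_star x = gbar x"
  by (simp add: omega_star_def C_inv_right)

lemma in_own_ball: "x \<in> iter_ball (norm x)"
  using norm_fst_le[of "fst x" "snd x"] norm_snd_le[of "snd x" "fst x"] by (simp add: in_iter_ball)

text \<open>The iterated integral is vector-valued, whereas \<open>integral_stationary_obs\<close>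
  is available for real functions; so both sides are compared through their inner products with an
  arbitrary u.\<close>

lemma mean_td_eq_gbar: "mean_td \<mu> P \<gamma> r \<phi> \<pi> (fst x) = gbar x"
proof -
  define F where "F z = td x z *\<^sub>R feat z" for z
  have F: "reg_family Obs (iter_ball (norm x)) (\<lambda>x z. td x z *\<^sub>R feat z)"
    by (intro reg_family_scaleR reg_td reg_feat)
  have Fm: "F \<in> borel_measurable Obs" unfolding F_def by (rule reg_family_section[OF F])
  obtain B where B: "\<And>z. z \<in> space Obs \<Longrightarrow> norm (F z) \<le> B"
    using reg_familyE[OF F] in_own_ball[of x] unfolding F_def by metis
  have Fi: "integrable \<nu> F" unfolding F_def using reg_integrable[OF F in_own_ball] .
  have Fy: "F \<circ> Pair y \<in> borel_measurable (P y)" "prob_space (P y)" "\<And>s'. s' \<in> space (P y) \<Longrightarrow> norm (F (y, s')) \<le> B"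
    if y: "y \<in> space SA" for y
  proof -
    obtain s a where sa: "y = (s, a)" "s \<in> S" using y by (cases y) auto
    have "Pair y \<in> P y \<rightarrow>\<^sub>M Obs"
      unfolding sa(1) measurable_cong_sets[OF sets_P[OF sa(2)] refl] using sa(2) by (intro measurable_Pair) auto
    then show "F \<circ> Pair y \<in> borel_measurable (P y)" using Fm by (rule measurable_comp)
    show "prob_space (P y)" using P_prob[OF sa(2)] sa(1) by simp
    show "norm (F (y, s')) \<le> B" if "s' \<in> space (P y)" for s'
      using that sa by (intro B) (simp add: space_Obs space_P)
  qed
  define I where "I y = (\<integral>s'. F (y, s') \<partial>P y)" for y
  have Im: "I \<in> borel_measurable SA"
    unfolding I_def using Fm by (intro integral_measurable_prob_kernel[OF _ P_kernel]) (simp add: case_prod_unfold)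
  have Ib: "norm (I y) \<le> B" if "y \<in> space SA" for y
    unfolding I_def using Fy[OF that] by (intro norm_integral_le_prob) (simp_all add: o_def)
  have Ii: "integrable \<mu> I"
    by (rule integrable_bounded_prob[OF mu_prob[OF inv], where B=B])
      (use Im Ib in \<open>auto simp: measurable_cong_sets[OF sets_mu[OF inv] refl] space_mu[OF inv]\<close>)
  have "mean_td \<mu> P \<gamma> r \<phi> \<pi> (fst x) = (\<integral>y. I y \<partial>\<mu>)"
    unfolding mean_td_def I_def F_def td_def feat_def by (simp add: case_prod_unfold)
  moreover have "(\<integral>y. I y \<partial>\<mu>) \<bullet> u = gbar x \<bullet> u" for u
  proof -
    have Fu: "(\<lambda>z. F z \<bullet> u) \<in> borel_measurable Obs" using Fm by simp
    have "(\<integral>y. I y \<partial>\<mu>) \<bullet> u = (\<integral>y. I y \<bullet> u \<partial>\<mu>)" using Ii by simp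
    also have "\<dots> = (\<integral>y. (\<integral>s'. F (y, s') \<bullet> u \<partial>P y) \<partial>\<mu>)"
    proof (rule Bochner_Integration.integral_cong[OF refl])
      fix y assume "y \<in> space \<mu>"
      then have y: "y \<in> space SA" by (simp add: space_mu[OF inv])
      have "integrable (P y) (\<lambda>s'. F (y, s'))"
        by (rule integrable_bounded_prob[OF Fy(2)[OF y], where B=B]) (use Fy[OF y] in \<open>auto simp: o_def\<close>)
      then show "I y \<bullet> u = (\<integral>s'. F (y, s') \<bullet> u \<partial>P y)" unfolding I_def by simp
    qed
    also have "\<dots> = (\<integral>z. F z \<bullet> u \<partial>\<nu>)"
    proof (rule integral_stationary_obs[OF inv Fu, symmetric, where B="B * norm u"])
      fix z assume "z \<in> space Obs"
      from mult_right_mono[OF B[OF this] norm_ge_zero[of u]]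
      show "\<bar>F z \<bullet> u\<bar> \<le> B * norm u" using Cauchy_Schwarz_ineq2[of "F z" u] by linarith
    qed
    also have "\<dots> = gbar x \<bullet> u" unfolding gbar_def F_def[symmetric] using Fi by simp
    finally show ?thesis .
  qed
  then have "(\<integral>y. I y \<partial>\<mu>) = gbar x" by (rule vector_eq_rdot[THEN iffD1, OF allI])
  ultimately show ?thesis by simp
qed

lemma J_eq: "J (fst x) = gbar x \<bullet> omega_star x"
  unfolding mspbe_def mean_td_eq_gbar omega_star_def ..

lemma reg_J: "reg_family Obs (iter_ball R) (\<lambda>x z. J (fst x))"
  unfolding J_eq by (intro reg_family_inner reg_gbar reg_omega_star)

text \<open>Since \<open>phi_hat\<close> is the gradient of \<open>Vbar\<close> and is Lipschitz on
  the ball uniformly in the state, one constant serves for all next states.\<close>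

lemma Vbar_taylor:
  assumes "0 \<le> R"
  obtains L where "0 \<le> L" "\<And>s' \<theta> \<theta>'. s' \<in> S \<Longrightarrow> norm \<theta> \<le> R \<Longrightarrow> norm \<theta>' \<le> R \<Longrightarrow>
    \<bar>Vbar \<phi> \<pi> s' \<theta>' - Vbar \<phi> \<pi> s' \<theta> - phi_hat \<phi> \<pi> s' \<theta> \<bullet> (\<theta>' - \<theta>)\<bar> \<le> L * (norm (\<theta>' - \<theta>))\<^sup>2"
proof -
  obtain L where L: "0 \<le> L" "\<And>x y z. x \<in> iter_ball R \<Longrightarrow> y \<in> iter_ball R \<Longrightarrow> z \<in> space Obs \<Longrightarrow>
      norm (next_feat x z - next_feat y z) \<le> L * norm (x - y)"
    using reg_familyE[OF reg_next_feat[of R]] by metis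
  show ?thesis
  proof (rule that[OF L(1)])
    fix s' and \<theta> \<theta>' :: "real^'n" assume s: "s' \<in> S" and t: "norm \<theta> \<le> R" "norm \<theta>' \<le> R"
    show "\<bar>Vbar \<phi> \<pi> s' \<theta>' - Vbar \<phi> \<pi> s' \<theta> - phi_hat \<phi> \<pi> s' \<theta> \<bullet> (\<theta>' - \<theta>)\<bar> \<le> L * (norm (\<theta>' - \<theta>))\<^sup>2"
    proof (rule taylor_lipschitz_gradient[where K="cball 0 R"])
      show "GDERIV (Vbar \<phi> \<pi> s') u :> phi_hat \<phi> \<pi> s' u" for u
      proof -
        have "Vbar \<phi> \<pi> s' differentiable (at u)"
          unfolding Vbar_def
          by (intro differentiable_sum differentiable_mult target_diff[OF s] finite_class.finite_UNIV ballI
              bounded_linear_imp_differentiable[OF bounded_linear_inner_left])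
        from GDERIV_gradient[OF this] show ?thesis by (simp add: gradient_Vbar target_diff[OF s])
      qed
      fix u v assume "u \<in> cball (0::real^'n) R" "v \<in> cball (0::real^'n) R"
      then show "norm (phi_hat \<phi> \<pi> s' u - phi_hat \<phi> \<pi> s' v) \<le> L * norm (u - v)"
        \<comment> \<open>The estimate for \<open>next_feat\<close> is read at a dummy observation:
          only its last state matters, and repeating s' as first state keeps the observation in the
          space.\<close>
        using L(2)[of "(u, 0)" "(v, 0)" "((s', undefined), s')"] s assms
        by (simp add: in_iter_ball space_Obs next_feat_def norm_Pair)
    qed (use t L(1) in auto)
  qed
qed

lemma ideal_dir_mean:
  "(\<integral>z. ideal_dir x z \<partial>\<nu>) \<bullet> h
    = gbar x \<bullet> h - (\<integral>z. \<gamma> * ((omega_star x \<bullet> feat z) * (next_feat x z \<bullet> h)) \<partial>\<nu>)"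
proof -
  have "reg_family Obs (iter_ball (norm x)) (\<lambda>x z. td x z *\<^sub>R feat z)"
    by (intro reg_family_scaleR reg_td reg_feat)
  from reg_integrable[OF this in_own_ball] have i1: "integrable \<nu> (\<lambda>z. td x z *\<^sub>R feat z)" .
  have "reg_family Obs (iter_ball (norm x)) (\<lambda>x z. (omega_star x \<bullet> feat z) * (next_feat x z \<bullet> h))"
    by (intro reg_family_mult reg_family_inner reg_omega_star reg_feat
        reg_family_linear[OF bounded_linear_inner_left] reg_next_feat)
  from reg_integrable[OF this in_own_ball]
  have i2: "integrable \<nu> (\<lambda>z. (omega_star x \<bullet> feat z) * (next_feat x z \<bullet> h))" .
  have "(\<integral>z. ideal_dir x z \<partial>\<nu>) \<bullet> h = (\<integral>z. ideal_dir x z \<bullet> h \<partial>\<nu>)"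
    using reg_integrable[OF reg_ideal_dir in_own_ball] by simp
  also have "\<dots> = (\<integral>z. (td x z *\<^sub>R feat z) \<bullet> h - \<gamma> * ((omega_star x \<bullet> feat z) * (next_feat x z \<bullet> h)) \<partial>\<nu>)"
    by (simp add: ideal_dir_def inner_diff_left mult.assoc)
  also have "\<dots> = (\<integral>z. (td x z *\<^sub>R feat z) \<bullet> h \<partial>\<nu>) - (\<integral>z. \<gamma> * ((omega_star x \<bullet> feat z) * (next_feat x z \<bullet> h)) \<partial>\<nu>)"
    by (rule Bochner_Integration.integral_diff[OF integrable_inner_left integrable_mult_right]) (use i1 i2 in auto)
  also have "(\<integral>z. (td x z *\<^sub>R feat z) \<bullet> h \<partial>\<nu>) = gbar x \<bullet> h" unfolding gbar_def using i1 by (simp del: inner_scaleR_left)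
  finally show ?thesis .
qed

text \<open>First-order expansion of the mean update with w = \<open>omega_star\<close> frozen at
  \<theta>. Its linear term is the mean of (feat \<bullet> w) (\<gamma> \<open>next_feat\<close> -
  feat). The part without \<gamma> is minus \<open>gbar\<close>, because C w = \<open>gbar\<close>;
  this is why twice the linear term coincides with \<open>grad_J\<close>.\<close>

lemma gbar_taylor:
  assumes "0 \<le> R"
  obtains L where "0 \<le> L" "\<And>\<theta> \<theta>'. norm \<theta> \<le> R \<Longrightarrow> norm \<theta>' \<le> R \<Longrightarrow>
    \<bar>2 * ((gbar (\<theta>', 0) - gbar (\<theta>, 0)) \<bullet> omega_star (\<theta>, 0)) - grad_J (\<theta>, 0) \<bullet> (\<theta>' - \<theta>)\<bar>
      \<le> L * (norm (\<theta>' - \<theta>))\<^sup>2"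
proof -
  obtain L where L: "0 \<le> L" "\<And>s' \<theta> \<theta>'. s' \<in> S \<Longrightarrow> norm \<theta> \<le> R \<Longrightarrow> norm \<theta>' \<le> R \<Longrightarrow>
    \<bar>Vbar \<phi> \<pi> s' \<theta>' - Vbar \<phi> \<pi> s' \<theta> - phi_hat \<phi> \<pi> s' \<theta> \<bullet> (\<theta>' - \<theta>)\<bar> \<le> L * (norm (\<theta>' - \<theta>))\<^sup>2"
    using Vbar_taylor[OF assms] by metis
  have "reg_family Obs (iter_ball R) (\<lambda>x z. feat z \<bullet> omega_star x)"
    by (intro reg_family_inner reg_feat reg_omega_star)
  from reg_familyE[OF this] obtain B where B: "0 \<le> B"
      "\<And>x z. x \<in> iter_ball R \<Longrightarrow> z \<in> space Obs \<Longrightarrow> norm (feat z \<bullet> omega_star x) \<le> B"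
    by metis
  show ?thesis
  proof (rule that)
    show "0 \<le> 2 * (L * B)" using L(1) B(1) by simp
    fix \<theta> \<theta>' :: "real^'n" assume t: "norm \<theta> \<le> R" "norm \<theta>' \<le> R"
    define x where "x = (\<theta>, 0::real^'n)"
    define x' where "x' = (\<theta>', 0::real^'n)"
    define h where "h = \<theta>' - \<theta>"
    define w where "w = omega_star x"
    have xb: "x \<in> iter_ball R" "x' \<in> iter_ball R" using t by (auto simp: x_def x'_def zero_in_iter_ball)
    have reg1: "reg_family Obs (iter_ball R) (\<lambda>x z. td x z *\<^sub>R feat z)"
      by (intro reg_family_scaleR reg_td reg_feat)
    have gb: "gbar y \<bullet> w = (\<integral>z. td y z * (feat z \<bullet> w) \<partial>\<nu>)" "integrable \<nu> (\<lambda>z. td y z * (feat z \<bullet> w))"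
      if "y \<in> iter_ball R" for y
    proof -
      have "reg_family Obs (iter_ball R) (\<lambda>x z. td x z * (feat z \<bullet> w))"
        by (intro reg_family_mult reg_td reg_family_linear[OF bounded_linear_inner_left] reg_feat)
      from reg_integrable[OF this that] show "integrable \<nu> (\<lambda>z. td y z * (feat z \<bullet> w))" .
      show "gbar y \<bullet> w = (\<integral>z. td y z * (feat z \<bullet> w) \<partial>\<nu>)"
        unfolding gbar_def using reg_integrable[OF reg1 that] by (simp flip: integral_inner_left)
    qed
    have "reg_family Obs (iter_ball R) (\<lambda>x z. (w \<bullet> feat z) * (next_feat x z \<bullet> h))"
      by (intro reg_family_mult reg_family_linear[OF bounded_linear_inner_left]
          reg_family_linear[OF bounded_linear_inner_right] reg_next_feat reg_feat)
    from reg_integrable[OF this xb(1)] have i2: "integrable \<nu> (\<lambda>z. (w \<bullet> feat z) * (next_feat x z \<bullet> h))" .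
    have "reg_family Obs (UNIV :: real set) (\<lambda>x z. (feat z \<bullet> w) * (feat z \<bullet> h))"
      by (intro reg_family_mult reg_family_linear[OF bounded_linear_inner_left] reg_feat)
    from reg_integrable[OF this UNIV_I] have i3: "integrable \<nu> (\<lambda>z. (feat z \<bullet> w) * (feat z \<bullet> h))" .
    have "gbar x \<bullet> h = (\<integral>z. (feat z \<bullet> w) * (feat z \<bullet> h) \<partial>\<nu>)"
      using cov_inner[of w h] by (simp add: w_def C_omega_star)
    then have gJ: "grad_J x \<bullet> h = 2 * ((\<integral>z. \<gamma> * ((w \<bullet> feat z) * (next_feat x z \<bullet> h)) \<partial>\<nu>)
        - (\<integral>z. (feat z \<bullet> w) * (feat z \<bullet> h) \<partial>\<nu>))"
      unfolding grad_J_def inner_scaleR_left ideal_dir_mean w_def by simp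
    \<comment> \<open>Pointwise remainder before averaging. The rewards and the terms linear in
      \<theta> cancel, leaving \<gamma> times the Taylor remainder of \<open>Vbar\<close> times feat
      \<bullet> w.\<close>
    define e where "e z = td x' z * (feat z \<bullet> w) - td x z * (feat z \<bullet> w)
        - (\<gamma> * ((w \<bullet> feat z) * (next_feat x z \<bullet> h)) - (feat z \<bullet> w) * (feat z \<bullet> h))" for z
    have ie: "(\<integral>z. e z \<partial>\<nu>) = (gbar x' - gbar x) \<bullet> w - ((\<integral>z. \<gamma> * ((w \<bullet> feat z) * (next_feat x z \<bullet> h)) \<partial>\<nu>)
        - (\<integral>z. (feat z \<bullet> w) * (feat z \<bullet> h) \<partial>\<nu>))"
      unfolding e_def inner_diff_left using gb[OF xb(1)] gb[OF xb(2)] i2 i3 by simp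
    have "integrable \<nu> e"
      unfolding e_def by (intro Bochner_Integration.integrable_diff integrable_mult_right gb(2) xb i2 i3)
    then have em: "e \<in> borel_measurable \<nu>" by (rule borel_measurable_integrable)
    have "norm (\<integral>z. e z \<partial>\<nu>) \<le> L * (norm h)\<^sup>2 * B"
    proof (rule norm_integral_le_prob[OF nu_prob em])
      fix z assume "z \<in> space \<nu>"
      then have z: "z \<in> space Obs" "snd z \<in> S" by (auto simp: space_nu space_Obs)
      have "e z = (\<gamma> * (Vbar \<phi> \<pi> (snd z) \<theta>' - Vbar \<phi> \<pi> (snd z) \<theta> - phi_hat \<phi> \<pi> (snd z) \<theta> \<bullet> h)) * (feat z \<bullet> w)"
        unfolding e_def td_def td_error_def x_def x'_def h_def next_feat_def feat_def
        by (simp add: algebra_simps inner_commute)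
      also have "\<bar>\<dots>\<bar> \<le> (1 * (L * (norm h)\<^sup>2)) * B"
        unfolding abs_mult
      proof (intro mult_mono)
        show "\<bar>Vbar \<phi> \<pi> (snd z) \<theta>' - Vbar \<phi> \<pi> (snd z) \<theta> - phi_hat \<phi> \<pi> (snd z) \<theta> \<bullet> h\<bar> \<le> L * (norm h)\<^sup>2"
          unfolding h_def by (rule L(2)[OF z(2) t])
        show "\<bar>feat z \<bullet> w\<bar> \<le> B" using B(2)[OF xb(1) z(1)] by (simp add: w_def)
      qed (use discount L(1) in auto)
      finally show "norm (e z) \<le> L * (norm h)\<^sup>2 * B" by simp
    qed
    then have "\<bar>2 * ((gbar x' - gbar x) \<bullet> w) - grad_J x \<bullet> h\<bar> \<le> 2 * (L * (norm h)\<^sup>2 * B)"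
      unfolding gJ using ie by (simp add: right_diff_distrib)
    then show "\<bar>2 * ((gbar (\<theta>', 0) - gbar (\<theta>, 0)) \<bullet> omega_star (\<theta>, 0)) - grad_J (\<theta>, 0) \<bullet> (\<theta>' - \<theta>)\<bar>
      \<le> 2 * (L * B) * (norm (\<theta>' - \<theta>))\<^sup>2"
      by (simp add: x_def x'_def w_def h_def mult_ac)
  qed
qed

text \<open>J is a symmetric quadratic form in \<open>gbar\<close>. For an increment u of
  \<open>gbar\<close>, the change of J is 2 u \<bullet> \<open>omega_star\<close> plus the form at
  u: the first part is \<open>gbar_taylor\<close>, the second is quadratic in the step because
  \<open>gbar\<close> is Lipschitz.\<close>

lemma J_taylor:
  assumes "0 \<le> R"
  obtains L where "0 \<le> L" "\<And>\<theta> \<theta>'. norm \<theta> \<le> R \<Longrightarrow> norm \<theta>' \<le> R \<Longrightarrow>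
    \<bar>J \<theta>' - J \<theta> - grad_J (\<theta>, 0) \<bullet> (\<theta>' - \<theta>)\<bar> \<le> L * (norm (\<theta>' - \<theta>))\<^sup>2"
proof -
  obtain L where L: "0 \<le> L" "\<And>\<theta> \<theta>'. norm \<theta> \<le> R \<Longrightarrow> norm \<theta>' \<le> R \<Longrightarrow>
    \<bar>2 * ((gbar (\<theta>', 0) - gbar (\<theta>, 0)) \<bullet> omega_star (\<theta>, 0)) - grad_J (\<theta>, 0) \<bullet> (\<theta>' - \<theta>)\<bar>
      \<le> L * (norm (\<theta>' - \<theta>))\<^sup>2"
    using gbar_taylor[OF assms] by metis
  obtain z :: "((real^'d) \<times> 'a) \<times> (real^'d)" where z: "z \<in> space Obs"
    using prob_space.not_empty[OF nu_prob] by (auto simp: space_nu space_Obs)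
  obtain G where G: "0 \<le> G" "\<And>x y z. x \<in> iter_ball R \<Longrightarrow> y \<in> iter_ball R \<Longrightarrow> z \<in> space Obs \<Longrightarrow>
      norm (gbar x - gbar y) \<le> G * norm (x - y)"
    using reg_familyE[OF reg_gbar[of R]] by metis
  interpret A: bounded_linear "(*v) C_inv" by (rule matrix_vector_mul_bounded_linear)
  obtain b where b: "0 \<le> b" "\<And>v. norm (C_inv *v v) \<le> norm v * b" using A.nonneg_bounded by blast
  show ?thesis
  proof (rule that)
    show "0 \<le> L + G * G * b" using L(1) G(1) b(1) by simp
    fix \<theta> \<theta>' :: "real^'n" assume t: "norm \<theta> \<le> R" "norm \<theta>' \<le> R"
    define g where "g = gbar (\<theta>, 0)"
    define u where "u = gbar (\<theta>', 0) - g"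
    have un: "norm u \<le> G * norm (\<theta>' - \<theta>)"
      using G(2)[of "(\<theta>', 0)" "(\<theta>, 0)" z] z t unfolding u_def g_def
      by (simp add: zero_in_iter_ball norm_Pair)
    have "J \<theta>' = (g + u) \<bullet> (C_inv *v (g + u))"
      using J_eq[of "(\<theta>', 0)"] by (simp add: u_def omega_star_def)
    moreover have "J \<theta> = g \<bullet> (C_inv *v g)"
      using J_eq[of "(\<theta>, 0)"] by (simp add: g_def omega_star_def)
    moreover have "g \<bullet> (C_inv *v u) = u \<bullet> (C_inv *v g)"
      using C_inv_symmetric[of g u] by (simp add: inner_commute)
    ultimately have "J \<theta>' - J \<theta> = 2 * (u \<bullet> omega_star (\<theta>, 0)) + u \<bullet> (C_inv *v u)"
      by (simp add: A.add inner_add_left inner_add_right omega_star_def g_def)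
    moreover have "\<bar>2 * (u \<bullet> omega_star (\<theta>, 0)) - grad_J (\<theta>, 0) \<bullet> (\<theta>' - \<theta>)\<bar> \<le> L * (norm (\<theta>' - \<theta>))\<^sup>2"
      unfolding u_def g_def by (rule L(2)[OF t])
    moreover have "\<bar>u \<bullet> (C_inv *v u)\<bar> \<le> (G * G * b) * (norm (\<theta>' - \<theta>))\<^sup>2"
    proof -
      have "\<bar>u \<bullet> (C_inv *v u)\<bar> \<le> norm u * (norm u * b)"
        by (rule order_trans[OF Cauchy_Schwarz_ineq2 mult_left_mono[OF b(2)]]) simp
      also have "\<dots> \<le> (G * norm (\<theta>' - \<theta>)) * ((G * norm (\<theta>' - \<theta>)) * b)"
        using un b(1) G(1) by (intro mult_mono) auto
      finally show ?thesis by (simp add: power2_eq_square mult_ac)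
    qed
    ultimately show "\<bar>J \<theta>' - J \<theta> - grad_J (\<theta>, 0) \<bullet> (\<theta>' - \<theta>)\<bar> \<le> (L + G * G * b) * (norm (\<theta>' - \<theta>))\<^sup>2"
      by (simp add: distrib_right)
  qed
qed

text \<open>A quadratic remainder on a ball with \<theta> in its interior gives the Frechet
  derivative at \<theta>.\<close>

lemma gradient_J: "gradient J (fst x) = grad_J x"
proof -
  define \<theta> where "\<theta> = fst x"
  obtain L where L: "0 \<le> L" "\<And>\<theta>1 \<theta>'. norm \<theta>1 \<le> norm \<theta> + 1 \<Longrightarrow> norm \<theta>' \<le> norm \<theta> + 1 \<Longrightarrow>
    \<bar>J \<theta>' - J \<theta>1 - grad_J (\<theta>1, 0) \<bullet> (\<theta>' - \<theta>1)\<bar> \<le> L * (norm (\<theta>' - \<theta>1))\<^sup>2"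
    using J_taylor[of "norm \<theta> + 1"] by auto
  have "(J has_derivative (\<lambda>h. h \<bullet> grad_J (\<theta>, 0))) (at \<theta>)"
    unfolding has_derivative_at_alt
  proof (intro conjI allI impI)
    show "bounded_linear (\<lambda>h. h \<bullet> grad_J (\<theta>, 0))" by (rule bounded_linear_inner_left)
    fix e :: real assume e: "0 < e"
    show "\<exists>d>0. \<forall>y. norm (y - \<theta>) < d \<longrightarrow>
        norm (J y - J \<theta> - (y - \<theta>) \<bullet> grad_J (\<theta>, 0)) \<le> e * norm (y - \<theta>)"
    \<comment> \<open>The minimum with 1 keeps y in the ball of radius |\<theta>| + 1 on which the
      Taylor bound holds; L + 1 avoids a division by zero.\<close>
    proof (intro exI[of _ "min 1 (e / (L + 1))"] conjI allI impI)
      show "0 < min 1 (e / (L + 1))" using e L(1) by simp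
      fix y assume y: "norm (y - \<theta>) < min 1 (e / (L + 1))"
      have "norm y \<le> norm \<theta> + 1" using y norm_triangle_ineq[of \<theta> "y - \<theta>"] by simp
      then have "\<bar>J y - J \<theta> - grad_J (\<theta>, 0) \<bullet> (y - \<theta>)\<bar> \<le> L * (norm (y - \<theta>))\<^sup>2" by (intro L(2)) simp
      also have "\<dots> = (L * norm (y - \<theta>)) * norm (y - \<theta>)" by (simp add: power2_eq_square)
      also have "\<dots> \<le> e * norm (y - \<theta>)"
      proof (rule mult_right_mono)
        have "L * norm (y - \<theta>) \<le> (L + 1) * norm (y - \<theta>)" by (rule mult_right_mono) auto
        also have "\<dots> \<le> (L + 1) * (e / (L + 1))" using y L(1) by (intro mult_left_mono) auto
        finally show "L * norm (y - \<theta>) \<le> e" using L(1) by simp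
      qed simp
      finally show "norm (J y - J \<theta> - (y - \<theta>) \<bullet> grad_J (\<theta>, 0)) \<le> e * norm (y - \<theta>)"
        by (simp add: inner_commute)
    qed
  qed
  then have "gradient J \<theta> = grad_J (\<theta>, 0)" by (intro gradient_eqI) (simp add: gderiv_def)
  also have "\<dots> = grad_J x" by (rule grad_J_cong) (simp add: \<theta>_def)
  finally show ?thesis by (simp add: \<theta>_def)
qed

subsection \<open>One-step drift\<close>

text \<open>The mean is gbar - C \<omega>, and gbar = C \<open>omega_star\<close>: on average the
  second update is linear and contracts towards the moving target.\<close>

lemma omega_dir_mean: "(\<integral>z. omega_dir x z \<partial>\<nu>) = - (C *v track_err x)"
proof -
  have r1: "reg_family Obs (iter_ball (norm x)) (\<lambda>x z. td x z *\<^sub>R feat z)"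
    and r2: "reg_family Obs (iter_ball (norm x)) (\<lambda>x z. (feat z \<bullet> snd x) *\<^sub>R feat z)"
    by (intro reg_family_scaleR reg_family_inner reg_td reg_feat reg_snd)+
  note i = reg_integrable[OF r1 in_own_ball] reg_integrable[OF r2 in_own_ball]
  have c: "(\<integral>z. (feat z \<bullet> snd x) *\<^sub>R feat z \<partial>\<nu>) = C *v snd x"
  proof -
    have "(\<integral>z. (feat z \<bullet> snd x) *\<^sub>R feat z \<partial>\<nu>) \<bullet> u = (C *v snd x) \<bullet> u" for u
      unfolding cov_inner using i(2) by (simp flip: integral_inner_left)
    then show ?thesis by (rule vector_eq_rdot[THEN iffD1, OF allI])
  qed
  have "(\<integral>z. omega_dir x z \<partial>\<nu>) = (\<integral>z. td x z *\<^sub>R feat z - (feat z \<bullet> snd x) *\<^sub>R feat z \<partial>\<nu>)"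
    by (simp add: omega_dir_def scaleR_diff_left)
  also have "\<dots> = gbar x - C *v snd x" using i c by (simp add: gbar_def)
  also have "\<dots> = - (C *v track_err x)"
    by (simp add: track_err_def matrix_vector_mult_diff_distrib C_omega_star)
  finally show ?thesis .
qed

lemma noise_centred: "(\<integral>z. noise \<kappa> x z \<partial>\<nu>) = 0"
proof -
  interpret nu: prob_space \<nu> by (rule nu_prob)
  note i = reg_integrable[OF reg_ideal_dir in_own_ball[of x]] reg_integrable[OF reg_omega_dir in_own_ball[of x]]
  have "(\<integral>z. ideal_dir x z + (1/2) *\<^sub>R grad_J x \<partial>\<nu>) = 0"
    using i(1) by (simp add: grad_J_def nu.prob_space)
  moreover have "(\<integral>z. omega_dir x z + C *v track_err x \<partial>\<nu>) = 0"
    using i(2) by (simp add: omega_dir_mean nu.prob_space)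
  moreover have "integrable \<nu> (\<lambda>z. ideal_dir x z + (1/2) *\<^sub>R grad_J x)" "integrable \<nu> (\<lambda>z. omega_dir x z + C *v track_err x)"
    using i by auto
  ultimately show ?thesis
    unfolding noise_def by (subst Bochner_Integration.integral_add) auto
qed

text \<open>Two inequalities are combined. The Taylor bound for J, divided by \<alpha>, yields
  |grad|^2 / 4 up to B5^2 times the squared tracking error. Expanding the square of the new tracking
  error, divided by 2 \<beta>, bounds l times the old one. Multiplying the second by \<kappa> and
  adding cancels the squared error.\<close>

lemma descent_step:
  fixes R :: real
  assumes R: "0 \<le> R"
  obtains \<kappa> c where "0 \<le> \<kappa>" "0 \<le> c"
    "\<And>\<alpha> \<beta> x z. 0 < \<alpha> \<Longrightarrow> \<alpha> \<le> \<beta> \<Longrightarrow> \<beta> \<le> 1 \<Longrightarrow> x \<in> iter_ball R \<Longrightarrow> z \<in> space Obs \<Longrightarrow>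
      next_iter \<alpha> \<beta> x z \<in> iter_ball R \<Longrightarrow>
      (norm (grad_J x))\<^sup>2 / 4
      \<le> (J (fst x) - J (fst (next_iter \<alpha> \<beta> x z))) / \<alpha>
        + \<kappa> * (((norm (track_err x))\<^sup>2
            - (norm (track_err (next_iter \<alpha> \<beta> x z)))\<^sup>2) / (2 * \<beta>))
        + noise \<kappa> x z + c * (\<beta> + \<alpha> / \<beta>)"
proof -
  obtain l where l: "0 < l" "\<And>v. l * (norm v)\<^sup>2 \<le> v \<bullet> (C *v v)"
    using cov_positive_definite by metis
  obtain L where L: "0 \<le> L" "\<And>\<theta> \<theta>'. norm \<theta> \<le> R \<Longrightarrow> norm \<theta>' \<le> R \<Longrightarrow>
    \<bar>J \<theta>' - J \<theta> - grad_J (\<theta>, 0) \<bullet> (\<theta>' - \<theta>)\<bar> \<le> L * (norm (\<theta>' - \<theta>))\<^sup>2"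
    using J_taylor[OF R] by metis
  from reg_familyE[OF reg_theta_dir[of R]] obtain B1 where B1: "0 \<le> B1"
    "\<And>x z. x \<in> iter_ball R \<Longrightarrow> z \<in> space Obs \<Longrightarrow> norm (theta_dir x z) \<le> B1" by metis
  from reg_familyE[OF reg_omega_dir[of R]] obtain B2 where B2: "0 \<le> B2"
    "\<And>x z. x \<in> iter_ball R \<Longrightarrow> z \<in> space Obs \<Longrightarrow> norm (omega_dir x z) \<le> B2" by metis
  from reg_familyE[OF reg_track_err[of R]] obtain B3 where B3: "0 \<le> B3"
    "\<And>x z. x \<in> iter_ball R \<Longrightarrow> z \<in> space Obs \<Longrightarrow> norm (track_err x) \<le> B3" by metis
  from reg_familyE[OF reg_omega_star[of R]] obtain B4 where B4: "0 \<le> B4"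
    "\<And>x y z. x \<in> iter_ball R \<Longrightarrow> y \<in> iter_ball R \<Longrightarrow> z \<in> space Obs \<Longrightarrow>
      norm (omega_star x - omega_star y) \<le> B4 * norm (x - y)" by metis
  from reg_familyE[OF reg_next_feat[of R]] obtain B5 where B5: "0 \<le> B5"
    "\<And>x z. x \<in> iter_ball R \<Longrightarrow> z \<in> space Obs \<Longrightarrow> norm (next_feat x z) \<le> B5" by metis
  \<comment> \<open>Bounds the change of the tracking error per unit of \<beta>: B2 from the
    \<omega> step, B4 * B1 from the motion of the target, where \<alpha> \<le> \<beta> is
    used.\<close>
  define B6 where "B6 = B2 + B4 * B1"
  define \<kappa> where "\<kappa> = B5\<^sup>2 / l"
  \<comment> \<open>In order: the second-order term of J, at most \<alpha> \<le> \<beta> after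
    division; the tracking error against the target motion, of order \<alpha> / \<beta>; and the
    squared increment of the tracking error, of order \<beta>.\<close>
  define c where "c = L * B1\<^sup>2 + \<kappa> * (B3 * B4 * B1 + B6\<^sup>2)"
  have \<kappa>0: "0 \<le> \<kappa>" unfolding \<kappa>_def using l(1) by simp
  have c0: "0 \<le> c" unfolding c_def using L(1) \<kappa>0 B1(1) B3(1) B4(1) by simp
  show ?thesis
  proof (rule that[OF \<kappa>0 c0])
    fix \<alpha> \<beta> :: real and x z
    assume ab: "0 < \<alpha>" "\<alpha> \<le> \<beta>" "\<beta> \<le> 1" and x: "x \<in> iter_ball R" and z: "z \<in> space Obs"
      and x'0: "next_iter \<alpha> \<beta> x z \<in> iter_ball R"
    define x' where "x' = next_iter \<alpha> \<beta> x z"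
    define D where "D = grad_J x"
    define e where "e = track_err x"
    define \<zeta> where "\<zeta> = D \<bullet> (ideal_dir x z + (1/2) *\<^sub>R D)"
    define \<xi> where "\<xi> = e \<bullet> (omega_dir x z + C *v e)"
    have x': "x' \<in> iter_ball R" using x'0 by (simp add: x'_def next_iter_def)
    have \<beta>: "0 < \<beta>" using ab by linarith
    have "\<bar>J (fst x') - J (fst x) - D \<bullet> (fst x' - fst x)\<bar> \<le> L * (norm (fst x' - fst x))\<^sup>2"
      using L(2)[of "fst x" "fst x'"] x x' grad_J_cong[of "(fst x, 0)" x] by (simp add: in_iter_ball D_def)
    moreover have "fst x' - fst x = \<alpha> *\<^sub>R theta_dir x z" by (simp add: x'_def next_iter_def)
    moreover have "L * (norm (\<alpha> *\<^sub>R theta_dir x z))\<^sup>2 \<le> L * (\<alpha> * B1)\<^sup>2"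
      using B1(2)[OF x z] ab L(1) by (intro mult_left_mono power_mono) auto
    ultimately have "J (fst x') - J (fst x) \<le> \<alpha> * (D \<bullet> theta_dir x z) + L * (\<alpha> * B1)\<^sup>2" by simp
    moreover have "D \<bullet> theta_dir x z \<le> \<zeta> - (norm D)\<^sup>2 / 4 + B5\<^sup>2 * (norm e)\<^sup>2"
    proof -
      have "theta_dir x z - ideal_dir x z = - ((\<gamma> * (e \<bullet> feat z)) *\<^sub>R next_feat x z)"
        by (simp add: theta_dir_def ideal_dir_def e_def track_err_def inner_diff_left algebra_simps)
      then have "norm (theta_dir x z - ideal_dir x z) = \<gamma> * \<bar>e \<bullet> feat z\<bar> * norm (next_feat x z)"
        using discount by (simp add: abs_mult)
      also have "\<dots> \<le> 1 * (norm e * 1) * B5"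
      proof (intro mult_mono B5(2)[OF x z])
        show "\<bar>e \<bullet> feat z\<bar> \<le> norm e * 1"
          by (rule order_trans[OF Cauchy_Schwarz_ineq2 mult_left_mono[OF feat_bound[OF z]]]) simp
      qed (use discount in auto)
      finally have d: "norm (theta_dir x z - ideal_dir x z) \<le> norm e * B5" by simp
      have "D \<bullet> (theta_dir x z - ideal_dir x z) \<le> norm D * (norm e * B5)"
        by (rule order_trans[OF norm_cauchy_schwarz mult_left_mono[OF d]]) simp
      \<comment> \<open>Young's inequality with weights that use up half of the available decrease
        |D|^2 / 2.\<close>
      moreover have "norm D * (norm e * B5) \<le> (norm D)\<^sup>2 / 4 + B5\<^sup>2 * (norm e)\<^sup>2"
        using zero_le_power2[of "norm D / 2 - B5 * norm e"] by (simp add: power2_eq_square algebra_simps)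
      moreover have "D \<bullet> theta_dir x z = \<zeta> - (norm D)\<^sup>2 / 2 + D \<bullet> (theta_dir x z - ideal_dir x z)"
        unfolding \<zeta>_def by (simp add: inner_add_right inner_diff_right power2_norm_eq_inner)
      ultimately show ?thesis by linarith
    qed
    ultimately have "J (fst x') - J (fst x) \<le> \<alpha> * (\<zeta> - (norm D)\<^sup>2 / 4 + B5\<^sup>2 * (norm e)\<^sup>2 + L * \<alpha> * B1\<^sup>2)"
      using mult_left_mono[of "D \<bullet> theta_dir x z" "\<zeta> - (norm D)\<^sup>2 / 4 + B5\<^sup>2 * (norm e)\<^sup>2" \<alpha>] ab
      by (simp add: power2_eq_square algebra_simps)
    then have A: "(norm D)\<^sup>2 / 4 \<le> (J (fst x) - J (fst x')) / \<alpha> + \<zeta> + B5\<^sup>2 * (norm e)\<^sup>2 + L * \<alpha> * B1\<^sup>2"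
      using ab by (simp add: field_simps)
    \<comment> \<open>The new tracking error is the old one plus the \<omega> step plus d, the
      displacement of the target.\<close>
    define d where "d = omega_star x - omega_star x'"
    define q where "q = \<beta> *\<^sub>R omega_dir x z + d"
    have e': "track_err x' = e + q"
      unfolding e_def q_def d_def track_err_def x'_def next_iter_def by simp
    have dn: "norm d \<le> B4 * (\<alpha> * B1)"
    proof -
      \<comment> \<open>Setting the second components to 0 makes the Lipschitz estimate see only the
        \<theta> displacement, of size \<alpha>, and not the \<omega> displacement, of size \<beta>.
        The bound \<alpha> / \<beta> depends on this.\<close>
      have "d = omega_star (fst x, 0) - omega_star (fst x', 0)"
        unfolding d_def by (simp add: omega_star_cong[of x "(fst x, 0)"] omega_star_cong[of x' "(fst x', 0)"])
      then have "norm d \<le> B4 * norm ((fst x, 0::real^'n) - (fst x', 0))"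
        using B4(2)[OF zero_in_iter_ball zero_in_iter_ball z] x x' by (simp add: in_iter_ball)
      also have "norm ((fst x, 0::real^'n) - (fst x', 0)) = \<alpha> * norm (theta_dir x z)"
        using ab by (simp add: x'_def next_iter_def norm_Pair)
      also have "B4 * (\<alpha> * norm (theta_dir x z)) \<le> B4 * (\<alpha> * B1)"
        using B1(2)[OF x z] ab B4(1) by (intro mult_left_mono) auto
      finally show ?thesis .
    qed
    have qn: "norm q \<le> \<beta> * B6"
    proof -
      have "norm q \<le> \<beta> * norm (omega_dir x z) + norm d"
        unfolding q_def by (rule norm_triangle_le) (use \<beta> in simp)
      also have "\<dots> \<le> \<beta> * B2 + B4 * (\<beta> * B1)"
        using B2(2)[OF x z] \<beta> dn mult_left_mono[OF mult_right_mono[OF ab(2) B1(1)] B4(1)]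
        by (intro add_mono mult_left_mono) auto
      finally show ?thesis unfolding B6_def by (simp add: algebra_simps)
    qed
    have "(norm (track_err x'))\<^sup>2 = (norm e)\<^sup>2 + 2 * (e \<bullet> q) + (norm q)\<^sup>2"
      unfolding e' by (simp add: power2_norm_eq_inner inner_add_left inner_add_right inner_commute)
    moreover have "e \<bullet> q = \<beta> * (\<xi> - e \<bullet> (C *v e)) + e \<bullet> d"
      unfolding q_def \<xi>_def by (simp add: inner_add_right)
    moreover have "\<beta> * (l * (norm e)\<^sup>2) \<le> \<beta> * (e \<bullet> (C *v e))"
      using l(2) \<beta> by (intro mult_left_mono) auto
    moreover have "e \<bullet> d \<le> B3 * (B4 * (\<alpha> * B1))"
      by (rule order_trans[OF norm_cauchy_schwarz mult_mono]) (use B3 x z dn in \<open>auto simp: e_def\<close>)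
    moreover have "(norm q)\<^sup>2 \<le> (\<beta> * B6)\<^sup>2" by (rule power_mono[OF qn]) simp
    ultimately have "2 * \<beta> * (l * (norm e)\<^sup>2)
        \<le> (norm e)\<^sup>2 - (norm (track_err x'))\<^sup>2 + 2 * \<beta> * \<xi> + 2 * (B3 * (B4 * (\<alpha> * B1))) + (\<beta> * B6)\<^sup>2"
      by (simp add: algebra_simps)
    then have "l * (norm e)\<^sup>2 \<le> ((norm e)\<^sup>2 - (norm (track_err x'))\<^sup>2) / (2 * \<beta>) + \<xi>
        + (B3 * B4 * B1) * (\<alpha> / \<beta>) + \<beta> * B6\<^sup>2 / 2"
      using \<beta> by (simp add: field_simps power2_eq_square)
    moreover have "\<beta> * B6\<^sup>2 / 2 \<le> B6\<^sup>2 * \<beta>" using \<beta> by simp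
    ultimately have "l * (norm e)\<^sup>2 \<le> ((norm e)\<^sup>2 - (norm (track_err x'))\<^sup>2) / (2 * \<beta>) + \<xi>
        + (B3 * B4 * B1) * (\<alpha> / \<beta>) + B6\<^sup>2 * \<beta>" by linarith
    then have "\<kappa> * (l * (norm e)\<^sup>2) \<le> \<kappa> * (((norm e)\<^sup>2 - (norm (track_err x'))\<^sup>2) / (2 * \<beta>) + \<xi>
        + (B3 * B4 * B1) * (\<alpha> / \<beta>) + B6\<^sup>2 * \<beta>)" by (rule mult_left_mono[OF _ \<kappa>0])
    moreover have "\<kappa> * (l * (norm e)\<^sup>2) = B5\<^sup>2 * (norm e)\<^sup>2" using l(1) by (simp add: \<kappa>_def)
    moreover have "\<kappa> * ((B3 * B4 * B1) * (\<alpha> / \<beta>)) + \<kappa> * (B6\<^sup>2 * \<beta>) + L * \<alpha> * B1\<^sup>2 \<le> c * (\<beta> + \<alpha> / \<beta>)"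
    proof -
      have "0 \<le> L * B1\<^sup>2 * (\<alpha> / \<beta>)" "0 \<le> \<kappa> * (B3 * B4 * B1) * \<beta>" "0 \<le> \<kappa> * B6\<^sup>2 * (\<alpha> / \<beta>)"
        using L(1) \<kappa>0 B1(1) B3(1) B4(1) ab(1) \<beta> by simp_all
      moreover have "L * \<alpha> * B1\<^sup>2 \<le> L * B1\<^sup>2 * \<beta>"
        using mult_left_mono[OF ab(2), of "L * B1\<^sup>2"] L(1) by (simp add: mult_ac)
      moreover have "c * (\<beta> + \<alpha> / \<beta>) = L * B1\<^sup>2 * \<beta> + L * B1\<^sup>2 * (\<alpha> / \<beta>)
          + \<kappa> * (B3 * B4 * B1) * \<beta> + \<kappa> * ((B3 * B4 * B1) * (\<alpha> / \<beta>)) + \<kappa> * (B6\<^sup>2 * \<beta>) + \<kappa> * B6\<^sup>2 * (\<alpha> / \<beta>)"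
        unfolding c_def by (simp only: distrib_left distrib_right mult.assoc)
      ultimately show ?thesis by linarith
    qed
    moreover have "noise \<kappa> x z = \<zeta> + \<kappa> * \<xi>" by (simp add: noise_def \<zeta>_def \<xi>_def D_def e_def)
    moreover have "\<kappa> * (((norm e)\<^sup>2 - (norm (track_err x'))\<^sup>2) / (2 * \<beta>) + \<xi>
        + (B3 * B4 * B1) * (\<alpha> / \<beta>) + B6\<^sup>2 * \<beta>) = \<kappa> * (((norm e)\<^sup>2 - (norm (track_err x'))\<^sup>2) / (2 * \<beta>)) + \<kappa> * \<xi>
        + \<kappa> * ((B3 * B4 * B1) * (\<alpha> / \<beta>)) + \<kappa> * (B6\<^sup>2 * \<beta>)" by (simp only: distrib_left)
    ultimately have "(norm D)\<^sup>2 / 4 \<le> (J (fst x) - J (fst x')) / \<alpha>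
        + \<kappa> * (((norm e)\<^sup>2 - (norm (track_err x'))\<^sup>2) / (2 * \<beta>)) + noise \<kappa> x z + c * (\<beta> + \<alpha> / \<beta>)"
      using A by linarith
    then show "(norm (grad_J x))\<^sup>2 / 4
      \<le> (J (fst x) - J (fst (next_iter \<alpha> \<beta> x z))) / \<alpha>
        + \<kappa> * (((norm (track_err x))\<^sup>2
            - (norm (track_err (next_iter \<alpha> \<beta> x z)))\<^sup>2) / (2 * \<beta>))
        + noise \<kappa> x z + c * (\<beta> + \<alpha> / \<beta>)"
      unfolding D_def e_def x'_def .
  qed
qed

end

text \<open>With lag \<open>\<tau> \<approx> ln T / ln (1/\<rho>)\<close> the mixing error is at most \<open>1/T\<close>.\<close>

lemma step_size_rates:
  fixes a b \<rho> :: real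
  assumes ab: "1/2 < a" "a \<le> 1" "0 < b" "b \<le> a" and \<rho>: "0 < \<rho>" "\<rho> < 1"
  obtains c where "0 \<le> c" "\<And>T. 2 \<le> T \<Longrightarrow> \<exists>\<tau>\<ge>1.
    (let \<alpha> = real T powr - a; \<beta> = real T powr - b;
         rate = 1 / real T powr (1 - a) + ln (real T) / real T powr (min b (a - b))
     in 1 / (\<alpha> * real T) \<le> c * rate \<and> 1 / (\<beta> * real T) \<le> c * rate \<and> real \<tau> / real T \<le> c * rate
        \<and> \<beta> * real \<tau> \<le> c * rate \<and> \<rho> ^ \<tau> \<le> c * rate \<and> \<beta> + \<alpha> / \<beta> \<le> c * rate \<and> 1 / real T \<le> c * rate)"
proof -
  define \<Lambda> where "\<Lambda> = ln (1 / \<rho>)"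
  have \<Lambda>: "0 < \<Lambda>" unfolding \<Lambda>_def using \<rho> by simp
  \<comment> \<open>Chosen so that \<tau> \<le> c0 ln T: the extra 1 from rounding up is at most ln
    T / ln 2 because T \<ge> 2.\<close>
  define c0 where "c0 = 1 / \<Lambda> + 1 / ln 2"
  define c where "c = c0 + 2 / ln 2 + 1"
  have ln2: "0 < ln (2::real)" by simp
  have c0: "0 \<le> c0" unfolding c0_def using \<Lambda> ln2 by simp
  have c1: "1 \<le> c" "0 \<le> c" unfolding c_def using c0 ln2 by (simp_all add: add_nonneg_nonneg)
  show ?thesis
  proof (rule that[OF c1(2)])
    fix T :: nat assume T: "2 \<le> T"
    define x where "x = real T"
    define \<delta> where "\<delta> = min b (a - b)"
    define \<tau> where "\<tau> = nat \<lceil>ln x / \<Lambda>\<rceil>"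
    define rate where "rate = 1 / x powr (1 - a) + ln x / x powr \<delta>"
    have x: "2 \<le> x" "1 < x" "0 < x" using T by (auto simp: x_def)
    have lnx: "ln 2 \<le> ln x" "0 < ln x" using x by simp_all
    have l1: "1 \<le> ln x / ln 2" using lnx ln2 by simp
    have \<tau>: "1 \<le> \<tau>" "ln x / \<Lambda> \<le> real \<tau>" "real \<tau> \<le> ln x / \<Lambda> + 1"
    proof -
      have "0 < ln x / \<Lambda>" using lnx \<Lambda> by simp
      then show "1 \<le> \<tau>" "ln x / \<Lambda> \<le> real \<tau>" "real \<tau> \<le> ln x / \<Lambda> + 1" unfolding \<tau>_def by linarith+
    qed
    have \<tau>c: "real \<tau> \<le> c0 * ln x"
    proof -
      have "c0 * ln x = ln x / \<Lambda> + ln x / ln 2" by (simp add: c0_def distrib_right)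
      then show ?thesis using \<tau>(3) l1 by linarith
    qed
    define p where "p = ln x / x powr \<delta>"
    have p0: "0 \<le> p" unfolding p_def using lnx by simp
    have r: "rate = x powr (a - 1) + p"
      unfolding rate_def p_def by (simp add: powr_minus_divide[symmetric])
    have pw: "x powr - y * ln x \<le> p" if "\<delta> \<le> y" for y
    proof -
      have "x powr - y \<le> x powr - \<delta>" using that x by (intro powr_mono) auto
      then have "x powr - y * ln x \<le> x powr - \<delta> * ln x" using lnx by (intro mult_right_mono) auto
      then show ?thesis by (simp add: p_def powr_minus divide_inverse mult.commute)
    qed
    \<comment> \<open>Powers without a logarithm are absorbed into the logarithmic term at the price
      1 / ln 2.\<close>
    have pw1: "x powr - y \<le> p / ln 2" if "\<delta> \<le> y" for y
    proof -
      have "x powr - y * 1 \<le> x powr - y * (ln x / ln 2)" using l1 by (intro mult_left_mono) auto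
      also have "\<dots> \<le> p / ln 2" using divide_right_mono[OF pw[OF that], of "ln 2"] by simp
      finally show ?thesis by simp
    qed
    have xi: "1 / x = x powr - 1" using x by (simp add: powr_minus divide_inverse)
    have \<delta>b: "\<delta> \<le> b" "\<delta> \<le> a - b" "\<delta> \<le> 1" using ab by (auto simp: \<delta>_def)
    have rate0: "0 \<le> rate" "p \<le> rate" "x powr (a - 1) \<le> rate" using p0 by (simp_all add: r)
    have le1: "u \<le> c * rate" if "u \<le> rate" for u
      using that mult_right_mono[OF c1(1) rate0(1)] by linarith
    have le2: "u \<le> c * rate" if "u \<le> k * p" "k \<le> c" "0 \<le> k" for u k
      using that mult_mono[OF that(2) rate0(2) c1(2) p0] by linarith
    have e1: "1 / (x powr - a * x) \<le> c * rate"
    proof (rule le1)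
      have "x powr - a * x = x powr (1 - a)" using x by (simp add: powr_mult_base mult.commute)
      also have "1 / x powr (1 - a) = x powr (a - 1)" by (simp add: powr_minus_divide[symmetric])
      finally show "1 / (x powr - a * x) \<le> rate" using rate0(3) by simp
    qed
    have e2: "1 / (x powr - b * x) \<le> c * rate"
    proof (rule le1)
      have "x powr - b * x = x powr (1 - b)" using x by (simp add: powr_mult_base mult.commute)
      also have "1 / x powr (1 - b) = x powr (b - 1)" by (simp add: powr_minus_divide[symmetric])
      also have "\<dots> \<le> x powr (a - 1)" using x ab by (intro powr_mono) auto
      finally show "1 / (x powr - b * x) \<le> rate" using rate0(3) by simp
    qed
    have e3: "real \<tau> / x \<le> c * rate"
    proof (rule le2[where k=c0])
      have "real \<tau> / x \<le> (c0 * ln x) * (1 / x)" using \<tau>c x by (simp add: divide_right_mono)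
      also have "\<dots> = c0 * (x powr - 1 * ln x)" unfolding xi by simp
      also have "\<dots> \<le> c0 * p" by (rule mult_left_mono[OF pw[OF \<delta>b(3)] c0])
      finally show "real \<tau> / x \<le> c0 * p" .
    qed (use c0 ln2 in \<open>auto simp: c_def\<close>)
    have e4: "x powr - b * real \<tau> \<le> c * rate"
    proof (rule le2[where k=c0])
      have "x powr - b * real \<tau> \<le> x powr - b * (c0 * ln x)" using \<tau>c by (intro mult_left_mono) auto
      also have "\<dots> = c0 * (x powr - b * ln x)" by simp
      also have "\<dots> \<le> c0 * p" by (rule mult_left_mono[OF pw[OF \<delta>b(1)] c0])
      finally show "x powr - b * real \<tau> \<le> c0 * p" .
    qed (use c0 ln2 in \<open>auto simp: c_def\<close>)
    have e7: "1 / x \<le> c * rate"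
      unfolding xi by (rule le2[where k="1 / ln 2"]) (use pw1[OF \<delta>b(3)] c0 ln2 in \<open>auto simp: c_def field_simps\<close>)
    have e5: "\<rho> ^ \<tau> \<le> c * rate"
    proof -
      have "\<rho> ^ \<tau> = exp (- (\<Lambda> * real \<tau>))"
      \<comment> \<open>By the choice of \<Lambda>, \<rho> to the power \<tau> is exp(- \<Lambda>
        \<tau>), and \<Lambda> \<tau> \<ge> ln T brings it below 1 / T.\<close>
      proof -
        have "\<rho> ^ \<tau> = exp (ln \<rho>) ^ \<tau>" using \<rho> by simp
        also have "\<dots> = exp (real \<tau> * ln \<rho>)" by (rule exp_of_nat_mult[symmetric])
        also have "ln \<rho> = - \<Lambda>" unfolding \<Lambda>_def using \<rho> by (simp add: ln_div)
        finally show ?thesis by (simp add: mult.commute)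
      qed
      also have "\<dots> \<le> exp (- ln x)" using \<tau>(2) \<Lambda> by (simp add: field_simps)
      also have "\<dots> = 1 / x" using x by (simp add: exp_minus divide_inverse)
      finally show ?thesis using e7 by linarith
    qed
    have e6: "x powr - b + x powr - a / x powr - b \<le> c * rate"
    proof (rule le2[where k="2 / ln 2"])
      have "x powr - a / x powr - b = x powr - (a - b)" using x by (simp add: powr_diff[symmetric])
      then show "x powr - b + x powr - a / x powr - b \<le> 2 / ln 2 * p"
        using pw1[OF \<delta>b(1)] pw1[OF \<delta>b(2)] by simp
    qed (use c0 ln2 in \<open>auto simp: c_def\<close>)
    show "\<exists>\<tau>\<ge>1. (let \<alpha> = real T powr - a; \<beta> = real T powr - b;
         rate = 1 / real T powr (1 - a) + ln (real T) / real T powr (min b (a - b))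
     in 1 / (\<alpha> * real T) \<le> c * rate \<and> 1 / (\<beta> * real T) \<le> c * rate \<and> real \<tau> / real T \<le> c * rate
        \<and> \<beta> * real \<tau> \<le> c * rate \<and> \<rho> ^ \<tau> \<le> c * rate \<and> \<beta> + \<alpha> / \<beta> \<le> c * rate \<and> 1 / real T \<le> c * rate)"
      using e1 e2 e3 e4 e5 e6 e7 \<tau>(1) unfolding rate_def x_def \<delta>_def Let_def by blast
  qed
qed

section \<open>The rate along a trajectory\<close>

text \<open>\<open>output_index\<close> prescribes only the probabilities of 0, ..., T. They already
  add up to 1, so larger values have probability zero.\<close>

lemma (in prob_space) AE_index_le:
  assumes idx: "idx \<in> M \<rightarrow>\<^sub>M count_space UNIV"
    and p: "\<And>k. k \<le> T \<Longrightarrow> prob {w \<in> space M. idx w = k} = 1 / real (Suc T)"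
  shows "AE w in M. idx w \<le> T"
proof -
  have m: "{w \<in> space M. idx w = k} \<in> events" for k using idx by measurable
  have "prob (\<Union>k\<in>{..T}. {w \<in> space M. idx w = k}) = (\<Sum>k\<in>{..T}. prob {w \<in> space M. idx w = k})"
    by (rule finite_measure_finite_Union) (use m in \<open>auto simp: disjoint_family_on_def\<close>)
  also have "\<dots> = (\<Sum>k\<in>{..T}. 1 / real (Suc T))" by (rule sum.cong) (use p in auto)
  also have "\<dots> = 1" by simp
  finally have "AE w in M. w \<in> (\<Union>k\<in>{..T}. {w \<in> space M. idx w = k})"
    by (rule prob_eq_1[THEN iffD1, rotated]) (use m in auto)
  then show ?thesis by eventually_elim auto
qed

text \<open>Independence is given between the \<sigma>-algebras of the index and of the trajectory;
  the events generated by the indicator and by V lie in them, which yields independence of the two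
  random variables and hence the product formula.\<close>

lemma (in prob_space) expectation_indep_indicator:
  fixes V :: "'a \<Rightarrow> real"
  assumes ind: "indep_set (sets A) (sets B)" and A: "subalgebra M A" and B: "subalgebra M B"
    and E: "E \<in> sets A" and V: "V \<in> borel_measurable B" "integrable M V"
  shows "integrable M (\<lambda>w. indicator E w * V w)"
    and "expectation (\<lambda>w. indicator E w * V w) = prob E * expectation V"
proof -
  have spA: "space A = space M" and spB: "space B = space M" using A B by (auto simp: subalgebra_def)
  have EM: "E \<in> events" using A E by (auto simp: subalgebra_def)
  have i1: "(indicator E :: 'a \<Rightarrow> real) \<in> borel_measurable A" using E by measurable
  have "sigma_sets (space M) {indicator E -` C \<inter> space M | C. C \<in> sets (borel :: real measure)} \<subseteq> sets A"
    unfolding spA[symmetric] by (rule sets.sigma_sets_subset) (use measurable_sets[OF i1] in auto)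
  moreover have "sigma_sets (space M) {V -` C \<inter> space M | C. C \<in> sets borel} \<subseteq> sets B"
    unfolding spB[symmetric] by (rule sets.sigma_sets_subset) (use measurable_sets[OF V(1)] in auto)
  ultimately have "indep_var borel (indicator E) borel V"
    unfolding indep_var_eq
    using ind measurable_from_subalg[OF A i1] measurable_from_subalg[OF B V(1)]
    unfolding indep_sets2_eq by blast
  moreover have "integrable M (indicator E :: 'a \<Rightarrow> real)"
    using EM by (simp add: integrable_indicator_iff emeasure_eq_measure)
  ultimately show "integrable M (\<lambda>w. indicator E w * V w)"
    and "expectation (\<lambda>w. indicator E w * V w) = prob E * expectation V"
    using indep_var_integrable[of "indicator E" V] indep_var_lebesgue_integral[of "indicator E" V] V(2) EM
    by (auto simp: Int_absorb2 sets.sets_into_space)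
qed

locale greedy_gq_run = greedy_gq_model S P \<pi>b \<gamma> r_max k1 k2 r \<phi> \<pi> \<mu> + mdp_trajectory S P \<pi>b M s0 st act
  for S :: "(real^'d) set"
    and P :: "(real^'d) \<times> 'a::finite \<Rightarrow> (real^'d) measure"
    and \<pi>b :: "real^'d \<Rightarrow> 'a pmf"
    and \<gamma> r_max k1 k2 :: real
    and r :: "real^'d \<Rightarrow> 'a \<Rightarrow> real^'d \<Rightarrow> real"
    and \<phi> :: "real^'d \<Rightarrow> 'a \<Rightarrow> real^'n"
    and \<pi> :: "real^'n \<Rightarrow> real^'d \<Rightarrow> 'a pmf"
    and \<mu> :: "((real^'d) \<times> 'a) measure"
    and M :: "'w measure"
    and s0 :: "real^'d" and st :: "nat \<Rightarrow> 'w \<Rightarrow> real^'d" and act :: "nat \<Rightarrow> 'w \<Rightarrow> 'a" +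
  fixes m \<rho> :: real and \<theta>0 \<omega>0 :: "real^'n"
  assumes mixing_const: "0 < m" "0 < \<rho>" "\<rho> < 1"
    and mixing: "\<And>t s. 0 < t \<Longrightarrow> s \<in> S \<Longrightarrow>
      tv_dist (kernel_pow (state_space S) (state_kernel P \<pi>b) t s)
              (distr \<mu> (state_space S) fst) \<le> m * \<rho> ^ t"
begin

abbreviation "run a b T t w \<equiv> gq_run \<gamma> r \<phi> \<pi> \<theta>0 \<omega>0 st act a b T t w"

text \<open>Regular-family bounds hold on the ball only, while the run lies in it only almost
  surely. Clipping makes every integrand bounded at every sample point and changes the run only on a
  null set; 0 is a default inside the ball.\<close>

definition clip :: "real \<Rightarrow> (real^'n) \<times> (real^'n) \<Rightarrow> (real^'n) \<times> (real^'n)" where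
  "clip R x = (if x \<in> iter_ball R then x else 0)"

lemma clip_in: "0 \<le> R \<Longrightarrow> clip R x \<in> iter_ball R"
  by (simp add: clip_def in_iter_ball)

lemma clip_measurable: "clip R \<in> borel_measurable borel"
proof -
  have "closed (iter_ball R)" unfolding iter_ball_def by (intro closed_Times closed_cball)
  then have "iter_ball R \<in> sets borel" by (rule borel_closed)
  then show ?thesis unfolding clip_def by (intro measurable_If_set) auto
qed

lemma run_Suc:
  "run a b T (Suc t) w
    = next_iter (real T powr - a) (real T powr - b) (run a b T t w) (obs t w)"
  unfolding gq_run_def
  by (simp add: Let_def case_prod_unfold const_step_def next_iter_def theta_dir_def omega_dir_def td_def next_feat_def feat_def obs_def)

lemma obs_Hist: "obs t \<in> Hist (Suc (Suc t)) (Suc t) \<rightarrow>\<^sub>M Obs"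
  unfolding obs_def by (intro measurable_Pair st_Hist act_Hist) auto

text \<open>The iterate at t uses observations 0 to t - 1, that is t + 1 states and t actions. It is
  thus known before the action at t is drawn, as \<open>expectation_obs\<close> demands.\<close>

lemma run_Hist: "run a b T t \<in> Hist (Suc t) t \<rightarrow>\<^sub>M borel"
proof (induction t)
  case 0
  show ?case unfolding gq_run_def by simp
next
  case (Suc t)
  have x: "run a b T t \<in> Hist (Suc (Suc t)) (Suc t) \<rightarrow>\<^sub>M borel"
    by (rule measurable_Hist_mono[OF _ _ Suc]) auto
  have xz: "(\<lambda>w. (run a b T t w, obs t w)) \<in> Hist (Suc (Suc t)) (Suc t) \<rightarrow>\<^sub>M borel \<Otimes>\<^sub>M Obs"
    by (intro measurable_Pair x obs_Hist)
  have fs: "(fst :: (real^'n) \<times> (real^'n) \<Rightarrow> _) \<in> borel \<rightarrow>\<^sub>M borel" "(snd :: (real^'n) \<times> (real^'n) \<Rightarrow> _) \<in> borel \<rightarrow>\<^sub>M borel"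
    by (rule borel_measurable_continuous_onI, intro continuous_intros)+
  \<comment> \<open>The radius 0 is arbitrary: the measurability clause of \<open>reg_family\<close>
    holds on the whole space, whatever the ball.\<close>
  have dirs: "(\<lambda>w. theta_dir (run a b T t w) (obs t w)) \<in> borel_measurable (Hist (Suc (Suc t)) (Suc t))"
    "(\<lambda>w. omega_dir (run a b T t w) (obs t w)) \<in> borel_measurable (Hist (Suc (Suc t)) (Suc t))"
    using measurable_compose[OF xz reg_family_measurable[OF reg_theta_dir[of 0]]]
      measurable_compose[OF xz reg_family_measurable[OF reg_omega_dir[of 0]]] by simp_all
  show ?case unfolding run_Suc next_iter_def
    by (intro borel_measurable_Pair borel_measurable_add borel_measurable_scaleR borel_measurable_const
        measurable_compose[OF x fs(1)] measurable_compose[OF x fs(2)] dirs)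
qed

lemma expectation_reg_bound:
  fixes f :: "_ \<Rightarrow> _ \<Rightarrow> real"
  assumes f: "reg_family Obs (iter_ball R) f" and Y: "Y \<in> M \<rightarrow>\<^sub>M borel" "\<And>w. w \<in> space M \<Longrightarrow> Y w \<in> iter_ball R"
  shows "integrable M (\<lambda>w. f (Y w) (obs t w))"
proof -
  from reg_familyE[OF f] obtain B where B: "\<And>x z. x \<in> iter_ball R \<Longrightarrow> z \<in> space Obs \<Longrightarrow> norm (f x z) \<le> B" by metis
  have "(\<lambda>w. (Y w, obs t w)) \<in> M \<rightarrow>\<^sub>M borel \<Otimes>\<^sub>M Obs" by (intro measurable_Pair Y(1) obs_measurable)
  from measurable_compose[OF this reg_family_measurable[OF f]]
  have "(\<lambda>w. f (Y w) (obs t w)) \<in> borel_measurable M" by simp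
  then show ?thesis
    by (rule integrable_bounded_prob[OF prob_space_axioms, where B=B])
      (auto intro!: B[unfolded real_norm_def] Y(2) obs_in simp: space_Obs simp del: space_SA)
qed

text \<open>The drift inequality is summed over t < T; its J and tracking-error parts telescope
  because the stepsizes are constant. The noise is handled by the lag, and the last index T, for
  which no drift inequality is at hand, by the plain bound BD.\<close>

lemma mean_square_gradient_bound:
  assumes ab: "1/2 < a" "a \<le> 1" "0 < b" "b \<le> a" and R: "0 \<le> R"
    and bd: "\<And>T t. 2 \<le> T \<Longrightarrow> t \<le> T \<Longrightarrow> AE w in M. run a b T t w \<in> iter_ball R"
  obtains K where "\<And>T. 2 \<le> T \<Longrightarrow> (\<Sum>t\<le>T. expectation (\<lambda>w. (norm (grad_J (clip R (run a b T t w))))\<^sup>2))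
      \<le> real (Suc T) * (K * (1 / real T powr (1 - a) + ln (real T) / real T powr (min b (a - b))))"
proof -
  obtain \<kappa> c where \<kappa>: "0 \<le> \<kappa>" and c: "0 \<le> c" and desc:
    "\<And>\<alpha> \<beta> x z. 0 < \<alpha> \<Longrightarrow> \<alpha> \<le> \<beta> \<Longrightarrow> \<beta> \<le> 1 \<Longrightarrow> x \<in> iter_ball R \<Longrightarrow> z \<in> space Obs \<Longrightarrow>
      next_iter \<alpha> \<beta> x z \<in> iter_ball R \<Longrightarrow>
      (norm (grad_J x))\<^sup>2 / 4
      \<le> (J (fst x) - J (fst (next_iter \<alpha> \<beta> x z))) / \<alpha>
        + \<kappa> * (((norm (track_err x))\<^sup>2
            - (norm (track_err (next_iter \<alpha> \<beta> x z)))\<^sup>2) / (2 * \<beta>))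
        + noise \<kappa> x z + c * (\<beta> + \<alpha> / \<beta>)"
    using descent_step[OF R] by blast
  from reg_familyE[OF reg_theta_dir[of R]] obtain B1 where B1: "0 \<le> B1"
    "\<And>x z. x \<in> iter_ball R \<Longrightarrow> z \<in> space Obs \<Longrightarrow> norm (theta_dir x z) \<le> B1" by metis
  from reg_familyE[OF reg_omega_dir[of R]] obtain B2 where B2: "0 \<le> B2"
    "\<And>x z. x \<in> iter_ball R \<Longrightarrow> z \<in> space Obs \<Longrightarrow> norm (omega_dir x z) \<le> B2" by metis
  from reg_familyE[OF reg_noise[of R \<kappa>]] obtain Bn where Bn: "0 \<le> Bn"
    "\<And>x z. x \<in> iter_ball R \<Longrightarrow> z \<in> space Obs \<Longrightarrow> norm (noise \<kappa> x z) \<le> Bn"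
    "\<And>x y z. x \<in> iter_ball R \<Longrightarrow> y \<in> iter_ball R \<Longrightarrow> z \<in> space Obs \<Longrightarrow>
      norm (noise \<kappa> x z - noise \<kappa> y z) \<le> Bn * norm (x - y)" by metis
  from reg_familyE[OF reg_J[of R]] obtain BJ where BJ: "0 \<le> BJ"
    "\<And>x z. x \<in> iter_ball R \<Longrightarrow> z \<in> space Obs \<Longrightarrow> norm (J (fst x)) \<le> BJ" by metis
  have reg_e: "reg_family Obs (iter_ball R) (\<lambda>x z. (norm (track_err x))\<^sup>2)"
    unfolding power2_norm_eq_inner by (intro reg_family_inner reg_track_err)
  from reg_familyE[OF this] obtain Be where Be: "0 \<le> Be"
    "\<And>x z. x \<in> iter_ball R \<Longrightarrow> z \<in> space Obs \<Longrightarrow> norm ((norm (track_err x))\<^sup>2) \<le> Be" by metis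
  have reg_d: "reg_family Obs (iter_ball R) (\<lambda>x z. (norm (grad_J x))\<^sup>2)"
    unfolding power2_norm_eq_inner by (intro reg_family_inner reg_grad_J)
  from reg_familyE[OF this] obtain BD where BD: "0 \<le> BD"
    "\<And>x z. x \<in> iter_ball R \<Longrightarrow> z \<in> space Obs \<Longrightarrow> norm ((norm (grad_J x))\<^sup>2) \<le> BD" by metis
  obtain cr where cr: "0 \<le> cr" "\<And>T. 2 \<le> T \<Longrightarrow> \<exists>\<tau>\<ge>1.
    (let \<alpha> = real T powr - a; \<beta> = real T powr - b;
         rate = 1 / real T powr (1 - a) + ln (real T) / real T powr (min b (a - b))
     in 1 / (\<alpha> * real T) \<le> cr * rate \<and> 1 / (\<beta> * real T) \<le> cr * rate \<and> real \<tau> / real T \<le> cr * rate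
        \<and> \<beta> * real \<tau> \<le> cr * rate \<and> \<rho> ^ \<tau> \<le> cr * rate \<and> \<beta> + \<alpha> / \<beta> \<le> cr * rate \<and> 1 / real T \<le> cr * rate)"
    using step_size_rates[OF ab mixing_const(2,3)] by blast
  define G where "G = B1 + B2"
  \<comment> \<open>One summand for each estimate \<open>s1\<close> to \<open>s6\<close> below (two
    for \<open>s4\<close>); the 4 clears the factor 1/4 of the drift inequality. Nothing here
    depends on T.\<close>
  define K where "K = (4 * (2 * BJ + \<kappa> * Be + Bn + Bn * G + 2 * Bn * m + c) + BD) * cr"
  have G0: "0 \<le> G" unfolding G_def using B1(1) B2(1) by simp
  have K0: "0 \<le> K" unfolding K_def using BJ(1) \<kappa> Be(1) Bn(1) G0 mixing_const(1) c BD(1) cr(1) by simp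
  have oin: "obs t w \<in> space Obs" if "w \<in> space M" for t w
    using obs_in[OF that] by (simp only: space_Obs)
  show ?thesis
  proof (rule that)
    fix T :: nat assume T: "2 \<le> T"
    define \<alpha> where "\<alpha> = real T powr - a"
    define \<beta> where "\<beta> = real T powr - b"
    define rate where "rate = 1 / real T powr (1 - a) + ln (real T) / real T powr (min b (a - b))"
    define Y where "Y t w = clip R (run a b T t w)" for t w
    obtain \<tau> where \<tau>: "1 \<le> \<tau>" and rt: "1 / (\<alpha> * real T) \<le> cr * rate" "1 / (\<beta> * real T) \<le> cr * rate"
      "real \<tau> / real T \<le> cr * rate" "\<beta> * real \<tau> \<le> cr * rate" "\<rho> ^ \<tau> \<le> cr * rate"
      "\<beta> + \<alpha> / \<beta> \<le> cr * rate" "1 / real T \<le> cr * rate"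
      using cr(2)[OF T] unfolding \<alpha>_def \<beta>_def rate_def Let_def by blast
    have Tr: "0 < real T" "1 \<le> real T" using T by auto
    have \<alpha>: "0 < \<alpha>" and \<beta>: "0 < \<beta>" unfolding \<alpha>_def \<beta>_def using Tr by auto
    have \<alpha>\<beta>: "\<alpha> \<le> \<beta>" unfolding \<alpha>_def \<beta>_def using Tr ab by (intro powr_mono) auto
    have \<beta>1: "\<beta> \<le> 1" unfolding \<beta>_def using powr_mono[of "-b" 0 "real T"] Tr ab by simp
    have Yin: "Y t w \<in> iter_ball R" for t w unfolding Y_def by (rule clip_in[OF R])
    have Ym: "Y t \<in> M \<rightarrow>\<^sub>M borel" for t
      unfolding Y_def by (rule measurable_compose[OF measurable_from_subalg[OF subalgebra_Hist run_Hist] clip_measurable])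
    \<comment> \<open>Only finitely many times are involved, so their null sets combine; off this
      set, clipping does nothing.\<close>
    have good: "AE w in M. w \<in> space M \<and> (\<forall>t\<in>{..T}. run a b T t w \<in> iter_ball R)"
      by (intro AE_conjI AE_space AE_finite_allI) (use bd[OF T] in auto)
    have YS: "Y (Suc t) w = next_iter \<alpha> \<beta> (Y t w) (obs t w)"
      if "\<forall>t\<in>{..T}. run a b T t w \<in> iter_ball R" "t < T" for t w
    proof -
      have "run a b T t w \<in> iter_ball R" "run a b T (Suc t) w \<in> iter_ball R" using that by auto
      then have "Y t w = run a b T t w" "Y (Suc t) w = run a b T (Suc t) w" by (simp_all add: Y_def clip_def)
      then show ?thesis by (simp add: run_Suc \<alpha>_def \<beta>_def)
    qed
    define d where "d t = expectation (\<lambda>w. (norm (grad_J (Y t w)))\<^sup>2)" for t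
    define j where "j t = expectation (\<lambda>w. J (fst (Y t w)))" for t
    define e where "e t = expectation (\<lambda>w. (norm (track_err (Y t w)))\<^sup>2)" for t
    define n where "n t = expectation (\<lambda>w. noise \<kappa> (Y t w) (obs t w))" for t
    note i_d = expectation_reg_bound[OF reg_d Ym Yin]
    note i_j = expectation_reg_bound[OF reg_J Ym Yin]
    note i_e = expectation_reg_bound[OF reg_e Ym Yin]
    have i_n: "integrable M (\<lambda>w. noise \<kappa> (Y t w) (obs s w))" for t s
      by (rule expectation_reg_bound[OF reg_noise Ym Yin])
    have drift: "d t / 4 \<le> (j t - j (Suc t)) / \<alpha> + \<kappa> * ((e t - e (Suc t)) / (2 * \<beta>)) + n t + c * (\<beta> + \<alpha> / \<beta>)"
      if t: "t < T" for t
    proof -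
      have "d t / 4 = expectation (\<lambda>w. (norm (grad_J (Y t w)))\<^sup>2 / 4)" by (simp add: d_def)
      also have "\<dots> \<le> expectation (\<lambda>w. (J (fst (Y t w)) - J (fst (Y (Suc t) w))) / \<alpha>
          + \<kappa> * (((norm (track_err (Y t w)))\<^sup>2 - (norm (track_err (Y (Suc t) w)))\<^sup>2) / (2 * \<beta>))
          + noise \<kappa> (Y t w) (obs t w) + c * (\<beta> + \<alpha> / \<beta>))"
      proof (rule integral_mono_AE)
        show "AE w in M. (norm (grad_J (Y t w)))\<^sup>2 / 4 \<le> (J (fst (Y t w)) - J (fst (Y (Suc t) w))) / \<alpha>
          + \<kappa> * (((norm (track_err (Y t w)))\<^sup>2 - (norm (track_err (Y (Suc t) w)))\<^sup>2) / (2 * \<beta>))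
          + noise \<kappa> (Y t w) (obs t w) + c * (\<beta> + \<alpha> / \<beta>)"
          using good
        proof eventually_elim
          case (elim w)
          then have ys: "Y (Suc t) w = next_iter \<alpha> \<beta> (Y t w) (obs t w)"
            using YS t by blast
          show ?case
            using desc[OF \<alpha> \<alpha>\<beta> \<beta>1 Yin oin, of w t w t] Yin[of "Suc t" w] elim unfolding ys by blast
        qed
      qed (use i_d[of t] i_j[of t] i_j[of "Suc t"] i_e[of t] i_e[of "Suc t"] i_n[of t t] in auto)
      also have "\<dots> = (j t - j (Suc t)) / \<alpha> + \<kappa> * ((e t - e (Suc t)) / (2 * \<beta>)) + n t + c * (\<beta> + \<alpha> / \<beta>)"
        unfolding j_def e_def n_def
        using i_j[of t] i_j[of "Suc t"] i_e[of t] i_e[of "Suc t"] i_n[of t t] by (simp add: prob_space)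
      finally show ?thesis .
    qed
    have bj: "\<bar>j t\<bar> \<le> BJ" for t
      unfolding j_def real_norm_def[symmetric]
      by (rule norm_integral_le_prob[OF prob_space_axioms borel_measurable_integrable[OF i_j]]) (use BJ(2)[OF Yin oin] in auto)
    have be: "0 \<le> e t" "e t \<le> Be" for t
    proof -
      show "0 \<le> e t" by (simp add: e_def)
      have "norm (e t) \<le> Be"
        unfolding e_def
        by (rule norm_integral_le_prob[OF prob_space_axioms borel_measurable_integrable[OF i_e]]) (use Be(2)[OF Yin oin] in auto)
      then show "e t \<le> Be" by simp
    qed
    have bdd: "d t \<le> BD" for t
    proof -
      have "norm (d t) \<le> BD"
        unfolding d_def
        by (rule norm_integral_le_prob[OF prob_space_axioms borel_measurable_integrable[OF i_d]]) (use BD(2)[OF Yin oin] in auto)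
      then show "d t \<le> BD" by simp
    qed
    have bn: "n t \<le> Bn" for t
    proof -
      have "norm (n t) \<le> Bn"
        unfolding n_def
        by (rule norm_integral_le_prob[OF prob_space_axioms borel_measurable_integrable[OF i_n]]) (use Bn(2)[OF Yin oin] in auto)
      then show ?thesis by simp
    qed
    \<comment> \<open>Price of one noise term: Lipschitz constant times the distance travelled in
      \<tau> steps, each at most \<beta> G because \<alpha> \<le> \<beta>, plus the mixing
      error.\<close>
    define W where "W = Bn * (real \<tau> * (\<beta> * G)) + 2 * Bn * (m * \<rho> ^ \<tau>)"
    have W0: "0 \<le> W" unfolding W_def using Bn(1) \<beta> G0 mixing_const by simp
    have lag: "n (u + \<tau>) \<le> W" if u: "u + \<tau> \<le> T" for u
    proof -
      have move: "norm (Y (u + k) w - Y u w) \<le> real k * (\<beta> * G)"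
        if w: "w \<in> space M" "\<forall>t\<in>{..T}. run a b T t w \<in> iter_ball R" and k: "u + k \<le> T" for k w
        using k
      proof (induction k)
        case (Suc k)
        have ys: "Y (Suc (u + k)) w - Y (u + k) w = (\<alpha> *\<^sub>R theta_dir (Y (u + k) w) (obs (u + k) w), \<beta> *\<^sub>R omega_dir (Y (u + k) w) (obs (u + k) w))"
          using YS[OF w(2), of "u + k"] Suc.prems by (simp add: next_iter_def minus_prod_def)
        have "norm (Y (Suc (u + k)) w - Y (u + k) w) \<le> \<alpha> * norm (theta_dir (Y (u + k) w) (obs (u + k) w)) + \<beta> * norm (omega_dir (Y (u + k) w) (obs (u + k) w))"
          unfolding ys using norm_Pair_le[of "\<alpha> *\<^sub>R theta_dir (Y (u + k) w) (obs (u + k) w)" "\<beta> *\<^sub>R omega_dir (Y (u + k) w) (obs (u + k) w)"] \<alpha> \<beta> by simp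
        also have "\<dots> \<le> \<beta> * B1 + \<beta> * B2"
          using B1(2)[OF Yin oin[OF w(1)]] B2(2)[OF Yin oin[OF w(1)]] \<alpha> \<beta> \<alpha>\<beta> by (intro add_mono mult_mono) auto
        finally have "norm (Y (Suc (u + k)) w - Y (u + k) w) \<le> \<beta> * G" by (simp add: G_def distrib_left)
        moreover have "norm (Y (u + k) w - Y u w) \<le> real k * (\<beta> * G)" using Suc by simp
        moreover have "norm (Y (Suc (u + k)) w - Y u w) \<le> norm (Y (Suc (u + k)) w - Y (u + k) w) + norm (Y (u + k) w - Y u w)"
          using norm_triangle_ineq[of "Y (Suc (u + k)) w - Y (u + k) w" "Y (u + k) w - Y u w"] by simp
        ultimately show ?case by (simp add: distrib_right)
      qed simp
      have "n (u + \<tau>) \<le> expectation (\<lambda>w. noise \<kappa> (Y u w) (obs (u + \<tau>) w) + Bn * (real \<tau> * (\<beta> * G)))"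
        unfolding n_def
      proof (rule integral_mono_AE)
        show "AE w in M. noise \<kappa> (Y (u + \<tau>) w) (obs (u + \<tau>) w) \<le> noise \<kappa> (Y u w) (obs (u + \<tau>) w) + Bn * (real \<tau> * (\<beta> * G))"
          using good
        proof eventually_elim
          case (elim w)
          have "norm (noise \<kappa> (Y (u + \<tau>) w) (obs (u + \<tau>) w) - noise \<kappa> (Y u w) (obs (u + \<tau>) w)) \<le> Bn * norm (Y (u + \<tau>) w - Y u w)"
            using elim by (intro Bn(3)[OF Yin Yin oin]) auto
          also have "\<dots> \<le> Bn * (real \<tau> * (\<beta> * G))" using move[of w \<tau>] elim u Bn(1) by (intro mult_left_mono) auto
          finally show ?case by simp
        qed
      qed (use i_n[of u "u + \<tau>"] i_n[of "u + \<tau>" "u + \<tau>"] in auto)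
      also have "\<dots> = expectation (\<lambda>w. noise \<kappa> (Y u w) (obs (u + \<tau>) w)) + Bn * (real \<tau> * (\<beta> * G))"
        using i_n[of u "u + \<tau>"] by (simp add: prob_space)
      also have "expectation (\<lambda>w. noise \<kappa> (Y u w) (obs (u + \<tau>) w)) \<le> 2 * Bn * (m * \<rho> ^ \<tau>)"
      proof -
        \<comment> \<open>The clipping is moved into h, which is then bounded and centred for every
          iterate, not only for those in the ball; the raw run serves as the past datum.\<close>
        define h where "h y = noise \<kappa> (clip R (fst y)) (snd y)" for y
        have cl: "(\<lambda>y. (clip R (fst y), snd y)) \<in> borel \<Otimes>\<^sub>M Obs \<rightarrow>\<^sub>M borel \<Otimes>\<^sub>M Obs"
          by (intro measurable_Pair measurable_compose[OF measurable_fst clip_measurable] measurable_snd)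
        have "\<bar>expectation (\<lambda>w. h (run a b T u w, obs (u + \<tau>) w))\<bar> \<le> 2 * Bn * (m * \<rho> ^ \<tau>)"
        proof (rule expectation_lagged_obs_le[OF inv _ run_Hist])
          show "tv_dist (kernel_pow SS (state_kernel P \<pi>b) \<tau> s) (distr \<mu> SS fst) \<le> m * \<rho> ^ \<tau>" if "s \<in> S" for s
            using mixing[of \<tau> s] \<tau> that by simp
          show "h \<in> borel_measurable (borel \<Otimes>\<^sub>M Obs)"
            unfolding h_def using measurable_compose[OF cl reg_family_measurable[OF reg_noise]] by simp
          show "\<bar>h z\<bar> \<le> Bn" if "z \<in> space (borel \<Otimes>\<^sub>M Obs)" for z
            using that Bn(2)[OF clip_in[OF R], of "snd z" "fst z"] by (simp add: h_def space_pair_measure[of borel Obs] mem_Times_iff)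
          show "(\<integral>z. h (x, z) \<partial>stationary_obs \<mu>) = 0" for x
            by (simp add: h_def noise_centred)
        qed
        then show ?thesis by (simp add: h_def Y_def)
      qed
      finally show ?thesis unfolding W_def by simp
    qed
    \<comment> \<open>The first \<tau> terms have no iterate \<tau> steps back and are bounded
      trivially; together they cost at most \<tau> Bn, which after division by T is within the
      rate.\<close>
    have nle: "n t \<le> (if t < \<tau> then Bn else 0) + W" if "t < T" for t
    proof (cases "t < \<tau>")
      case True
      then show ?thesis using bn[of t] W0 by simp
    next
      case False
      then show ?thesis using lag[of "t - \<tau>"] that by simp
    qed
    have sn: "(\<Sum>t<T. n t) \<le> real \<tau> * Bn + real T * W"
    proof -
      have "(\<Sum>t<T. n t) \<le> (\<Sum>t<T. (if t < \<tau> then Bn else 0) + W)" by (rule sum_mono) (use nle in auto)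
      also have "\<dots> = (\<Sum>t<T. if t < \<tau> then Bn else 0) + real T * W" by (simp add: sum.distrib)
      also have "(\<Sum>t<T. if t < \<tau> then Bn else 0) \<le> (\<Sum>t<\<tau>. Bn)"
      proof -
        have "(\<Sum>t<T. if t < \<tau> then Bn else 0) = (\<Sum>t\<in>{t \<in> {..<T}. t < \<tau>}. Bn)"
          by (rule sum.inter_filter[symmetric]) simp
        also have "\<dots> \<le> (\<Sum>t<\<tau>. Bn)" by (rule sum_mono2) (use Bn(1) in auto)
        finally show ?thesis .
      qed
      finally show ?thesis by simp
    qed
    have "(\<Sum>t<T. d t / 4) \<le> (\<Sum>t<T. (j t - j (Suc t)) / \<alpha> + \<kappa> * ((e t - e (Suc t)) / (2 * \<beta>)) + n t + c * (\<beta> + \<alpha> / \<beta>))"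
      by (rule sum_mono) (use drift in auto)
    also have "\<dots> = (\<Sum>t<T. j t - j (Suc t)) / \<alpha> + \<kappa> * ((\<Sum>t<T. e t - e (Suc t)) / (2 * \<beta>)) + (\<Sum>t<T. n t) + real T * (c * (\<beta> + \<alpha> / \<beta>))"
      by (simp add: sum.distrib sum_divide_distrib sum_distrib_left)
    also have "\<dots> = (j 0 - j T) / \<alpha> + \<kappa> * ((e 0 - e T) / (2 * \<beta>)) + (\<Sum>t<T. n t) + real T * (c * (\<beta> + \<alpha> / \<beta>))"
      by (simp only: sum_lessThan_telescope')
    finally have "(\<Sum>t<T. d t) / 4 \<le> (j 0 - j T) / \<alpha> + \<kappa> * ((e 0 - e T) / (2 * \<beta>)) + (\<Sum>t<T. n t) + real T * (c * (\<beta> + \<alpha> / \<beta>))"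
      by (simp only: sum_divide_distrib)
    moreover have "u \<le> 4 * v" if "u / 4 \<le> v" for u v :: real using that by simp
    ultimately have S1: "(\<Sum>t<T. d t) \<le> 4 * ((j 0 - j T) / \<alpha> + \<kappa> * ((e 0 - e T) / (2 * \<beta>)) + (\<Sum>t<T. n t) + real T * (c * (\<beta> + \<alpha> / \<beta>)))"
      by blast
    \<comment> \<open>The common unit against which each summand is measured, T times the rate of
      \<open>step_size_rates\<close>.\<close>
    define q where "q = real T * (cr * rate)"
    have s1: "(j 0 - j T) / \<alpha> \<le> 2 * BJ * q"
    proof -
      have "(j 0 - j T) / \<alpha> \<le> (2 * BJ) / \<alpha>" using bj[of 0] bj[of T] \<alpha> by (intro divide_right_mono) auto
      also have "\<dots> = 2 * BJ * (real T * (1 / (\<alpha> * real T)))" using Tr by simp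
      also have "\<dots> \<le> 2 * BJ * q" unfolding q_def using rt(1) Tr BJ(1) by (intro mult_left_mono) auto
      finally show ?thesis .
    qed
    have s2: "\<kappa> * ((e 0 - e T) / (2 * \<beta>)) \<le> \<kappa> * Be * q"
    proof -
      have "(e 0 - e T) / (2 * \<beta>) \<le> Be / (2 * \<beta>)" using be[of 0] be[of T] \<beta> by (intro divide_right_mono) auto
      also have "\<dots> \<le> Be / \<beta>" using \<beta> Be(1) by (simp add: field_simps)
      also have "\<dots> = Be * (real T * (1 / (\<beta> * real T)))" using Tr by simp
      also have "\<dots> \<le> Be * q" unfolding q_def using rt(2) Tr Be(1) by (intro mult_left_mono) auto
      finally have "(e 0 - e T) / (2 * \<beta>) \<le> Be * q" .
      from mult_left_mono[OF this \<kappa>] show ?thesis by (simp only: mult.assoc)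
    qed
    have s3: "real \<tau> * Bn \<le> Bn * q"
    proof -
      have "real \<tau> = real T * (real \<tau> / real T)" using Tr by simp
      also have "\<dots> \<le> q" unfolding q_def using rt(3) Tr by (intro mult_left_mono) auto
      finally have "real \<tau> \<le> q" .
      from mult_left_mono[OF this Bn(1)] show ?thesis by (simp only: mult.commute)
    qed
    have s4: "real T * W \<le> (Bn * G + 2 * Bn * m) * q"
    proof -
      have "W = (Bn * G) * (\<beta> * real \<tau>) + (2 * Bn * m) * \<rho> ^ \<tau>" by (simp add: W_def mult_ac)
      also have "\<dots> \<le> (Bn * G) * (cr * rate) + (2 * Bn * m) * (cr * rate)"
        using rt(4,5) Bn(1) G0 mixing_const(1) by (intro add_mono mult_left_mono) auto
      finally have "real T * W \<le> real T * ((Bn * G) * (cr * rate) + (2 * Bn * m) * (cr * rate))" using Tr by (intro mult_left_mono) auto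
      then show ?thesis unfolding q_def by (simp add: algebra_simps)
    qed
    have s5: "real T * (c * (\<beta> + \<alpha> / \<beta>)) \<le> c * q"
    proof -
      have "real T * (c * (\<beta> + \<alpha> / \<beta>)) \<le> real T * (c * (cr * rate))" using rt(6) c Tr by (intro mult_left_mono) auto
      then show ?thesis unfolding q_def by (simp add: mult_ac)
    qed
    have s6: "d T \<le> BD * q"
    proof -
      have "1 = real T * (1 / real T)" using Tr by simp
      also have "\<dots> \<le> q" unfolding q_def using rt(7) Tr by (intro mult_left_mono) auto
      finally have "BD * 1 \<le> BD * q" using BD(1) by (intro mult_left_mono) auto
      then show ?thesis using bdd[of T] by simp
    qed
    have "(\<Sum>t\<le>T. d t) = (\<Sum>t<T. d t) + d T" by (simp add: lessThan_Suc_atMost[symmetric])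
    also have "\<dots> \<le> 4 * (2 * BJ * q + \<kappa> * Be * q + (Bn * q + (Bn * G + 2 * Bn * m) * q) + c * q) + BD * q"
    proof (intro add_mono order_trans[OF S1] mult_left_mono s6)
      show "(\<Sum>t<T. n t) \<le> Bn * q + (Bn * G + 2 * Bn * m) * q" by (rule order_trans[OF sn add_mono[OF s3 s4]])
    qed (use s1 s2 s5 in auto)
    also have "\<dots> = real T * (K * rate)" unfolding K_def q_def by (simp add: algebra_simps)
    also have "\<dots> \<le> real (Suc T) * (K * rate)"
    proof (rule mult_right_mono)
      have "0 \<le> rate" unfolding rate_def using Tr by (intro add_nonneg_nonneg divide_nonneg_nonneg ln_ge_zero) auto
      then show "0 \<le> K * rate" using K0 by simp
    qed simp
    finally show "(\<Sum>t\<le>T. expectation (\<lambda>w. (norm (grad_J (clip R (run a b T t w))))\<^sup>2))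
      \<le> real (Suc T) * (K * (1 / real T powr (1 - a) + ln (real T) / real T powr (min b (a - b))))"
      unfolding d_def Y_def rate_def .
  qed
qed

text \<open>Constant stepsizes make the index uniform on 0, ..., T. Splitting over its value writes
  the output almost surely as a sum of indicators of the index times functions of the trajectory,
  and independence turns the mean into an average.\<close>

lemma output_expectation:
  assumes T: "0 < T" and R: "0 \<le> R" and bd: "\<And>t. t \<le> T \<Longrightarrow> AE w in M. run a b T t w \<in> iter_ball R"
    and out: "output_index M S st act (const_step a T) T idx"
  shows "integrable M (sq_grad_at_output \<mu> P \<gamma> r \<phi> \<pi> \<theta>0 \<omega>0 st act a b T idx)"
    and "expectation (sq_grad_at_output \<mu> P \<gamma> r \<phi> \<pi> \<theta>0 \<omega>0 st act a b T idx)
      = (\<Sum>t\<le>T. expectation (\<lambda>w. (norm (grad_J (clip R (run a b T t w))))\<^sup>2)) / real (Suc T)"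
proof -
  let ?out = "sq_grad_at_output \<mu> P \<gamma> r \<phi> \<pi> \<theta>0 \<omega>0 st act a b T idx"
  define A where "A = vimage_algebra (space M) idx (count_space UNIV)"
  define B where "B = vimage_algebra (space M) (\<lambda>w t. (st t w, act t w)) (Pi\<^sub>M UNIV (\<lambda>_. SA))"
  have ind: "indep_set (sets A) (sets B)"
    using out unfolding output_index_def A_def B_def by blast
  have subA: "subalgebra M A" and subB: "subalgebra M B"
    using indep_setD_ev1[OF ind] indep_setD_ev2[OF ind] by (auto simp: subalgebra_def A_def B_def)
  have idxA: "idx \<in> A \<rightarrow>\<^sub>M count_space UNIV"
    unfolding A_def by (rule measurable_vimage_algebra1) auto
  have idxM: "idx \<in> M \<rightarrow>\<^sub>M count_space UNIV" by (rule measurable_from_subalg[OF subA idxA])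
  have E: "{w \<in> space M. idx w = k} \<in> sets A" for k
  proof -
    have "{w \<in> space A. idx w = k} \<in> sets A" using idxA by measurable
    then show ?thesis by (simp add: A_def)
  qed
  have p: "prob {w \<in> space M. idx w = k} = 1 / real (Suc T)" if "k \<le> T" for k
    using out that T unfolding output_index_def by (simp add: const_step_def)
  have trajB: "(\<lambda>w t. (st t w, act t w)) \<in> B \<rightarrow>\<^sub>M Pi\<^sub>M UNIV (\<lambda>_. SA)"
    unfolding B_def by (rule measurable_vimage_algebra1) (auto simp: space_PiM st_in)
  have compB: "(\<lambda>w. (st t w, act t w)) \<in> B \<rightarrow>\<^sub>M SA" for t
    using measurable_compose[OF trajB measurable_component_singleton[of t UNIV "\<lambda>_. SA"]] by simp
  have stB: "st t \<in> B \<rightarrow>\<^sub>M SS" and actB: "act t \<in> B \<rightarrow>\<^sub>M count_space UNIV" for t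
    using measurable_compose[OF compB measurable_fst, of t] measurable_compose[OF compB measurable_snd, of t] by simp_all
  have spB: "space B = space M" by (simp add: B_def)
  \<comment> \<open>Each finite history lies in the \<sigma>-algebra of the whole trajectory, so the
    iterates are measurable for the side that is independent of the index.\<close>
  have HB: "subalgebra B (Hist n k)" for n k
    unfolding subalgebra_def space_Hist sets_Hist spB
    unfolding spB[symmetric]
    by (auto intro!: sets.sigma_sets_subset measurable_sets[OF stB] measurable_sets[OF actB])
  define V where "V t w = (norm (grad_J (clip R (run a b T t w))))\<^sup>2" for t w
  have reg_d: "reg_family Obs (iter_ball R) (\<lambda>x z. (norm (grad_J x))\<^sup>2)" for R
    unfolding power2_norm_eq_inner by (intro reg_family_inner reg_grad_J)
  obtain z where z: "z \<in> space Obs" using prob_space.not_empty[OF nu_prob] by (auto simp: space_nu space_Obs)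
  \<comment> \<open>A family constant in z is measurable in x alone: it is the section at any fixed
    observation.\<close>
  have gm: "(\<lambda>x. (norm (grad_J x))\<^sup>2) \<in> borel_measurable borel"
    using measurable_compose[OF measurable_Pair2'[OF z] reg_family_measurable[OF reg_d[of 0]]] by simp
  have runB: "run a b T t \<in> B \<rightarrow>\<^sub>M borel" for t by (rule measurable_from_subalg[OF HB run_Hist])
  have runM: "run a b T t \<in> M \<rightarrow>\<^sub>M borel" for t by (rule measurable_from_subalg[OF subB runB])
  have VB: "V t \<in> borel_measurable B" for t
    unfolding V_def by (rule measurable_compose[OF measurable_compose[OF runB clip_measurable] gm])
  have Vi: "integrable M (V t)" for t
    unfolding V_def
    by (rule expectation_reg_bound[OF reg_d measurable_compose[OF runM clip_measurable] clip_in[OF R]])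
  note prod = expectation_indep_indicator[OF ind subA subB E VB Vi]
  define F where "F w = (\<Sum>k\<le>T. indicator {w \<in> space M. idx w = k} w * V k w)" for w
  have Fi: "integrable M F" unfolding F_def by (intro Bochner_Integration.integrable_sum prod(1))
  have eqAE: "AE w in M. ?out w = F w"
  proof -
    have "AE w in M. \<forall>t\<in>{..T}. run a b T t w \<in> iter_ball R" by (rule AE_finite_allI) (use bd in auto)
    moreover have "AE w in M. idx w \<le> T" by (rule AE_index_le[OF idxM p])
    moreover have "AE w in M. w \<in> space M" by simp
    ultimately show ?thesis
    proof eventually_elim
      case (elim w)
      have "F w = (\<Sum>k\<le>T. if k = idx w then V k w else 0)"
        unfolding F_def using elim by (intro sum.cong) auto
      also have "\<dots> = V (idx w) w" using elim by simp
      also have "\<dots> = ?out w"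
        using elim by (simp add: V_def clip_def sq_grad_at_output_def gradient_J)
      finally show ?case ..
    qed
  qed
  have outM: "?out \<in> borel_measurable M"
  proof -
    have "(\<lambda>w. (norm (grad_J (run a b T (idx w) w)))\<^sup>2) \<in> borel_measurable M"
      by (rule measurable_compose_countable[OF measurable_compose[OF runM gm] idxM])
    then show ?thesis by (simp add: sq_grad_at_output_def[abs_def] gradient_J)
  qed
  show "integrable M ?out"
    using Fi integrable_cong_AE[OF outM borel_measurable_integrable[OF Fi] eqAE] by simp
  have "expectation ?out = expectation F"
    by (rule integral_cong_AE[OF outM borel_measurable_integrable[OF Fi] eqAE])
  also have "\<dots> = (\<Sum>k\<le>T. expectation (\<lambda>w. indicator {w \<in> space M. idx w = k} w * V k w))"
    unfolding F_def by (rule Bochner_Integration.integral_sum) (rule prod(1))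
  also have "\<dots> = (\<Sum>k\<le>T. (1 / real (Suc T)) * expectation (V k))"
    by (intro sum.cong refl) (simp add: prod(2) p)
  also have "\<dots> = (\<Sum>t\<le>T. expectation (V t)) / real (Suc T)"
    by (simp add: sum_divide_distrib)
  finally show "expectation ?out = (\<Sum>t\<le>T. expectation (\<lambda>w. (norm (grad_J (clip R (run a b T t w))))\<^sup>2)) / real (Suc T)"
    unfolding V_def .
qed

lemma output_rate:
  assumes ab: "1/2 < a" "a \<le> 1" "0 < b" "b \<le> a"
    and bounded: "gq_bounded M \<gamma> r \<phi> \<pi> \<theta>0 \<omega>0 st act a b"
  shows "\<exists>K. \<forall>T\<ge>2. \<forall>idx. output_index M S st act (const_step a T) T idx \<longrightarrow>
     integrable M (sq_grad_at_output \<mu> P \<gamma> r \<phi> \<pi> \<theta>0 \<omega>0 st act a b T idx) \<and>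
     expectation (sq_grad_at_output \<mu> P \<gamma> r \<phi> \<pi> \<theta>0 \<omega>0 st act a b T idx)
       \<le> K * (1 / real T powr (1 - a) + ln (real T) / real T powr (min b (a - b)))"
proof -
  obtain R0 where R0: "\<And>T t. 2 \<le> T \<Longrightarrow> t \<le> T \<Longrightarrow>
      AE w in M. norm (fst (run a b T t w)) \<le> R0 \<and> norm (snd (run a b T t w)) \<le> R0"
    using bounded unfolding gq_bounded_def by blast
  \<comment> \<open>The absolute value supplies the nonnegative radius that clipping
    requires.\<close>
  have bd: "AE w in M. run a b T t w \<in> iter_ball \<bar>R0\<bar>" if "2 \<le> T" "t \<le> T" for T t
    using R0[OF that] by eventually_elim (auto simp: in_iter_ball)
  obtain K where K: "\<And>T. 2 \<le> T \<Longrightarrow> (\<Sum>t\<le>T. expectation (\<lambda>w. (norm (grad_J (clip \<bar>R0\<bar> (run a b T t w))))\<^sup>2))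
      \<le> real (Suc T) * (K * (1 / real T powr (1 - a) + ln (real T) / real T powr (min b (a - b))))"
    using mean_square_gradient_bound[OF ab abs_ge_zero bd] by blast
  show ?thesis
  proof (intro exI[of _ K] allI impI conjI)
    fix T idx assume T: "2 \<le> T" and out: "output_index M S st act (const_step a T) T idx"
    have T0: "0 < T" using T by simp
    note oe = output_expectation[OF T0 abs_ge_zero bd[OF T] out]
    show "integrable M (sq_grad_at_output \<mu> P \<gamma> r \<phi> \<pi> \<theta>0 \<omega>0 st act a b T idx)" by (rule oe(1))
    have "expectation (sq_grad_at_output \<mu> P \<gamma> r \<phi> \<pi> \<theta>0 \<omega>0 st act a b T idx)
      \<le> real (Suc T) * (K * (1 / real T powr (1 - a) + ln (real T) / real T powr (min b (a - b)))) / real (Suc T)"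
      by (rule order_trans[OF eq_refl[OF oe(2)] divide_right_mono[OF K[OF T]]]) simp_all
    then show "expectation (sq_grad_at_output \<mu> P \<gamma> r \<phi> \<pi> \<theta>0 \<omega>0 st act a b T idx)
       \<le> K * (1 / real T powr (1 - a) + ln (real T) / real T powr (min b (a - b)))" by simp
  qed
qed

end

text \<open>K is chosen before T and the index, so it depends on neither. Integrability is claimed
  together with each bound because the Bochner integral of a non-integrable function is 0 by
  convention. Each rate assumes bounded iterates for its own pair of exponents.\<close>

theorem corollary1:
  fixes S :: "(real^'d) set"
    and P :: "(real^'d) \<times> 'a::finite \<Rightarrow> (real^'d) measure"
    and \<gamma> r_max m \<rho> k1 k2 :: real
    and r :: "real^'d \<Rightarrow> 'a \<Rightarrow> real^'d \<Rightarrow> real"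
    and \<phi> :: "real^'d \<Rightarrow> 'a \<Rightarrow> real^'n"
    and \<pi>b :: "real^'d \<Rightarrow> 'a pmf"
    and \<pi> :: "real^'n \<Rightarrow> real^'d \<Rightarrow> 'a pmf"
    and \<mu> :: "((real^'d) \<times> 'a) measure"
    and s0 :: "real^'d"
    and \<theta>0 \<omega>0 :: "real^'n"
    and M :: "'w measure"
    and st :: "nat \<Rightarrow> 'w \<Rightarrow> real^'d"
    and act :: "nat \<Rightarrow> 'w \<Rightarrow> 'a"
  assumes P_kernel: "P \<in> sa_space S \<rightarrow>\<^sub>M prob_algebra (state_space S)"
    and discount: "0 < \<gamma>" "\<gamma> < 1"
    and r_meas: "(\<lambda>((s, a), s'). r s a s') \<in> borel_measurable (sa_space S \<Otimes>\<^sub>M state_space S)"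
    and r_bound: "\<And>s a s'. s \<in> S \<Longrightarrow> s' \<in> S \<Longrightarrow> 0 \<le> r s a s' \<and> r s a s' \<le> r_max"
    and phi_meas: "\<And>a. (\<lambda>s. \<phi> s a) \<in> borel_measurable (state_space S)"
    and behaviour_meas: "\<And>a. (\<lambda>s. pmf (\<pi>b s) a) \<in> borel_measurable (state_space S)"
    and target_meas: "\<And>\<theta> a. (\<lambda>s. pmf (\<pi> \<theta> s) a) \<in> borel_measurable (state_space S)"
    and target_diff: "\<And>\<theta> s a. s \<in> S \<Longrightarrow> (\<lambda>\<theta>'. pmf (\<pi> \<theta>' s) a) differentiable (at \<theta>)"
    and ergodic: "uniformly_ergodic (sa_space S) (sa_kernel S P \<pi>b) \<mu>"
    and s0_in: "s0 \<in> S"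
    and M_prob: "prob_space M"
    and traj: "trajectory M S P \<pi>b s0 st act"
    and C_nonsingular: "invertible (feature_cov \<mu> \<phi>)"
    and phi_bound: "\<And>s a. s \<in> S \<Longrightarrow> norm (\<phi> s a) \<le> 1"
    and mixing_const: "0 < m" "0 < \<rho>" "\<rho> < 1"
    and mixing: "\<And>t s. 0 < t \<Longrightarrow> s \<in> S \<Longrightarrow>
      tv_dist (kernel_pow (state_space S) (state_kernel P \<pi>b) t s)
              (distr \<mu> (state_space S) fst) \<le> m * \<rho> ^ t"
    and target_grad_bound: "\<And>\<theta> s a. s \<in> S \<Longrightarrow>
      norm (gradient (\<lambda>\<theta>'. pmf (\<pi> \<theta>' s) a) \<theta>) \<le> k1"
    and target_grad_lipschitz: "\<And>\<theta>1 \<theta>2 s a. s \<in> S \<Longrightarrow>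
      norm (gradient (\<lambda>\<theta>'. pmf (\<pi> \<theta>' s) a) \<theta>1 - gradient (\<lambda>\<theta>'. pmf (\<pi> \<theta>' s) a) \<theta>2)
        \<le> k2 * norm (\<theta>1 - \<theta>2)"
  shows
    "(\<forall>a b :: real. 1/2 < a \<and> a \<le> 1 \<and> 0 < b \<and> b \<le> a \<and>
        gq_bounded M \<gamma> r \<phi> \<pi> \<theta>0 \<omega>0 st act a b \<longrightarrow>
        (\<exists>K. \<forall>T\<ge>2. \<forall>idx. output_index M S st act (const_step a T) T idx \<longrightarrow>
           integrable M (sq_grad_at_output \<mu> P \<gamma> r \<phi> \<pi> \<theta>0 \<omega>0 st act a b T idx) \<and>
           (LINT w|M. sq_grad_at_output \<mu> P \<gamma> r \<phi> \<pi> \<theta>0 \<omega>0 st act a b T idx w)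
             \<le> K * (1 / real T powr (1 - a) + ln (real T) / real T powr (min b (a - b)))))
     \<and> is_arg_max (\<lambda>(a, b). min (1 - a) (min b (a - b)))
         (\<lambda>(a, b). 1/2 < a \<and> a \<le> 1 \<and> 0 < b \<and> b \<le> a) (2/3 :: real, 1/3 :: real)
     \<and> (gq_bounded M \<gamma> r \<phi> \<pi> \<theta>0 \<omega>0 st act (2/3) (1/3) \<longrightarrow>
        (\<exists>K. \<forall>T\<ge>2. \<forall>idx. output_index M S st act (const_step (2/3) T) T idx \<longrightarrow>
           integrable M (sq_grad_at_output \<mu> P \<gamma> r \<phi> \<pi> \<theta>0 \<omega>0 st act (2/3) (1/3) T idx) \<and>
           (LINT w|M. sq_grad_at_output \<mu> P \<gamma> r \<phi> \<pi> \<theta>0 \<omega>0 st act (2/3) (1/3) T idx w)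
             \<le> K * (ln (real T) / real T powr (1/3))))"
proof (intro conjI impI, goal_cases)
  interpret M: prob_space M by (rule M_prob)
  have inv: "invariant_measure (sa_space S) (sa_kernel S P \<pi>b) \<mu>"
    using ergodic by (simp add: uniformly_ergodic_def)
  interpret greedy_gq_run S P \<pi>b \<gamma> r_max k1 k2 r \<phi> \<pi> \<mu> M s0 st act m \<rho> \<theta>0 \<omega>0
    by unfold_locales (fact P_kernel behaviour_meas inv discount r_meas r_bound phi_meas target_meas target_diff
      C_nonsingular phi_bound target_grad_bound target_grad_lipschitz traj mixing_const mixing)+
  {
    case 1
    then show ?case using output_rate by blast
  next
    case 2
    \<comment> \<open>The exponents 1 - a, b and a - b add up to 1, so their minimum is at most 1/3,
      with equality when all three agree.\<close>
    then show ?case by (auto simp: is_arg_max_def min_def)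
  next
    case 3
    obtain K where K: "\<And>T idx. 2 \<le> T \<Longrightarrow> output_index M S st act (const_step (2/3) T) T idx \<Longrightarrow>
           integrable M (sq_grad_at_output \<mu> P \<gamma> r \<phi> \<pi> \<theta>0 \<omega>0 st act (2/3) (1/3) T idx) \<and>
           (LINT w|M. sq_grad_at_output \<mu> P \<gamma> r \<phi> \<pi> \<theta>0 \<omega>0 st act (2/3) (1/3) T idx w)
             \<le> K * (1 / real T powr (1/3) + ln (real T) / real T powr (1/3))"
      using output_rate[OF _ _ _ _ 3] by auto
    \<comment> \<open>The term without logarithm is absorbed through 1 \<le> ln T / ln 2; the
      absolute value is taken because the sign of K is unknown.\<close>
    have le: "K * (1 / real T powr (1/3) + ln (real T) / real T powr (1/3))
        \<le> \<bar>K\<bar> * (1 / ln 2 + 1) * (ln (real T) / real T powr (1/3))" if T: "2 \<le> T" for T :: nat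
    proof -
      define p where "p = real T powr (1/3)"
      have p: "0 < p" using T by (simp add: p_def)
      have "ln 2 \<le> ln (real T)" using T by simp
      then have "1 / p \<le> (1 / ln 2) * (ln (real T) / p)"
        using p by (simp add: field_simps)
      then have "1 / p + ln (real T) / p \<le> (1 / ln 2 + 1) * (ln (real T) / p)"
        unfolding distrib_right by linarith
      moreover have "0 \<le> 1 / p + ln (real T) / p" using p T by simp
      ultimately have "K * (1 / p + ln (real T) / p) \<le> \<bar>K\<bar> * ((1 / ln 2 + 1) * (ln (real T) / p))"
        by (intro mult_mono) auto
      then show ?thesis by (simp add: p_def mult.assoc)
    qed
    show ?case
      by (intro exI[of _ "\<bar>K\<bar> * (1 / ln 2 + 1)"] allI impI conjI)
        (use K in blast, use K le order_trans in blast)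
  }
qed

end
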